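(* Let $\zeta$ be a primitive root of unity, $k\in\mathbb N$, and suppose $q\to\zeta$ radially within the unit disk: (a) If $\zeta$ has order $4k$, then $\lim_{q\to\zeta}\big(\phi(q) - B(\phi;q)\big) = -2\zeta \sum_{n=0}^{k-1} \zeta^n (-\zeta^2; \zeta^2)_n$. (b) If $\zeta$ has order $2k-1$, then $\lim_{q\to\zeta}\big(\psi(q) - B(\psi;q)\big) = -\sum_{n=0}^{k-1} (-1)^n (\zeta; \zeta^2)_n$. (c) If $\zeta$ has order $4k-2$, then $\lim_{q\to\zeta} \big(\nu(q) - B(\nu;q)\big) = -\sum_{n=0}^{k-1} \zeta^n (-\zeta; \zeta^2)_n$. Moreover, for $M\in\{\phi,\psi,\nu\}$, $B(M;q)$ is a modular form of weight $1/2$ and level $\Gamma_0(4)$.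
   Context: Let $q=e^{2\pi i\tau}$ with $\tau$ in the upper half-plane, $(a;q)_\infty=\prod_{j\ge0}(1-aq^j)$ and $(a;q)_n=(a;q)_\infty/(aq^n;q)_\infty$ for all $n\in\mathbb Z$. The 3rd order mock theta functions considered are $\phi(q)=\sum_{n\ge0} q^{n^2}/(-q^2;q^2)_n$, $\psi(q)=\sum_{n\ge1} q^{n^2}/(q;q^2)_n$, $\nu(q)=\sum_{n\ge0} q^{n(n+1)}/(-q;q^2)_{n+1}$. For $M(q)=\sum_{n}c(n;q)$ (sum over the indicated nonnegative range), the associated bilateral series is $B(M;q)=\sum_{n\in\mathbb Z}c(n;q)$, negative-index summands interpreted via the definition of $(a;q)_n$ for negative $n$; one has $B(\phi;q)=\phi(q)+2\psi(q)=2B(\psi;q)$ and $B(\nu;q)=\nu(q)+\nu(-q)$. "Modular form" means modular up to a rational power of $q$ with respect to some character.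
   Formalization: The bilateral series B(ψ;q) diverges for 0<|q|<1, so it is read as the Cesàro limit of its symmetric partial sums, which gives ψ(q)+φ(q)/2; "modular form" allows poles at the cusps (holomorphic on the upper half-plane, meromorphic at cusps, unitary multiplier). *)

theory Defs
  imports "HOL-Complex_Analysis.Complex_Analysis"
begin

section \<open>\<open>q\<close>-Pochhammer symbols\<close>

definition qpoch_inf :: "complex \<Rightarrow> complex \<Rightarrow> complex" where
  "qpoch_inf a q = (\<Prod>j. 1 - a * q ^ j)"

definition qpoch :: "complex \<Rightarrow> complex \<Rightarrow> int \<Rightarrow> complex" where
  "qpoch a q n = qpoch_inf a q / qpoch_inf (a * q powi n) q"

text \<open>
  The infinite products only make sense for \<open>|q| < 1\<close>. At roots of unity, \<open>(a;q)\<^sub>n\<close> with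
  \<open>n \<ge> 0\<close> is the finite product that the quotient telescopes to (see \<open>qpoch_of_nat\<close> below).
\<close>

definition qpoch_fin :: "complex \<Rightarrow> complex \<Rightarrow> nat \<Rightarrow> complex" where
  "qpoch_fin a q n = (\<Prod>j<n. 1 - a * q ^ j)"

lemma convergent_qpoch_inf:
  fixes a q :: complex
  assumes "norm q < 1"
  shows "convergent_prod (\<lambda>j. 1 - a * q ^ j)"
proof -
  have "summable (\<lambda>j. norm (- a * q ^ j))"
    using summable_mult[OF summable_geometric[of "norm q"], of "norm a"] assms
    by (simp add: norm_mult norm_power)
  hence "convergent_prod (\<lambda>j. 1 + (- a * q ^ j))"
    by (intro abs_convergent_prod_imp_convergent_prod)
       (simp add: abs_convergent_prod_conv_summable)
  thus ?thesis by simp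
qed

lemma qpoch_of_nat:
  assumes "norm q < 1" and "\<And>j. a * q ^ j \<noteq> 1"
  shows "qpoch a q (int n) = qpoch_fin a q n"
proof -
  have nz: "1 - a * q ^ j \<noteq> 0" for j using assms(2)[of j] by auto
  have conv: "convergent_prod (\<lambda>j. 1 - a * q ^ j)"
    by (rule convergent_qpoch_inf[OF assms(1)])
  have eq: "qpoch_inf a q = qpoch_inf (a * q powi int n) q * qpoch_fin a q n"
    using prodinf_split_initial_segment[OF conv nz, of n]
    by (simp add: qpoch_inf_def qpoch_fin_def power_add mult_ac)
  have "qpoch_inf a q \<noteq> 0"
    unfolding qpoch_inf_def using prodinf_nonzero[OF conv] nz by blast
  with eq show ?thesis by (auto simp: qpoch_def field_simps)
qed


section \<open>Mock theta functions and bilateral series\<close>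

definition c_phi :: "complex \<Rightarrow> int \<Rightarrow> complex" where
  "c_phi q n = q powi (n\<^sup>2) / qpoch (- (q\<^sup>2)) (q\<^sup>2) n"

definition c_psi :: "complex \<Rightarrow> int \<Rightarrow> complex" where
  "c_psi q n = q powi (n\<^sup>2) / qpoch q (q\<^sup>2) n"

definition c_nu :: "complex \<Rightarrow> int \<Rightarrow> complex" where
  "c_nu q n = q powi (n * (n + 1)) / qpoch (- q) (q\<^sup>2) (n + 1)"

definition mock_phi :: "complex \<Rightarrow> complex" where
  "mock_phi q = (\<Sum>\<^sub>\<infinity>n\<in>{0..}. c_phi q n)"

definition mock_psi :: "complex \<Rightarrow> complex" where
  "mock_psi q = (\<Sum>\<^sub>\<infinity>n\<in>{1..}. c_psi q n)"

definition mock_nu :: "complex \<Rightarrow> complex" where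
  "mock_nu q = (\<Sum>\<^sub>\<infinity>n\<in>{0..}. c_nu q n)"

text \<open>
  For \<open>\<phi>\<close> and \<open>\<nu>\<close> the bilateral series converge absolutely for \<open>0 < |q| < 1\<close>. For \<open>\<psi>\<close> the summand
  at \<open>n = -m\<close> is \<open>(-1)\<^sup>m (q;q\<^sup>2)\<^sub>m\<close>, which does not tend to \<open>0\<close>, so the series diverges; it is
  Cesaro summable, and that is the value for which \<open>2 B(\<psi>;q) = \<phi>(q) + 2 \<psi>(q)\<close>. Hence a bilateral
  series denotes its ordinary sum when it converges unconditionally, and otherwise the limit of the
  Cesaro means of its symmetric partial sums.
\<close>

definition cesaro_bilateral_sum :: "(int \<Rightarrow> complex) \<Rightarrow> complex" where
  "cesaro_bilateral_sum c =
     lim (\<lambda>N::nat. (\<Sum>K\<le>N. \<Sum>n=-int K..int K. c n) / of_nat (N + 1))"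

definition bilateral_sum :: "(int \<Rightarrow> complex) \<Rightarrow> complex" where
  "bilateral_sum c =
     (if c summable_on UNIV then \<Sum>\<^sub>\<infinity>n\<in>UNIV. c n else cesaro_bilateral_sum c)"

definition B_phi :: "complex \<Rightarrow> complex" where
  "B_phi q = bilateral_sum (c_phi q)"

definition B_psi :: "complex \<Rightarrow> complex" where
  "B_psi q = bilateral_sum (c_psi q)"

definition B_nu :: "complex \<Rightarrow> complex" where
  "B_nu q = bilateral_sum (c_nu q)"


section \<open>Roots of unity and radial limits\<close>

definition primitive_root_of_unity :: "nat \<Rightarrow> complex \<Rightarrow> bool" where
  "primitive_root_of_unity m \<zeta> \<longleftrightarrow>
     m > 0 \<and> \<zeta> ^ m = 1 \<and> (\<forall>j. 0 < j \<and> j < m \<longrightarrow> \<zeta> ^ j \<noteq> 1)"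

definition has_radial_limit :: "(complex \<Rightarrow> complex) \<Rightarrow> complex \<Rightarrow> complex \<Rightarrow> bool" where
  "has_radial_limit f \<zeta> L \<longleftrightarrow> ((\<lambda>r::real. f (of_real r * \<zeta>)) \<longlongrightarrow> L) (at_left 1)"


section \<open>Modular forms of real weight with multiplier\<close>

definition upper_half_plane :: "complex set" where
  "upper_half_plane = {\<tau>. Im \<tau> > 0}"

definition SL2Z :: "(int^2^2) set" where
  "SL2Z = {A. det A = 1}"

definition Gamma0 :: "nat \<Rightarrow> (int^2^2) set" where
  "Gamma0 N = {A \<in> SL2Z. int N dvd A $ 2 $ 1}"

definition moebius_act :: "int^2^2 \<Rightarrow> complex \<Rightarrow> complex" where
  "moebius_act A \<tau> = (of_int (A $ 1 $ 1) * \<tau> + of_int (A $ 1 $ 2)) /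
                      (of_int (A $ 2 $ 1) * \<tau> + of_int (A $ 2 $ 2))"

text \<open>The power \<open>(c\<tau> + d)\<^sup>k\<close> is taken with the principal branch, argument in \<open>(-\<pi>, \<pi>]\<close>.\<close>

definition automorphy :: "real \<Rightarrow> int^2^2 \<Rightarrow> complex \<Rightarrow> complex" where
  "automorphy k A \<tau> =
     (of_int (A $ 2 $ 1) * \<tau> + of_int (A $ 2 $ 2)) powr complex_of_real k"

text \<open>
  For half-integral weight, the character of a modular form is a unitary multiplier system: it is
  multiplicative up to the cocycle coming from the choice of branch in \<open>(c\<tau> + d)\<^sup>k\<close>, and two of the
  same weight differ by a genuine character of the group.
\<close>

definition multiplier_system :: "real \<Rightarrow> (int^2^2) set \<Rightarrow> (int^2^2 \<Rightarrow> complex) \<Rightarrow> bool" where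
  "multiplier_system k \<Gamma> v \<longleftrightarrow>
     (\<forall>A\<in>\<Gamma>. norm (v A) = 1) \<and>
     (\<forall>A\<in>\<Gamma>. \<forall>B\<in>\<Gamma>. \<forall>\<tau>\<in>upper_half_plane.
        v (A ** B) * automorphy k (A ** B) \<tau> =
        v A * v B * automorphy k A (moebius_act B \<tau>) * automorphy k B \<tau>)"

text \<open>
  Meromorphy at the cusps: for every \<open>A\<close> in \<open>SL\<^sub>2(\<int>)\<close>, the transform \<open>f|\<^sub>k A\<close> has a Laurent
  expansion with finite principal part in \<open>e\<^bsup>2\<pi>i\<tau>/N\<^esup>\<close> for some \<open>N\<close>. Holomorphy at the cusps cannot
  be required: the bilateral series of third order mock theta functions considered here are
  (up to powers of \<open>q\<close>) eta quotients with poles at cusps of \<open>\<Gamma>\<^sub>0(4)\<close>.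
\<close>

definition meromorphic_at_cusps :: "real \<Rightarrow> (complex \<Rightarrow> complex) \<Rightarrow> bool" where
  "meromorphic_at_cusps k f \<longleftrightarrow>
     (\<forall>A\<in>SL2Z. \<exists>N::nat. N > 0 \<and> (\<exists>g. g meromorphic_on {0} \<and>
        (\<forall>\<tau>\<in>upper_half_plane.
           f (moebius_act A \<tau>) / automorphy k A \<tau> =
           g (exp (2 * of_real pi * \<i> * \<tau> / of_nat N)))))"

definition modular_form ::
  "real \<Rightarrow> (int^2^2) set \<Rightarrow> (int^2^2 \<Rightarrow> complex) \<Rightarrow> (complex \<Rightarrow> complex) \<Rightarrow> bool" where
  "modular_form k \<Gamma> v f \<longleftrightarrow>
     multiplier_system k \<Gamma> v \<and>
     f holomorphic_on upper_half_plane \<and>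
     (\<forall>A\<in>\<Gamma>. \<forall>\<tau>\<in>upper_half_plane. f (moebius_act A \<tau>) = v A * automorphy k A \<tau> * f \<tau>) \<and>
     meromorphic_at_cusps k f"

definition modular_up_to_q_power ::
  "real \<Rightarrow> (int^2^2) set \<Rightarrow> (complex \<Rightarrow> complex) \<Rightarrow> bool" where
  "modular_up_to_q_power k \<Gamma> F \<longleftrightarrow>
     (\<exists>(r::rat) v. modular_form k \<Gamma> v
        (\<lambda>\<tau>. exp (2 * of_real pi * \<i> * of_rat r * \<tau>) * F (exp (2 * of_real pi * \<i> * \<tau>))))"

end

(*
  For n < 0 the summands of the three bilateral series are, up to elementary factors, finite products
  (a;q^2)_m. So M(q) - B(M;q) is a one-sided series of such products; at the roots of unity in
  question the products vanish from m = k on, and near them they are O((1 - |q|)^2) for large m,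
  uniformly in m, so the radial limit may be taken termwise.

  For the modularity, L(b) = sum_n (-x)^n q^(n(n-1)/2) (b q^n;q)_inf satisfies
  (1 - b/x) L(b) = L(bq). Iterating this expresses L(b) by L(0), and L(0) by L(q), which is Euler's
  series; L(b) = (q, x, q/x; q)_inf / (b/x; q)_inf follows and turns the bilateral series into
  quotients of eta(tau), eta(2 tau), eta(4 tau). A holomorphic function of constant modulus on the
  half-plane is constant, so it suffices to know that |eta(tau)|^4 Im(tau) is invariant under SL_2(Z).
  For tau -> -1/tau, Liouville's theorem gives theta(z/tau; -1/tau) = c exp(quadratic in z)
  theta(z; tau); comparing derivatives at z = 0 and values at the three half-periods gives |c|.
*)

theory Submission
  imports Defs
begin

section \<open>Infinite \<open>q\<close>-Pochhammer symbols\<close>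

lemma qpoch_inf_LIMSEQ:
  assumes "norm q < 1"
  shows "(\<lambda>n. qpoch_fin a q n) \<longlonglongrightarrow> qpoch_inf a q"
  using convergent_prod_LIMSEQ[OF convergent_qpoch_inf[OF assms, of a]]
  unfolding qpoch_fin_def qpoch_inf_def by (simp add: LIMSEQ_lessThan_iff_atMost)

lemma qpoch_fin_0 [simp]: "qpoch_fin a q 0 = 1"
  by (simp add: qpoch_fin_def)

lemma qpoch_fin_Suc: "qpoch_fin a q (Suc n) = qpoch_fin a q n * (1 - a * q ^ n)"
  by (simp add: qpoch_fin_def)

lemma qpoch_fin_Suc_shift: "qpoch_fin a q (Suc n) = (1 - a) * qpoch_fin (a * q) q n"
  unfolding qpoch_fin_def by (subst prod.lessThan_Suc_shift) (simp add: mult_ac)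

lemma qpoch_inf_step:
  assumes "norm q < 1"
  shows "qpoch_inf a q = (1 - a) * qpoch_inf (a * q) q"
proof (rule LIMSEQ_unique)
  show "(\<lambda>n. qpoch_fin a q (Suc n)) \<longlonglongrightarrow> qpoch_inf a q"
    by (rule LIMSEQ_Suc[OF qpoch_inf_LIMSEQ[OF assms]])
  show "(\<lambda>n. qpoch_fin a q (Suc n)) \<longlonglongrightarrow> (1 - a) * qpoch_inf (a * q) q"
    unfolding qpoch_fin_Suc_shift by (intro tendsto_intros qpoch_inf_LIMSEQ assms)
qed

lemma qpoch_inf_0 [simp]: "qpoch_inf 0 q = 1"
  by (simp add: qpoch_inf_def)

lemma qpoch_inf_split:
  assumes "norm q < 1"
  shows "qpoch_inf a q = qpoch_fin a q n * qpoch_inf (a * q ^ n) q"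
proof (induction n)
  case (Suc n)
  then show ?case
    using qpoch_inf_step[OF assms, of "a * q ^ n"] by (simp add: qpoch_fin_Suc mult_ac)
qed auto

lemma qpoch_inf_eq_0_iff:
  assumes "norm q < 1"
  shows "qpoch_inf a q = 0 \<longleftrightarrow> (\<exists>j. a * q ^ j = 1)"
proof
  assume "qpoch_inf a q = 0"
  then show "\<exists>j. a * q ^ j = 1"
    using prodinf_nonzero[OF convergent_qpoch_inf[OF assms, of a]]
    unfolding qpoch_inf_def by (metis eq_iff_diff_eq_0)
next
  assume "\<exists>j. a * q ^ j = 1"
  then obtain j where "a * q ^ j = 1" by blast
  then show "qpoch_inf a q = 0"
    using qpoch_inf_split[OF assms, of a "Suc j"] by (simp add: qpoch_fin_Suc)
qed

lemma qpoch_inf_nonzero_of_norm: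
  assumes "norm q < 1" "norm a < 1"
  shows "qpoch_inf a q \<noteq> 0"
proof -
  have "a * q ^ j \<noteq> 1" for j
  proof
    assume "a * q ^ j = 1"
    then have "norm a * norm q ^ j = 1" by (metis norm_mult norm_one norm_power)
    moreover have "norm a * norm q ^ j \<le> norm a * 1"
      using assms by (intro mult_left_mono power_le_one) auto
    ultimately show False using assms by simp
  qed
  then show ?thesis using qpoch_inf_eq_0_iff[OF assms(1)] by blast
qed

lemma norm_qpoch_inf_le:
  assumes q: "norm q < 1" and a: "norm a \<le> B"
  shows "norm (qpoch_inf a q) \<le> exp (B / (1 - norm q))"
proof -
  have B: "0 \<le> B" using a norm_ge_zero[of a] by linarith
  have "norm (qpoch_fin a q n) \<le> exp (B / (1 - norm q))" for n
  proof -
    have "norm (qpoch_fin a q n) = (\<Prod>j<n. norm (1 - a * q ^ j))"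
      by (simp add: qpoch_fin_def prod_norm)
    also have "\<dots> \<le> (\<Prod>j<n. 1 + B * norm q ^ j)"
    proof (intro prod_mono conjI norm_ge_zero)
      fix j
      have "norm (1 - a * q ^ j) \<le> 1 + norm a * norm q ^ j"
        using norm_triangle_ineq4[of 1 "a * q ^ j"] by (simp add: norm_mult norm_power)
      also have "norm a * norm q ^ j \<le> B * norm q ^ j"
        using a by (intro mult_right_mono) auto
      finally show "norm (1 - a * q ^ j) \<le> 1 + B * norm q ^ j" by simp
    qed
    also have "\<dots> \<le> exp (\<Sum>j<n. B * norm q ^ j)"
      using B by (intro prod_le_exp_sum) auto
    also have "(\<Sum>j<n. B * norm q ^ j) \<le> B / (1 - norm q)"
    proof -
      have "(\<Sum>j<n. norm q ^ j) \<le> (\<Sum>j. norm q ^ j)"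
        using q by (intro sum_le_suminf summable_geometric) auto
      also have "\<dots> = 1 / (1 - norm q)" using q by (simp add: suminf_geometric)
      finally show ?thesis
        using B mult_left_mono[of "\<Sum>j<n. norm q ^ j" "1 / (1 - norm q)" B]
        by (simp add: sum_distrib_left)
    qed
    finally show ?thesis by simp
  qed
  then show ?thesis
    using LIMSEQ_le_const2[OF tendsto_norm[OF qpoch_inf_LIMSEQ[OF q, of a]]] by blast
qed

lemma qpoch_inf_dissect:
  assumes "norm q < 1"
  shows "qpoch_inf a q = qpoch_inf a (q\<^sup>2) * qpoch_inf (a * q) (q\<^sup>2)"
proof (rule LIMSEQ_unique)
  have q2: "norm (q\<^sup>2) < 1" using assms by (simp add: norm_power power_less_one_iff)
  have eq: "qpoch_fin a q (2 * n) = qpoch_fin a (q\<^sup>2) n * qpoch_fin (a * q) (q\<^sup>2) n" for n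
    by (induction n) (auto simp: qpoch_fin_Suc mult_ac simp flip: power_mult)
  have "strict_mono (\<lambda>n::nat. 2 * n)" by (auto simp: strict_mono_def)
  from LIMSEQ_subseq_LIMSEQ[OF qpoch_inf_LIMSEQ[OF assms, of a] this]
  show "(\<lambda>n. qpoch_fin a q (2 * n)) \<longlonglongrightarrow> qpoch_inf a q" by (simp add: o_def)
  show "(\<lambda>n. qpoch_fin a q (2 * n)) \<longlonglongrightarrow> qpoch_inf a (q\<^sup>2) * qpoch_inf (a * q) (q\<^sup>2)"
    unfolding eq by (intro tendsto_intros qpoch_inf_LIMSEQ q2)
qed

lemma qpoch_inf_mult_uminus:
  assumes "norm q < 1"
  shows "qpoch_inf a q * qpoch_inf (- a) q = qpoch_inf (a\<^sup>2) (q\<^sup>2)"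
proof (rule LIMSEQ_unique)
  have q2: "norm (q\<^sup>2) < 1" using assms by (simp add: norm_power power_less_one_iff)
  have eq: "qpoch_fin a q n * qpoch_fin (- a) q n = qpoch_fin (a\<^sup>2) (q\<^sup>2) n" for n
    unfolding qpoch_fin_def prod.distrib[symmetric]
    by (intro prod.cong) (auto simp: algebra_simps power2_eq_square power_mult_distrib)
  show "(\<lambda>n. qpoch_fin (a\<^sup>2) (q\<^sup>2) n) \<longlonglongrightarrow> qpoch_inf (a\<^sup>2) (q\<^sup>2)"
    by (rule qpoch_inf_LIMSEQ[OF q2])
  show "(\<lambda>n. qpoch_fin (a\<^sup>2) (q\<^sup>2) n) \<longlonglongrightarrow> qpoch_inf a q * qpoch_inf (- a) q"
    unfolding eq[symmetric] by (intro tendsto_intros qpoch_inf_LIMSEQ assms)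
qed

lemma holomorphic_on_qpoch_inf:
  assumes f: "f holomorphic_on S" and g: "g holomorphic_on S" and S: "open S"
    and g1: "\<And>z. z \<in> S \<Longrightarrow> norm (g z) < 1"
  shows "(\<lambda>z. qpoch_inf (f z) (g z)) holomorphic_on S"
proof (rule holomorphic_uniform_sequence[OF S])
  show "(\<lambda>z. qpoch_fin (f z) (g z) n) holomorphic_on S" for n
    unfolding qpoch_fin_def by (intro holomorphic_intros f g)
  fix z0 assume "z0 \<in> S"
  then obtain d where d: "d > 0" "cball z0 d \<subseteq> S" using S open_contains_cball by blast
  let ?K = "cball z0 d"
  have cont: "continuous_on ?K f" "continuous_on ?K g"
    using f g d(2) by (meson continuous_on_subset holomorphic_on_imp_continuous_on)+
  have "bounded (f ` ?K)"
    by (intro compact_imp_bounded compact_continuous_image cont) auto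
  then obtain B where B: "B > 0" "\<And>z. z \<in> ?K \<Longrightarrow> norm (f z) \<le> B"
    unfolding bounded_pos by auto
  have "\<exists>x\<in>?K. \<forall>y\<in>?K. norm (g y) \<le> norm (g x)"
    using d by (intro continuous_attains_sup continuous_intros cont) auto
  then obtain x where x: "x \<in> ?K" "\<And>y. y \<in> ?K \<Longrightarrow> norm (g y) \<le> norm (g x)" by blast
  define \<rho> where "\<rho> = norm (g x)"
  have \<rho>: "0 \<le> \<rho>" "\<rho> < 1" "\<And>y. y \<in> ?K \<Longrightarrow> norm (g y) \<le> \<rho>"
    using x d g1 by (auto simp: \<rho>_def)
  have "uniformly_convergent_on ?K (\<lambda>N z. \<Sum>n<N. norm ((1 - f z * g z ^ n) - 1))"
  proof (rule Weierstrass_m_test')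
    fix n z assume z: "z \<in> ?K"
    show "norm (norm ((1 - f z * g z ^ n) - 1)) \<le> B * \<rho> ^ n"
      using B z \<rho> by (auto simp: norm_mult norm_power intro!: mult_mono power_mono)
  next
    show "summable (\<lambda>n. B * \<rho> ^ n)" using \<rho> by (intro summable_mult summable_geometric) auto
  qed
  then have "uniformly_convergent_on ?K (\<lambda>N z. \<Prod>n<N. 1 - f z * g z ^ n)"
    by (intro uniformly_convergent_on_prod' continuous_intros cont) auto
  then obtain l where l: "uniform_limit ?K (\<lambda>N z. \<Prod>n<N. 1 - f z * g z ^ n) l sequentially"
    unfolding uniformly_convergent_on_def by blast
  have "l z = qpoch_inf (f z) (g z)" if "z \<in> ?K" for z
    using LIMSEQ_unique[OF tendsto_uniform_limitI[OF l that]] qpoch_inf_LIMSEQ[OF g1, of z "f z"] d that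
    by (auto simp: qpoch_fin_def)
  then have "uniform_limit ?K (\<lambda>N z. qpoch_fin (f z) (g z) N) (\<lambda>z. qpoch_inf (f z) (g z)) sequentially"
    unfolding qpoch_fin_def by (intro iffD1[OF uniform_limit_cong' l]) auto
  then show "\<exists>d>0. cball z0 d \<subseteq> S \<and>
      uniform_limit (cball z0 d) (\<lambda>N z. qpoch_fin (f z) (g z) N) (\<lambda>z. qpoch_inf (f z) (g z)) sequentially"
    using d by blast
qed

lemma tendsto_infsum_dominated:
  fixes f :: "nat \<Rightarrow> 'a \<Rightarrow> 'b :: banach"
  assumes w: "w summable_on A"
    and le: "\<And>n x. x \<in> A \<Longrightarrow> norm (f n x) \<le> w x"
    and lim: "\<And>x. x \<in> A \<Longrightarrow> (\<lambda>n. f n x) \<longlonglongrightarrow> g x"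
  shows "(\<lambda>n. infsum (f n) A) \<longlonglongrightarrow> infsum g A"
proof (rule LIMSEQ_I)
  fix e :: real assume e: "e > 0"
  have gle: "norm (g x) \<le> w x" if "x \<in> A" for x
    using LIMSEQ_le_const2[OF tendsto_norm[OF lim[OF that]]] le[OF that] by blast
  have abs: "(\<lambda>x. norm (h x)) summable_on B" if "B \<subseteq> A" "\<And>x. x \<in> A \<Longrightarrow> norm (h x) \<le> c * w x"
    for h :: "'a \<Rightarrow> 'b" and B and c :: real
    using that summable_on_subset_banach[OF summable_on_cmult_right[OF w] that(1), of c]
    by (intro summable_on_comparison_test[where g = "\<lambda>x. norm (h x)" and f = "\<lambda>x. c * w x"]) auto
  obtain F where F: "finite F" "F \<subseteq> A" "dist (sum w F) (infsum w A) \<le> e / 8"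
    using infsum_finite_approximation[OF w, of "e / 8"] e by auto
  have wF: "infsum w (A - F) \<le> e / 8"
    using F infsum_Diff[OF w summable_on_finite[OF F(1)] F(2)] abs_le_D2[of "sum w F - infsum w A" "e / 8"]
    by (simp add: dist_real_def)
  have "(\<lambda>n. \<Sum>x\<in>F. f n x - g x) \<longlonglongrightarrow> (\<Sum>x\<in>F. g x - g x)"
    using F lim by (intro tendsto_intros) auto
  then have "\<forall>\<^sub>F n in sequentially. norm (\<Sum>x\<in>F. f n x - g x) < e / 2"
    using e by (auto dest!: tendstoD[where e = "e / 2"])
  then obtain N where N: "\<And>n. n \<ge> N \<Longrightarrow> norm (\<Sum>x\<in>F. f n x - g x) < e / 2"
    unfolding eventually_sequentially by blast
  have "norm (infsum (f n) A - infsum g A) < e" if n: "n \<ge> N" for n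
  proof -
    let ?h = "\<lambda>x. f n x - g x"
    have hle: "norm (?h x) \<le> 2 * w x" if "x \<in> A" for x
      using norm_triangle_ineq4[of "f n x" "g x"] le[OF that, of n] gle[OF that] by simp
    have sf: "f n summable_on A" "g summable_on A"
      using abs[of A "f n" 1] abs[of A g 1] le gle by (auto intro: abs_summable_summable)
    have "infsum (f n) A - infsum g A = infsum ?h A"
      using sf by (simp add: infsum_add infsum_uminus summable_on_uminus diff_conv_add_uminus
          del: add_uminus_conv_diff)
    also have "\<dots> = infsum ?h F + infsum ?h (A - F)"
      using F abs[of "A - F" ?h 2] hle
      by (subst infsum_Un_disjoint[symmetric]) (auto intro: abs_summable_summable simp: Un_absorb1)
    also have "norm \<dots> \<le> norm (\<Sum>x\<in>F. ?h x) + infsum (\<lambda>x. norm (?h x)) (A - F)"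
      using F abs[of "A - F" ?h 2] hle
      by (intro order_trans[OF norm_triangle_ineq] add_mono norm_infsum_bound) auto
    also have "infsum (\<lambda>x. norm (?h x)) (A - F) \<le> infsum (\<lambda>x. 2 * w x) (A - F)"
      using abs[of "A - F" ?h 2] hle summable_on_subset_banach[OF summable_on_cmult_right[OF w], of "A - F" 2]
      by (intro infsum_mono) auto
    also have "\<dots> = 2 * infsum w (A - F)"
      by (simp add: infsum_cmult_right')
    finally show ?thesis using N[OF n] wF e by linarith
  qed
  then show "\<exists>N. \<forall>n\<ge>N. norm (infsum (f n) A - infsum g A) < e" by blast
qed

lemma summable_prod_ratio:
  fixes g :: "nat \<Rightarrow> real"
  assumes "\<And>j. g j \<ge> 0" and lim: "g \<longlonglongrightarrow> l" and "l < 1"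
  shows "summable (\<lambda>n. \<Prod>j<n. g j)"
proof -
  obtain c where c: "l < c" "c < 1" using \<open>l < 1\<close> dense by blast
  have "\<forall>\<^sub>F n in sequentially. g n < c" by (rule order_tendstoD(2)[OF lim c(1)])
  then obtain N where N: "\<And>n. n \<ge> N \<Longrightarrow> g n \<le> c"
    unfolding eventually_sequentially using less_imp_le by blast
  show ?thesis
  proof (rule summable_ratio_test[OF c(2), of N])
    fix n assume "N \<le> n"
    then have "norm (\<Prod>j<n. g j) * \<bar>g n\<bar> \<le> norm (\<Prod>j<n. g j) * c"
      using N[of n] assms(1)[of n] by (intro mult_left_mono) auto
    then show "norm (\<Prod>j<Suc n. g j) \<le> c * norm (\<Prod>j<n. g j)"
      by (simp add: abs_mult mult_ac)
  qed
qed

lemma summable_on_int: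
  fixes f :: "int \<Rightarrow> real"
  assumes "\<And>n. f n \<ge> 0" "summable (\<lambda>n. f (int n))" "summable (\<lambda>n. f (- int n))"
  shows "f summable_on UNIV"
proof -
  have "f summable_on {0..}"
    using summable_nonneg_imp_summable_on[OF assms(2)] assms(1)
    by (subst summable_on_reindex_bij_witness[of _ int nat UNIV "\<lambda>n. f (int n)"]) auto
  moreover have "f summable_on {..0}"
    using summable_nonneg_imp_summable_on[OF assms(3)] assms(1)
    by (subst summable_on_reindex_bij_witness[of _ "\<lambda>n. - int n" "\<lambda>n. nat (- n)" UNIV "\<lambda>n. f (- int n)"]) auto
  moreover have "UNIV = {0..} \<union> {..0::int}" by auto
  ultimately show ?thesis by (metis summable_on_union)
qed

section \<open>A bilateral summation formula\<close>

definition gauss_term :: "complex \<Rightarrow> complex \<Rightarrow> int \<Rightarrow> complex" where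
  "gauss_term x q n = (- x) powi n * q powi (n * (n - 1) div 2)"

definition bilateral_term :: "complex \<Rightarrow> complex \<Rightarrow> complex \<Rightarrow> int \<Rightarrow> complex" where
  "bilateral_term x b q n = gauss_term x q n * qpoch_inf (b * q powi n) q"

lemma gauss_term_0 [simp]: "gauss_term x q 0 = 1"
  by (simp add: gauss_term_def)

lemma triangular_step: "((n::int) + 1) * (n + 1 - 1) div 2 = n * (n - 1) div 2 + n"
proof -
  have "(n + 1) * (n + 1 - 1) = n * (n - 1) + n * 2" by (simp add: algebra_simps)
  then show ?thesis by simp
qed

lemma gauss_term_step:
  assumes "x \<noteq> 0" "q \<noteq> 0"
  shows "gauss_term x q (n + 1) = - x * q powi n * gauss_term x q n"
  unfolding gauss_term_def triangular_step using assms
  by (simp add: power_int_add)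

lemma gauss_term_scale:
  assumes "x \<noteq> 0" "q \<noteq> 0"
  shows "gauss_term (x * q) q n = q powi n * gauss_term x q n"
  unfolding gauss_term_def using power_int_mult_distrib[of "- x" q n] by simp

lemma qpoch_inf_powi_step:
  assumes "norm q < 1" "q \<noteq> 0"
  shows "qpoch_inf (b * q powi n) q = (1 - b * q powi n) * qpoch_inf (b * q powi (n + 1)) q"
  using qpoch_inf_step[OF assms(1), of "b * q powi n"] assms(2) by (simp add: power_int_add mult_ac)

lemma bilateral_term_split:
  assumes "norm q < 1" "q \<noteq> 0" "x \<noteq> 0"
  shows "bilateral_term x b q n = bilateral_term x (b * q) q n + b / x * bilateral_term x b q (n + 1)"
proof -
  have "qpoch_inf (b * q * q powi n) q = qpoch_inf (b * q powi (n + 1)) q"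
    using assms by (simp add: power_int_add mult_ac)
  then show ?thesis
    unfolding bilateral_term_def gauss_term_step[OF assms(3,2)] qpoch_inf_powi_step[OF assms(1,2), of b n] using assms
    by (simp add: field_simps)
qed

definition bilateral_majorant :: "real \<Rightarrow> real \<Rightarrow> real \<Rightarrow> int \<Rightarrow> real" where
  "bilateral_majorant x b q n = exp (b / (1 - q)) *
     (if n \<ge> 0 then \<Prod>j<nat n. x * q ^ j else \<Prod>j<nat (- n). (b + q ^ Suc j) / x)"

lemma summable_bilateral_majorant:
  assumes "0 < q" "q < 1" "0 \<le> b" "b < x"
  shows "bilateral_majorant x b q summable_on UNIV"
proof (rule summable_on_int)
  show "bilateral_majorant x b q n \<ge> 0" for n
    using assms unfolding bilateral_majorant_def by (auto intro!: mult_nonneg_nonneg prod_nonneg)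
  have "(\<lambda>j. x * q ^ j) \<longlonglongrightarrow> x * 0"
    using assms by (intro tendsto_intros LIMSEQ_power_zero) auto
  then have "summable (\<lambda>n. \<Prod>j<n. x * q ^ j)"
    using assms by (intro summable_prod_ratio[where l = 0]) auto
  then show "summable (\<lambda>n. bilateral_majorant x b q (int n))"
    unfolding bilateral_majorant_def by (auto intro: summable_mult)
  have "(\<lambda>j. (b + q ^ Suc j) / x) \<longlonglongrightarrow> (b + 0) / x"
    using assms by (intro tendsto_intros LIMSEQ_Suc[OF LIMSEQ_power_zero]) auto
  then have "summable (\<lambda>n. \<Prod>j<n. (b + q ^ Suc j) / x)"
    using assms by (intro summable_prod_ratio[where l = "b / x"]) auto
  then have "summable (\<lambda>n. exp (b / (1 - q)) * (\<Prod>j<n. (b + q ^ Suc j) / x))"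
    by (rule summable_mult)
  moreover have "bilateral_majorant x b q (- int n) = exp (b / (1 - q)) * (\<Prod>j<n. (b + q ^ Suc j) / x)" for n
    by (cases n) (auto simp: bilateral_majorant_def simp del: of_nat_Suc)
  ultimately show "summable (\<lambda>n. bilateral_majorant x b q (- int n))" by simp
qed

lemma norm_gauss_term_nat:
  assumes "x \<noteq> 0" "q \<noteq> 0"
  shows "norm (gauss_term x q (int n)) = (\<Prod>j<n. norm x * norm q ^ j)"
proof (induction n)
  case (Suc n)
  then show ?case
    using gauss_term_step[OF assms, of "int n"] by (simp add: norm_mult norm_power add.commute mult_ac)
qed auto

lemma norm_bilateral_term_le:
  assumes q: "norm q < 1" "q \<noteq> 0" and x: "x \<noteq> 0" and c: "norm c \<le> b"
  shows "norm (bilateral_term x c q n) \<le> bilateral_majorant (norm x) b (norm q) n"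
proof -
  have pos: "norm (bilateral_term x c q (int n)) \<le> bilateral_majorant (norm x) b (norm q) (int n)" for n
  proof -
    have "norm (c * q powi int n) \<le> b * 1"
      unfolding norm_mult using c q
      by (intro mult_mono) (auto simp: norm_power power_le_one intro: order_trans[OF norm_ge_zero c])
    then have "norm (qpoch_inf (c * q powi int n) q) \<le> exp (b / (1 - norm q))"
      using norm_qpoch_inf_le[OF q(1)] by simp
    then have "norm (gauss_term x q (int n)) * norm (qpoch_inf (c * q powi int n) q)
        \<le> norm (gauss_term x q (int n)) * exp (b / (1 - norm q))"
      by (intro mult_left_mono) auto
    then show ?thesis
      by (simp add: bilateral_term_def bilateral_majorant_def norm_mult norm_gauss_term_nat[OF x q(2)] mult_ac)
  qed
  have neg: "norm (bilateral_term x c q (- int n)) \<le> bilateral_majorant (norm x) b (norm q) (- int n)" for n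
  proof (induction n)
    case 0
    then show ?case using pos[of 0] by simp
  next
    case (Suc n)
    define k where "k = - int (Suc n)"
    have k1: "- int n = k + 1" by (simp add: k_def)
    have e1: "bilateral_term x c q k = bilateral_term x c q (k + 1) * ((c - q powi (- k)) / x)"
      unfolding bilateral_term_def gauss_term_step[OF x q(2)] qpoch_inf_powi_step[OF q, of c k]
      using x q by (simp add: field_simps power_int_minus)
    have e2: "norm ((c - q powi (- k)) / x) \<le> (b + norm q ^ Suc n) / norm x"
    proof -
      have "norm (c - q powi (- k)) \<le> b + norm q ^ Suc n"
        using norm_triangle_ineq4[of c "q ^ Suc n"] c unfolding k_def minus_minus power_int_of_nat norm_power
        by linarith
      then show ?thesis by (simp add: norm_divide divide_right_mono)
    qed
    have e3: "bilateral_majorant (norm x) b (norm q) k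
        = bilateral_majorant (norm x) b (norm q) (k + 1) * ((b + norm q ^ Suc n) / norm x)"
      by (cases n) (auto simp: bilateral_majorant_def k_def nat_add_distrib)
    show ?case
      using mult_mono[OF Suc[unfolded k1] e2] order_trans[OF norm_ge_zero Suc[unfolded k1]]
      unfolding k_def[symmetric] e1 e3 norm_mult by simp
  qed
  show ?thesis
    using pos[of "nat n"] neg[of "nat (- n)"] by (cases "n \<ge> 0") auto
qed

lemma summable_bilateral_term:
  assumes q: "norm q < 1" "q \<noteq> 0" and b: "norm b < norm x"
  shows "bilateral_term x b q summable_on UNIV"
proof -
  have x: "x \<noteq> 0" using b by auto
  have "(\<lambda>n. norm (bilateral_term x b q n)) summable_on UNIV"
    using norm_bilateral_term_le[OF q x order_refl] b q
    by (intro summable_on_comparison_test[OF summable_bilateral_majorant[of "norm q" "norm b" "norm x"]]) auto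
  then show ?thesis by (rule abs_summable_summable)
qed

lemma infsum_int_shift: "infsum (\<lambda>n::int. f (n + k)) UNIV = infsum f UNIV"
  by (rule infsum_reindex_bij_witness[where i = "\<lambda>n. n - k" and j = "\<lambda>n. n + k"]) auto

lemma summable_on_int_shift: "(\<lambda>n::int. f (n + k)) summable_on UNIV \<longleftrightarrow> f summable_on UNIV"
  by (rule summable_on_reindex_bij_witness[where i = "\<lambda>n. n - k" and j = "\<lambda>n. n + k"]) auto

lemma infsum_bilateral_term_step:
  assumes q: "norm q < 1" "q \<noteq> 0" and b: "norm b < norm x"
  shows "(1 - b / x) * infsum (bilateral_term x b q) UNIV = infsum (bilateral_term x (b * q) q) UNIV"
proof -
  have x: "x \<noteq> 0" using b by auto
  have "norm (b * q) < norm x"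
    using b q mult_left_le[of "norm q" "norm b"] by (simp add: norm_mult)
  note sm = summable_bilateral_term[OF q b] summable_bilateral_term[OF q this]
  have "infsum (bilateral_term x b q) UNIV
      = (\<Sum>\<^sub>\<infinity>n. bilateral_term x (b * q) q n + b / x * bilateral_term x b q (n + 1))"
    by (intro infsum_cong bilateral_term_split q x)
  also have "\<dots> = infsum (bilateral_term x (b * q) q) UNIV + (\<Sum>\<^sub>\<infinity>n. b / x * bilateral_term x b q (n + 1))"
    using sm summable_on_int_shift[of "bilateral_term x b q" 1]
    by (intro infsum_add summable_on_cmult_right) auto
  also have "\<dots> = infsum (bilateral_term x (b * q) q) UNIV + b / x * infsum (bilateral_term x b q) UNIV"
    by (rule arg_cong[where f = "(+) _"], rule trans[OF infsum_cmult_right' arg_cong[where f = "(*) _", OF infsum_int_shift]])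
  finally show ?thesis by (simp add: algebra_simps)
qed

lemma qpoch_inf_powers_tendsto_1:
  assumes "norm q < 1"
  shows "(\<lambda>N. qpoch_inf (b * q ^ N * c) q) \<longlonglongrightarrow> 1"
proof -
  have "(\<lambda>a. qpoch_inf a q) holomorphic_on UNIV"
    using assms by (intro holomorphic_on_qpoch_inf holomorphic_intros) auto
  then have "isCont (\<lambda>a. qpoch_inf a q) 0"
    using continuous_on_eq_continuous_at[of UNIV] holomorphic_on_imp_continuous_on by blast
  moreover have "(\<lambda>N. b * q ^ N * c) \<longlonglongrightarrow> b * 0 * c"
    using assms by (intro tendsto_intros LIMSEQ_power_zero) auto
  ultimately show ?thesis
    using isCont_tendsto_compose[of 0 "\<lambda>a. qpoch_inf a q"] by fastforce
qed

lemma infsum_bilateral_term_eq_limit: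
  assumes q: "norm q < 1" "q \<noteq> 0" and b: "norm b < norm x"
  shows "infsum (bilateral_term x b q) UNIV * qpoch_inf (b / x) q = infsum (gauss_term x q) UNIV"
proof (rule LIMSEQ_unique)
  have x: "x \<noteq> 0" using b by auto
  have bN: "norm (b * q ^ N) \<le> norm b" for N
    using q by (simp add: norm_mult norm_power mult_left_le power_le_one)
  have iter: "infsum (bilateral_term x b q) UNIV * qpoch_fin (b / x) q N = infsum (bilateral_term x (b * q ^ N) q) UNIV" for N
  proof (induction N)
    case (Suc N)
    have "norm (b * q ^ N) < norm x" using bN[of N] b by linarith
    from infsum_bilateral_term_step[OF q this] show ?case
      by (simp add: qpoch_fin_Suc Suc[symmetric] mult_ac)
  qed auto
  show "(\<lambda>N. infsum (bilateral_term x (b * q ^ N) q) UNIV) \<longlonglongrightarrow> infsum (bilateral_term x b q) UNIV * qpoch_inf (b / x) q"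
    unfolding iter[symmetric] by (intro tendsto_intros qpoch_inf_LIMSEQ q)
  show "(\<lambda>N. infsum (bilateral_term x (b * q ^ N) q) UNIV) \<longlonglongrightarrow> infsum (gauss_term x q) UNIV"
  proof (rule tendsto_infsum_dominated)
    show "bilateral_majorant (norm x) (norm b) (norm q) summable_on UNIV"
      using b q by (intro summable_bilateral_majorant) auto
    show "norm (bilateral_term x (b * q ^ N) q n) \<le> bilateral_majorant (norm x) (norm b) (norm q) n" for N n
      by (rule norm_bilateral_term_le[OF q x bN])
    have "(\<lambda>N. gauss_term x q n * qpoch_inf (b * q ^ N * q powi n) q) \<longlonglongrightarrow> gauss_term x q n * 1" for n
      by (intro tendsto_intros qpoch_inf_powers_tendsto_1 q)
    then show "(\<lambda>N. bilateral_term x (b * q ^ N) q n) \<longlonglongrightarrow> gauss_term x q n" for n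
      by (simp add: bilateral_term_def)
  qed
qed

lemma bilateral_term_q_eq_0:
  assumes q: "norm q < 1" "q \<noteq> 0" and n: "n < 0"
  shows "bilateral_term x q q n = 0"
proof -
  obtain m where m: "n = - int (Suc m)"
    using n by (metis neg_int_cases gr0_conv_Suc)
  have "q * q powi n * q ^ m = 1"
    using q unfolding m power_int_minus power_int_of_nat by (simp add: field_simps)
  then show ?thesis
    using qpoch_inf_eq_0_iff[OF q(1), of "q * q powi n"] by (auto simp: bilateral_term_def)
qed

lemma infsum_bilateral_term_q:
  assumes q: "norm q < 1" "q \<noteq> 0" and x: "x \<noteq> 0"
  shows "infsum (bilateral_term x q q) UNIV = qpoch_inf x q * qpoch_inf q q"
proof -
  define w where "w y n = (if n \<ge> 0 then bilateral_majorant (norm y) (norm q) (norm q) n else 0)" for y :: complex and n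
  have w: "w y summable_on UNIV" for y
  proof (rule summable_on_int)
    show "w y n \<ge> 0" for n
      using q unfolding w_def bilateral_majorant_def by (auto intro!: mult_nonneg_nonneg prod_nonneg)
    have "(\<lambda>j. norm y * norm q ^ j) \<longlonglongrightarrow> norm y * 0"
      using q by (intro tendsto_intros LIMSEQ_power_zero) auto
    then have "summable (\<lambda>n. \<Prod>j<n. norm y * norm q ^ j)"
      by (intro summable_prod_ratio[where l = 0]) auto
    then show "summable (\<lambda>n. w y (int n))"
      unfolding bilateral_majorant_def w_def by (auto intro: summable_mult)
    show "summable (\<lambda>n. w y (- int n))"
      by (rule summable_finite[of "{0}"]) (auto simp: w_def)
  qed
  have le: "norm (bilateral_term y q q n) \<le> w y n" if "y \<noteq> 0" for y n
    using norm_bilateral_term_le[OF q that order_refl, where n = n] bilateral_term_q_eq_0[OF q, of n y] by (auto simp: w_def)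
  have sm: "bilateral_term y q q summable_on UNIV" if "y \<noteq> 0" for y
    using le[OF that] w[of y]
    by (intro abs_summable_summable[OF summable_on_comparison_test[OF w[of y]]]) auto
  have step: "infsum (bilateral_term y q q) UNIV = (1 - y) * infsum (bilateral_term (y * q) q q) UNIV" if y: "y \<noteq> 0" for y
  proof -
    have yq: "y * q \<noteq> 0" using y q by simp
    have eq: "bilateral_term y q q n = bilateral_term (y * q) q q n + (- y) * bilateral_term (y * q) q q (n + (-1))" for n
    proof -
      have "gauss_term y q n = - y * q powi (n - 1) * gauss_term y q (n - 1)"
        using gauss_term_step[OF y q(2), of "n - 1"] by simp
      note g1 = this
      have g2: "qpoch_inf (q * q powi (n - 1)) q = (1 - q powi n) * qpoch_inf (q * q powi n) q"
        using qpoch_inf_powi_step[OF q, of 1 n] q by (simp add: power_int_add power_int_diff mult_ac)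
      have n1: "n + (-1) = n - 1" by simp
      show ?thesis
        unfolding bilateral_term_def gauss_term_scale[OF y q(2)] n1 g1 g2 by (simp add: algebra_simps)
    qed
    note sm' = sm[OF yq] summable_on_int_shift[of "bilateral_term (y * q) q q" "-1"]
    have "infsum (bilateral_term y q q) UNIV
        = infsum (bilateral_term (y * q) q q) UNIV + (\<Sum>\<^sub>\<infinity>n. (- y) * bilateral_term (y * q) q q (n + (-1)))"
      unfolding eq using sm' by (intro infsum_add summable_on_cmult_right) auto
    also have "\<dots> = infsum (bilateral_term (y * q) q q) UNIV + - y * infsum (bilateral_term (y * q) q q) UNIV"
      by (rule arg_cong[where f = "(+) _"], rule trans[OF infsum_cmult_right' arg_cong[where f = "(*) _", OF infsum_int_shift]])
    finally show ?thesis by (simp add: algebra_simps)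
  qed
  have iter: "infsum (bilateral_term x q q) UNIV = qpoch_fin x q N * infsum (bilateral_term (x * q ^ N) q q) UNIV" for N
  proof (induction N)
    case (Suc N)
    have "x * q ^ N \<noteq> 0" using x q by simp
    have "bilateral_term (x * q ^ Suc N) q q = bilateral_term (x * q ^ N * q) q q" by (simp add: mult_ac)
    with step[OF \<open>x * q ^ N \<noteq> 0\<close>] Suc show ?case by (simp only: qpoch_fin_Suc mult.assoc)
  qed auto
  have "(\<lambda>N. infsum (bilateral_term (x * q ^ N) q q) UNIV) \<longlonglongrightarrow> infsum (\<lambda>n::int. if n = 0 then qpoch_inf q q else 0) UNIV"
  proof (rule tendsto_infsum_dominated[OF w[of x]])
    fix N n
    have nz: "x * q ^ N \<noteq> 0" using x q by simp
    have "w (x * q ^ N) n \<le> w x n"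
    proof -
      have "norm x * norm q ^ N \<le> norm x"
        using q by (intro mult_left_le power_le_one) auto
      then have "(\<Prod>j<nat n. norm (x * q ^ N) * norm q ^ j) \<le> (\<Prod>j<nat n. norm x * norm q ^ j)"
        by (intro prod_mono conjI mult_right_mono) (auto simp: norm_mult norm_power)
      then show ?thesis unfolding w_def bilateral_majorant_def by simp
    qed
    with le[OF nz, of n] show "norm (bilateral_term (x * q ^ N) q q n) \<le> w x n" by linarith
  next
    fix n :: int
    have eq: "bilateral_term (x * q ^ N) q q n = (q powi n) ^ N * bilateral_term x q q n" for N
    proof (induction N)
      case (Suc N)
      have "x * q ^ N \<noteq> 0" using x q by simp
      have "bilateral_term (x * q ^ Suc N) q q n = bilateral_term (x * q ^ N * q) q q n" by (simp add: mult_ac)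
      also have "\<dots> = q powi n * bilateral_term (x * q ^ N) q q n"
        using gauss_term_scale[OF \<open>x * q ^ N \<noteq> 0\<close> q(2), of n] by (simp only: bilateral_term_def mult.assoc)
      finally show ?case unfolding Suc by (simp only: power_Suc mult.assoc)
    qed auto
    consider "n < 0" | "n = 0" | "n > 0" by linarith
    then show "(\<lambda>N. bilateral_term (x * q ^ N) q q n) \<longlonglongrightarrow> (if n = 0 then qpoch_inf q q else 0)"
    proof cases
      case 3
      then have "norm (q powi n) < 1"
        using q by (auto simp: power_int_def norm_power power_less_one_iff)
      then have "(\<lambda>N. (q powi n) ^ N * bilateral_term x q q n) \<longlonglongrightarrow> 0 * bilateral_term x q q n"
        by (intro tendsto_intros LIMSEQ_power_zero)
      with 3 show ?thesis by (simp add: eq)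
    next
      case 2
      have "bilateral_term (x * q ^ N) q q 0 = qpoch_inf q q" for N by (simp add: bilateral_term_def)
      with 2 show ?thesis by simp
    next
      case 1
      with bilateral_term_q_eq_0[OF q 1] show ?thesis by simp
    qed
  qed
  moreover have "infsum (\<lambda>n::int. if n = 0 then qpoch_inf q q else 0) UNIV = qpoch_inf q q"
    by (subst infsum_cong_neutral[where T = "{0}" and g = "\<lambda>_. qpoch_inf q q"]) auto
  ultimately have "(\<lambda>N. qpoch_fin x q N * infsum (bilateral_term (x * q ^ N) q q) UNIV) \<longlonglongrightarrow> qpoch_inf x q * qpoch_inf q q"
    by (intro tendsto_intros qpoch_inf_LIMSEQ q) simp
  then show ?thesis unfolding iter[symmetric] LIMSEQ_const_iff .
qed

theorem infsum_bilateral_term: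
  assumes q: "norm q < 1" "q \<noteq> 0" and b: "norm b < norm x" and x: "norm q < norm x"
  shows "infsum (bilateral_term x b q) UNIV * qpoch_inf (b / x) q
       = qpoch_inf q q * qpoch_inf x q * qpoch_inf (q / x) q"
proof -
  have "x \<noteq> 0" using b by auto
  then show ?thesis
    unfolding infsum_bilateral_term_eq_limit[OF q b]
    using infsum_bilateral_term_eq_limit[OF q x] infsum_bilateral_term_q[OF q, of x] by (simp add: mult_ac)
qed

section \<open>The bilateral series as infinite products\<close>

lemma summable_bilateral_majorant_nat:
  assumes "0 < q" "q < 1"
  shows "summable (\<lambda>n. bilateral_majorant x b q (int n))"
proof -
  have "(\<lambda>j. \<bar>x\<bar> * q ^ j) \<longlonglongrightarrow> \<bar>x\<bar> * 0"
    using assms by (intro tendsto_intros LIMSEQ_power_zero) auto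
  then have "summable (\<lambda>n. \<Prod>j<n. \<bar>x\<bar> * q ^ j)"
    using assms by (intro summable_prod_ratio[where l = 0]) auto
  then have "summable (\<lambda>n. norm (\<Prod>j<n. x * q ^ j))"
    using assms by (simp add: abs_prod abs_mult)
  then show ?thesis
    unfolding bilateral_majorant_def by (auto intro: summable_mult summable_norm_cancel)
qed

lemma summable_on_bilateral_term_nonneg:
  assumes q: "norm q < 1" "q \<noteq> 0" and x: "x \<noteq> 0"
  shows "bilateral_term x b q summable_on {0..}"
proof -
  have "summable (\<lambda>n. norm (bilateral_term x b q (int n)))"
    using norm_bilateral_term_le[OF q x order_refl] q
    by (intro summable_comparison_test'[OF summable_bilateral_majorant_nat[of "norm q" "norm x" "norm b"]]) auto
  from norm_summable_imp_summable_on[OF this] show ?thesis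
    by (subst summable_on_reindex_bij_witness[of _ int nat UNIV "\<lambda>n. bilateral_term x b q (int n)"]) auto
qed

lemma summable_on_int_tendsto_0:
  assumes "(f :: int \<Rightarrow> complex) summable_on {0..}"
  shows "(\<lambda>n. f (int n)) \<longlonglongrightarrow> 0"
proof -
  have "(\<lambda>n. f (int n)) summable_on UNIV"
    using assms by (subst summable_on_reindex_bij_witness[of UNIV nat int "{0..}" f]) auto
  then show ?thesis by (intro summable_LIMSEQ_zero summable_on_imp_summable)
qed

lemma arithmetic_means_tendsto:
  fixes s :: "nat \<Rightarrow> complex"
  assumes "s \<longlonglongrightarrow> l"
  shows "(\<lambda>N. (\<Sum>K\<le>N. s K) / of_nat (N + 1)) \<longlonglongrightarrow> l"
proof (rule LIMSEQ_I)
  fix e :: real assume e: "e > 0"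
  obtain M where M: "\<And>n. n \<ge> M \<Longrightarrow> norm (s n - l) < e / 2"
    using LIMSEQ_D[OF assms, of "e / 2"] e by auto
  define C where "C = (\<Sum>K<M. norm (s K - l))"
  have C0: "C \<ge> 0" by (simp add: C_def sum_nonneg)
  obtain R :: nat where R: "2 * C / e < R" using reals_Archimedean2 by blast
  have "norm ((\<Sum>K\<le>N. s K) / of_nat (N + 1) - l) < e" if N: "N \<ge> max M R" for N
  proof -
    have "(\<Sum>K\<le>N. s K) / of_nat (N + 1) - l = (\<Sum>K\<le>N. s K - l) / of_nat (N + 1)"
      by (simp add: sum_subtractf field_simps del: of_nat_Suc)
    then have eq: "norm ((\<Sum>K\<le>N. s K) / of_nat (N + 1) - l) = norm (\<Sum>K\<le>N. s K - l) / real (N + 1)"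
      by (simp only: norm_divide norm_of_nat)
    have U: "{..N} = {..<M} \<union> {M..N}" using N by auto
    have "norm (\<Sum>K\<le>N. s K - l) \<le> (\<Sum>K\<in>{..<M} \<union> {M..N}. norm (s K - l))"
      unfolding U[symmetric] by (rule norm_sum)
    also have "(\<Sum>K\<in>{..<M} \<union> {M..N}. norm (s K - l)) = C + (\<Sum>K=M..N. norm (s K - l))"
      unfolding C_def by (rule sum.union_disjoint) auto
    also have "(\<Sum>K=M..N. norm (s K - l)) \<le> (\<Sum>K=M..N. e / 2)"
      using M by (intro sum_mono less_imp_le) auto
    also have "\<dots> \<le> real (N + 1) * (e / 2)"
      using e by (auto intro!: mult_right_mono)
    also have "C < real (N + 1) * (e / 2)"
    proof -
      have "2 * C < real R * e" using R e by (simp add: field_simps)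
      also have "\<dots> \<le> real (N + 1) * e" using N e by (intro mult_right_mono) auto
      finally show ?thesis by simp
    qed
    finally show ?thesis unfolding eq by (simp add: divide_less_eq mult.commute)
  qed
  then show "\<exists>M. \<forall>n\<ge>M. norm ((\<Sum>K\<le>n. s K) / of_nat (n + 1) - l) < e" by blast
qed

lemma has_sum_symmetric_LIMSEQ:
  fixes f :: "int \<Rightarrow> complex"
  assumes "(f has_sum S) UNIV"
  shows "(\<lambda>K. \<Sum>n=- int K..int K. f n) \<longlonglongrightarrow> S"
proof -
  have "filterlim (\<lambda>K. {- int K..int K}) (finite_subsets_at_top UNIV) sequentially"
    unfolding filterlim_finite_subsets_at_top
  proof (intro allI impI)
    fix X :: "int set" assume "finite X \<and> X \<subseteq> UNIV"
    then have B: "\<bar>x\<bar> \<le> (\<Sum>y\<in>X. \<bar>y\<bar>)" if "x \<in> X" for x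
      using that by (intro member_le_sum) auto
    show "\<forall>\<^sub>F K in sequentially. finite {- int K..int K} \<and> X \<subseteq> {- int K..int K} \<and> {- int K..int K} \<subseteq> UNIV"
      unfolding eventually_sequentially by (rule exI[of _ "nat (\<Sum>y\<in>X. \<bar>y\<bar>)"]) (use B in force)
  qed
  then show ?thesis
    using assms unfolding has_sum_def by (rule filterlim_compose[rotated])
qed

text \<open>For \<open>\<psi>\<close> the terms at negative indices alternate in sign without tending to \<open>0\<close>, but sums of two
  consecutive terms are summable; this determines both readings of \<open>bilateral_sum\<close>.\<close>

lemma bilateral_sum_alternating:
  fixes c :: "int \<Rightarrow> complex"
  assumes d: "(\<lambda>n. c n + c (n + 1)) summable_on UNIV" and c: "c summable_on {0..}"
  shows "bilateral_sum c = (\<Sum>\<^sub>\<infinity>n. c n + c (n + 1)) / 2"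
proof (cases "c summable_on UNIV")
  case True
  then have "(\<Sum>\<^sub>\<infinity>n. c n + c (n + 1)) = infsum c UNIV + infsum (\<lambda>n. c (n + 1)) UNIV"
    using summable_on_int_shift[of c 1] by (intro infsum_add) auto
  also have "infsum (\<lambda>n. c (n + 1)) UNIV = infsum c UNIV" by (rule infsum_int_shift)
  finally show ?thesis using True by (simp add: bilateral_sum_def)
next
  case False
  define d where "d n = c n + c (n + 1)" for n
  define S where "S = infsum d UNIV"
  have hs: "(d has_sum S) UNIV" unfolding S_def using assms(1) by (intro has_sum_infsum) (simp add: d_def[abs_def])
  define D where "D K = (\<Sum>n=- int K..int K. d n)" for K
  have split: "(\<Sum>n=- int K..int K. f n) = f (- int K) + (\<Sum>n=- int K + 1..int K. f n)" for f :: "int \<Rightarrow> complex" and K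
  proof -
    have "{- int K..int K} = insert (- int K) {- int K + 1..int K}" by auto
    then show ?thesis by simp
  qed
  have shift: "(\<Sum>n=- int K..int K. c (n + 1)) = (\<Sum>n=- int K + 1..int K + 1. c n)" for K
    by (rule sum.reindex_bij_witness[of _ "\<lambda>n. n - 1" "\<lambda>n. n + 1"]) auto
  have shift': "(\<Sum>n=- int K + 1..int K + 1. c n) = (\<Sum>n=- int K + 1..int K. c n) + c (int K + 1)" for K
  proof -
    have "{- int K + 1..int K + 1} = insert (int K + 1) {- int K + 1..int K}" by auto
    then show ?thesis by simp
  qed
  have partial: "(\<Sum>n=- int K..int K. c n) = (D K - c (int K + 1)) / 2 + c (- int K) / 2" for K
    unfolding D_def d_def sum.distrib shift shift' using split[of c K] by (simp add: field_simps)
  have "D \<longlonglongrightarrow> S" unfolding D_def by (rule has_sum_symmetric_LIMSEQ[OF hs])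
  moreover have "(\<lambda>K. c (int K + 1)) \<longlonglongrightarrow> 0"
    using LIMSEQ_Suc[OF summable_on_int_tendsto_0[OF c]] by (simp add: add.commute)
  ultimately have "(\<lambda>K. (D K - c (int K + 1)) / 2) \<longlonglongrightarrow> (S - 0) / 2"
    by (intro tendsto_intros) auto
  from arithmetic_means_tendsto[OF this]
  have lim1: "(\<lambda>N. (\<Sum>K\<le>N. (D K - c (int K + 1)) / 2) / of_nat (N + 1)) \<longlonglongrightarrow> S / 2" by simp
  have "(\<lambda>n. norm (d n)) summable_on UNIV"
    using hs summable_on_iff_abs_summable_on_complex by (auto simp: summable_on_def)
  then have sd: "summable (\<lambda>n. norm (d (- int (Suc n))))"
    by (intro summable_on_imp_summable)
       (subst summable_on_reindex_bij_witness[of UNIV "\<lambda>n. nat (- n - 1)" "\<lambda>n. - int (Suc n)" "{..<0}" "\<lambda>n. norm (d n)"],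
        auto intro: summable_on_subset_banach)
  define M where "M = norm (c 0) + (\<Sum>n. norm (d (- int (Suc n))))"
  have part: "(\<Sum>n<N. norm (d (- int (Suc n)))) \<le> (\<Sum>n. norm (d (- int (Suc n))))" for N
    by (rule sum_le_suminf[OF sd]) auto
  have cSuc: "c (- int (Suc n)) = d (- int (Suc n)) - c (- int n)" for n
    by (simp add: d_def)
  have cM: "norm (c (- int N)) \<le> M" for N
  proof -
    have "norm (c (- int N)) \<le> norm (c 0) + (\<Sum>n<N. norm (d (- int (Suc n))))"
    proof (induction N)
      case (Suc N)
      show ?case
        using Suc norm_triangle_ineq4[of "d (- int (Suc N))" "c (- int N)"] unfolding cSuc by simp
    qed simp
    with part[of N] show ?thesis by (simp add: M_def)
  qed
  have "norm (\<Sum>K\<le>N. c (- int K)) \<le> 2 * M" for N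
  proof -
    have "2 * (\<Sum>K\<le>N. c (- int K)) = c 0 + c (- int N) + (\<Sum>n<N. d (- int (Suc n)))"
      by (induction N) (auto simp: d_def)
    then have "2 * norm (\<Sum>K\<le>N. c (- int K)) = norm (c 0 + c (- int N) + (\<Sum>n<N. d (- int (Suc n))))"
      by (metis norm_mult norm_numeral)
    also have "\<dots> \<le> norm (c 0) + norm (c (- int N)) + (\<Sum>n<N. norm (d (- int (Suc n))))"
      by (intro order_trans[OF norm_triangle_ineq] add_mono norm_triangle_ineq norm_sum)
    also have "\<dots> \<le> 2 * M + 2 * M"
      using cM[of N] part[of N] norm_ge_zero[of "c 0"] order_trans[OF norm_ge_zero cM[of 0]]
      by (simp add: M_def)
    finally show ?thesis by simp
  qed
  then have bd1: "norm (\<Sum>K\<le>N. c (- int K)) / (2 * real (Suc N)) \<le> 2 * M / (2 * real (Suc N))" for N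
    by (intro divide_right_mono) auto
  have mean: "(\<Sum>K\<le>N. c (- int K) / 2) / of_nat (N + 1) = (\<Sum>K\<le>N. c (- int K)) / (2 * of_nat (Suc N))" for N
    by (simp only: sum_divide_distrib[of "\<lambda>K. c (- int K)" "{..N}" 2, symmetric] divide_divide_eq_left Suc_eq_plus1)
  have bd: "norm ((\<Sum>K\<le>N. c (- int K) / 2) / of_nat (N + 1)) \<le> M * inverse (real (Suc N))" for N
  proof -
    have "2 * M / (2 * real (Suc N)) = M * inverse (real (Suc N))"
      by (subst mult_divide_mult_cancel_left) (simp, rule divide_inverse)
    with bd1[of N] show ?thesis
      unfolding mean norm_divide norm_mult norm_numeral norm_of_nat by metis
  qed
  have lim2: "(\<lambda>N. (\<Sum>K\<le>N. c (- int K) / 2) / of_nat (N + 1)) \<longlonglongrightarrow> 0"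
    by (rule Lim_null_comparison[OF always_eventually[OF allI[OF bd]]])
       (use tendsto_mult_right_zero[OF LIMSEQ_inverse_real_of_nat] in auto)
  have "(\<lambda>N. (\<Sum>K\<le>N. \<Sum>n=- int K..int K. c n) / of_nat (N + 1)) \<longlonglongrightarrow> S / 2"
    unfolding partial sum.distrib add_divide_distrib using tendsto_add[OF lim1 lim2] by simp
  from limI[OF this] have "bilateral_sum c = S / 2"
    unfolding bilateral_sum_def cesaro_bilateral_sum_def if_not_P[OF False] .
  moreover have "S = (\<Sum>\<^sub>\<infinity>n. c n + c (n + 1))" by (simp add: S_def d_def[abs_def])
  ultimately show ?thesis by (simp only:)
qed

lemma double_triangular: "2 * ((n::int) * (n - 1) div 2) = n * n - n"
proof -
  have "even (n * (n - 1))" by simp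
  then have "2 * (n * (n - 1) div 2) = n * (n - 1)" by simp
  then show ?thesis by (simp add: algebra_simps)
qed

lemma gauss_term_square_base:
  assumes "q \<noteq> 0"
  shows "gauss_term x (q\<^sup>2) n = (- x) powi n * q powi (n * n - n)"
proof -
  have "(q\<^sup>2) powi k = q powi (2 * k)" for k
    by (simp add: power_int_mult)
  then show ?thesis unfolding gauss_term_def by (simp only: double_triangular)
qed

lemma eta_quotient_field_identities:
  fixes X e1 e2 e4 :: "'a :: field"
  assumes nz: "e1 \<noteq> 0" "e2 \<noteq> 0" "e4 \<noteq> 0"
  shows "X * (e1 / e2) = e2 * (e2\<^sup>2 / (e1 * e4)) * (e2\<^sup>2 / (e1 * e4)) \<Longrightarrow>
      X / (e4 / e2) = e2 ^ 7 / (e1 ^ 3 * e4 ^ 3)"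
    and "X * (e4 / e2) = e2 * (e2\<^sup>2 / (e1 * e4)) * (e2\<^sup>2 / (e1 * e4)) \<Longrightarrow>
      X / (e1 / e2) = e2 ^ 7 / (e1 ^ 3 * e4 ^ 3)"
    and "X * (e1 / e2) = 2 * e2 * (e4 / e2) * (e4 / e2) \<Longrightarrow>
      X / (e2\<^sup>2 / (e1 * e4)) = 2 * e4 ^ 3 / e2\<^sup>2"
proof -
  have X: "X = Y / b" if "X * b = Y" "b \<noteq> 0" for Y b using that by (simp add: field_simps)
  assume "X * (e1 / e2) = e2 * (e2\<^sup>2 / (e1 * e4)) * (e2\<^sup>2 / (e1 * e4))"
  from X[OF this] show "X / (e4 / e2) = e2 ^ 7 / (e1 ^ 3 * e4 ^ 3)"
    using nz by (simp add: divide_simps eval_nat_numeral mult_ac)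
next
  have X: "X = Y / b" if "X * b = Y" "b \<noteq> 0" for Y b using that by (simp add: field_simps)
  assume "X * (e4 / e2) = e2 * (e2\<^sup>2 / (e1 * e4)) * (e2\<^sup>2 / (e1 * e4))"
  from X[OF this] show "X / (e1 / e2) = e2 ^ 7 / (e1 ^ 3 * e4 ^ 3)"
    using nz by (simp add: divide_simps eval_nat_numeral mult_ac)
next
  have X: "X = Y / b" if "X * b = Y" "b \<noteq> 0" for Y b using that by (simp add: field_simps)
  assume "X * (e1 / e2) = 2 * e2 * (e4 / e2) * (e4 / e2)"
  from X[OF this] show "X / (e2\<^sup>2 / (e1 * e4)) = 2 * e4 ^ 3 / e2\<^sup>2"
    using nz by (simp add: divide_simps eval_nat_numeral mult_ac)
qed

locale punctured_unit_disc =
  fixes q :: complex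
  assumes q1: "norm q < 1" and q0: "q \<noteq> 0"
begin

lemma sq1: "norm (q\<^sup>2) < 1" and sq0: "q\<^sup>2 \<noteq> 0" and sq_lt: "norm (q\<^sup>2) < norm q"
proof -
  have "norm q ^ 2 < norm q" using q1 q0 by (simp add: power2_eq_square)
  then show "norm (q\<^sup>2) < norm q" "norm (q\<^sup>2) < 1" using q1 by (simp_all add: norm_power)
qed (use q0 in simp)

lemma c_phi_bilateral_term: "c_phi q n = bilateral_term (- q) (- (q\<^sup>2)) (q\<^sup>2) n / qpoch_inf (- (q\<^sup>2)) (q\<^sup>2)"
proof -
  have "q powi n * q powi (n * n - n) = q powi (n\<^sup>2)"
    using q0 by (simp add: power2_eq_square flip: power_int_add)
  then show ?thesis
    unfolding c_phi_def bilateral_term_def qpoch_def gauss_term_square_base[OF q0] minus_minus by simp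
qed

lemma c_psi_bilateral_term: "c_psi q n = bilateral_term (- q) q (q\<^sup>2) n / qpoch_inf q (q\<^sup>2)"
proof -
  have "q powi n * q powi (n * n - n) = q powi (n\<^sup>2)"
    using q0 by (simp add: power2_eq_square flip: power_int_add)
  then show ?thesis
    unfolding c_psi_def bilateral_term_def qpoch_def gauss_term_square_base[OF q0] minus_minus by simp
qed

lemma c_nu_bilateral_term: "c_nu q n = bilateral_term (- 1) (- q) (q\<^sup>2) (n + 1) / qpoch_inf (- q) (q\<^sup>2)"
proof -
  have "(n + 1) * (n + 1) - (n + 1) = n * (n + 1)" by (simp add: algebra_simps)
  then show ?thesis
    unfolding c_nu_def bilateral_term_def qpoch_def gauss_term_square_base[OF q0] minus_minus by simp
qed

lemma summable_c_phi: "c_phi q summable_on UNIV"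
  unfolding c_phi_bilateral_term divide_inverse using sq_lt
  by (intro summable_on_cmult_left summable_bilateral_term sq1 sq0) auto

lemma summable_c_psi_nonneg: "c_psi q summable_on {0..}"
  unfolding c_psi_bilateral_term divide_inverse using q0
  by (intro summable_on_cmult_left summable_on_bilateral_term_nonneg sq1 sq0) auto

lemma summable_c_nu: "c_nu q summable_on UNIV"
  unfolding c_nu_bilateral_term divide_inverse summable_on_int_shift[of "\<lambda>n. bilateral_term (- 1) (- q) (q\<^sup>2) n * inverse (qpoch_inf (- q) (q\<^sup>2))"]
  using q1 by (intro summable_on_cmult_left summable_bilateral_term sq1 sq0) auto

text \<open>The series for \<open>\<psi>\<close> is the boundary case \<open>b / x = - 1\<close> of the bilateral summation formula.\<close>

lemma c_psi_pair: "c_psi q n + c_psi q (n + 1) = bilateral_term (- q) (q * q\<^sup>2) (q\<^sup>2) n / qpoch_inf q (q\<^sup>2)"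
  using bilateral_term_split[OF sq1 sq0, of "- q" q n] q0 unfolding c_psi_bilateral_term by (simp add: field_simps flip: add_divide_distrib)

lemma summable_c_psi_pair: "(\<lambda>n. c_psi q n + c_psi q (n + 1)) summable_on UNIV"
proof -
  have "norm (q * q\<^sup>2) < norm (- q)" using sq1 q0 by (simp add: norm_mult)
  then show ?thesis
    unfolding c_psi_pair divide_inverse by (intro summable_on_cmult_left summable_bilateral_term sq1 sq0)
qed

lemma B_psi_pair: "B_psi q = (\<Sum>\<^sub>\<infinity>n. c_psi q n + c_psi q (n + 1)) / 2"
  unfolding B_psi_def by (rule bilateral_sum_alternating[OF summable_c_psi_pair summable_c_psi_nonneg])

lemma euler_nz: "qpoch_inf q q \<noteq> 0" "qpoch_inf (q\<^sup>2) (q\<^sup>2) \<noteq> 0" "qpoch_inf (q ^ 4) (q ^ 4) \<noteq> 0"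
proof -
  have "norm (q ^ 4) < 1" using q1 by (simp add: norm_power power_less_one_iff)
  then show "qpoch_inf q q \<noteq> 0" "qpoch_inf (q\<^sup>2) (q\<^sup>2) \<noteq> 0" "qpoch_inf (q ^ 4) (q ^ 4) \<noteq> 0"
    using q1 sq1 qpoch_inf_nonzero_of_norm by blast+
qed

lemma qpoch_inf_q_q2: "qpoch_inf q (q\<^sup>2) = qpoch_inf q q / qpoch_inf (q\<^sup>2) (q\<^sup>2)"
  using qpoch_inf_dissect[OF q1, of q] euler_nz by (simp add: field_simps power2_eq_square)

lemma qpoch_inf_minus_q2_q2:
  "qpoch_inf (- (q\<^sup>2)) (q\<^sup>2) = qpoch_inf (q ^ 4) (q ^ 4) / qpoch_inf (q\<^sup>2) (q\<^sup>2)"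
  using qpoch_inf_mult_uminus[OF sq1, of "q\<^sup>2"] euler_nz by (simp add: field_simps)

lemma qpoch_inf_minus_q_q2:
  "qpoch_inf (- q) (q\<^sup>2) = (qpoch_inf (q\<^sup>2) (q\<^sup>2))\<^sup>2 / (qpoch_inf q q * qpoch_inf (q ^ 4) (q ^ 4))"
proof -
  have "qpoch_inf (q\<^sup>2) (q\<^sup>2) = qpoch_inf (q\<^sup>2) (q ^ 4) * qpoch_inf (q ^ 4) (q ^ 4)"
    using qpoch_inf_dissect[OF sq1, of "q\<^sup>2"] by (simp flip: power_add power_mult)
  moreover have "qpoch_inf q (q\<^sup>2) * qpoch_inf (- q) (q\<^sup>2) = qpoch_inf (q\<^sup>2) (q ^ 4)"
    using qpoch_inf_mult_uminus[OF sq1, of q] by (simp flip: power_mult)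
  ultimately show ?thesis
    using euler_nz unfolding qpoch_inf_q_q2 by (simp add: field_simps power2_eq_square)
qed

lemma B_phi_product:
  "B_phi q = qpoch_inf (q\<^sup>2) (q\<^sup>2) ^ 7 / (qpoch_inf q q ^ 3 * qpoch_inf (q ^ 4) (q ^ 4) ^ 3)"
proof -
  have "infsum (bilateral_term (- q) (- (q\<^sup>2)) (q\<^sup>2)) UNIV * qpoch_inf q (q\<^sup>2)
      = qpoch_inf (q\<^sup>2) (q\<^sup>2) * qpoch_inf (- q) (q\<^sup>2) * qpoch_inf (- q) (q\<^sup>2)"
    using infsum_bilateral_term[OF sq1 sq0, of "- (q\<^sup>2)" "- q"] sq_lt q0 by (simp add: power2_eq_square)
  moreover have "B_phi q = infsum (bilateral_term (- q) (- (q\<^sup>2)) (q\<^sup>2)) UNIV / qpoch_inf (- (q\<^sup>2)) (q\<^sup>2)"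
    unfolding B_phi_def bilateral_sum_def using summable_c_phi
    by (simp add: c_phi_bilateral_term[abs_def] divide_inverse infsum_cmult_left')
  ultimately show ?thesis
    unfolding qpoch_inf_q_q2 qpoch_inf_minus_q2_q2 qpoch_inf_minus_q_q2
    using eta_quotient_field_identities(1)[OF euler_nz] by presburger
qed

lemma B_psi_eq_half_B_phi: "B_psi q = B_phi q / 2"
proof -
  have lt: "norm (q * q\<^sup>2) < norm (- q)" using sq1 q0 by (simp add: norm_mult)
  have "infsum (bilateral_term (- q) (q * q\<^sup>2) (q\<^sup>2)) UNIV * qpoch_inf (- (q\<^sup>2)) (q\<^sup>2)
      = qpoch_inf (q\<^sup>2) (q\<^sup>2) * qpoch_inf (- q) (q\<^sup>2) * qpoch_inf (- q) (q\<^sup>2)"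
    using infsum_bilateral_term[OF sq1 sq0 lt] sq_lt q0 by (simp add: power2_eq_square)
  moreover have "B_psi q = infsum (bilateral_term (- q) (q * q\<^sup>2) (q\<^sup>2)) UNIV / qpoch_inf q (q\<^sup>2) / 2"
    unfolding B_psi_pair c_psi_pair divide_inverse[of _ "qpoch_inf q (q\<^sup>2)"] by (simp only: infsum_cmult_left')
  ultimately show ?thesis
    unfolding B_phi_product qpoch_inf_q_q2 qpoch_inf_minus_q2_q2 qpoch_inf_minus_q_q2
    using eta_quotient_field_identities(2)[OF euler_nz] by presburger
qed

lemma B_nu_product:
  "B_nu q = 2 * qpoch_inf (q ^ 4) (q ^ 4) ^ 3 / qpoch_inf (q\<^sup>2) (q\<^sup>2) ^ 2"
proof -
  have "qpoch_inf (- 1) (q\<^sup>2) = 2 * qpoch_inf (- (q\<^sup>2)) (q\<^sup>2)"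
    using qpoch_inf_step[OF sq1, of "- 1"] by simp
  then have "infsum (bilateral_term (- 1) (- q) (q\<^sup>2)) UNIV * qpoch_inf q (q\<^sup>2)
      = 2 * qpoch_inf (q\<^sup>2) (q\<^sup>2) * qpoch_inf (- (q\<^sup>2)) (q\<^sup>2) * qpoch_inf (- (q\<^sup>2)) (q\<^sup>2)"
    using infsum_bilateral_term[OF sq1 sq0, of "- q" "- 1"] sq1 q1 by simp
  moreover have "B_nu q = infsum (bilateral_term (- 1) (- q) (q\<^sup>2)) UNIV / qpoch_inf (- q) (q\<^sup>2)"
  proof -
    have "B_nu q = (\<Sum>\<^sub>\<infinity>n. bilateral_term (- 1) (- q) (q\<^sup>2) (n + 1) * inverse (qpoch_inf (- q) (q\<^sup>2)))"
      unfolding B_nu_def bilateral_sum_def using summable_c_nu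
      by (simp add: c_nu_bilateral_term[abs_def] divide_inverse)
    also have "\<dots> = infsum (bilateral_term (- 1) (- q) (q\<^sup>2)) UNIV * inverse (qpoch_inf (- q) (q\<^sup>2))"
      by (rule trans[OF infsum_cmult_left' arg_cong[where f = "\<lambda>y. y * _", OF infsum_int_shift]])
    finally show ?thesis by (simp only: divide_inverse)
  qed
  ultimately show ?thesis
    unfolding qpoch_inf_q_q2 qpoch_inf_minus_q2_q2 qpoch_inf_minus_q_q2
    using eta_quotient_field_identities(3)[OF euler_nz] by presburger
qed

end

section \<open>Radial limits\<close>

lemma prod_one_minus_primitive_root:
  assumes "primitive_root_of_unity N \<omega>"
  shows "(\<Prod>j<N. 1 - X * \<omega> ^ j) = 1 - X ^ N"
proof (cases "X = 0")
  case True
  then show ?thesis using assms by (simp add: primitive_root_of_unity_def)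
next
  case False
  have N: "N > 0" "\<omega> ^ N = 1" and prim: "\<And>j. 0 < j \<Longrightarrow> j < N \<Longrightarrow> \<omega> ^ j \<noteq> 1"
    using assms by (auto simp: primitive_root_of_unity_def)
  have nz: "\<omega> \<noteq> 0" using N by (auto simp: power_0_left)
  have ne: "\<omega> ^ i \<noteq> \<omega> ^ j" if "i < j" "j < N" for i j
  proof
    assume "\<omega> ^ i = \<omega> ^ j"
    also have "\<dots> = \<omega> ^ i * \<omega> ^ (j - i)" using that by (simp flip: power_add)
    finally have "\<omega> ^ (j - i) = 1" using nz by simp
    moreover have "0 < j - i" "j - i < N" using that by auto
    ultimately show False using prim by blast
  qed
  have inj: "inj_on (\<lambda>j. \<omega> ^ j) {..<N}"
    by (rule linorder_inj_onI) (use ne in auto)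
  let ?p = "\<Prod>j<N. [:- (\<omega> ^ j), 1:]"
  let ?q = "monom 1 N - 1 :: complex poly"
  have degp: "degree ?p = N" by (subst degree_prod_sum_eq) auto
  have degq: "degree ?q \<le> N" by (intro degree_diff_le) (auto simp: degree_monom_eq)
  have "?p = ?q"
  proof (rule poly_eqI_degree_lead_coeff[where n = N and A = "(\<lambda>j. \<omega> ^ j) ` {..<N}"])
    have "lead_coeff ?p = 1" by (simp add: lead_coeff_prod)
    then show "poly.coeff ?p N = poly.coeff ?q N" using degp N by simp
    show "N \<le> card ((\<lambda>j. \<omega> ^ j) ` {..<N})" by (simp add: card_image[OF inj])
    fix x assume "x \<in> (\<lambda>j. \<omega> ^ j) ` {..<N}"
    then obtain j where j: "j < N" "x = \<omega> ^ j" by auto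
    have "poly ?p x = 0" using j by (auto simp: poly_prod)
    moreover have "x ^ N = 1"
      using N unfolding j by (metis power_mult mult.commute power_one)
    ultimately show "poly ?p x = poly ?q x" by (simp add: poly_monom)
  qed (use degp degq in auto)
  then have "poly ?p (1 / X) = poly ?q (1 / X)" by simp
  then have eq: "(\<Prod>j<N. 1 / X - \<omega> ^ j) = 1 / X ^ N - 1"
    by (simp add: poly_prod poly_monom power_one_over)
  have "(\<Prod>j<N. 1 - X * \<omega> ^ j) = (\<Prod>j<N. X * (1 / X - \<omega> ^ j))"
    using False by (intro prod.cong) (auto simp: field_simps)
  also have "\<dots> = X ^ N * (1 / X ^ N - 1)"
    by (simp add: prod.distrib eq)
  also have "\<dots> = 1 - X ^ N" using False by (simp add: right_diff_distrib)
  finally show ?thesis .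
qed

lemma one_minus_power_le:
  assumes "0 \<le> r" "r \<le> (1::real)"
  shows "1 - r ^ k \<le> real k * (1 - r)"
  using Bernoulli_inequality[of "r - 1" k] assms by (simp add: algebra_simps)

lemma qpoch_fin_add: "qpoch_fin a q (m + n) = qpoch_fin a q m * qpoch_fin (a * q ^ m) q n"
  by (induction n) (auto simp: qpoch_fin_Suc power_add mult_ac)

lemma norm_qpoch_fin_le:
  assumes "norm a \<le> 1" "norm q \<le> 1"
  shows "norm (qpoch_fin a q n) \<le> 2 ^ n"
proof -
  have "norm (qpoch_fin a q n) = (\<Prod>j<n. norm (1 - a * q ^ j))"
    by (simp add: qpoch_fin_def prod_norm)
  also have "\<dots> \<le> (\<Prod>j<n. 2)"
  proof (intro prod_mono conjI norm_ge_zero)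
    fix j
    have "norm a * norm q ^ j \<le> 1 * 1"
      using assms by (intro mult_mono power_le_one) auto
    then show "norm (1 - a * q ^ j) \<le> 2"
      using norm_triangle_ineq4[of 1 "a * q ^ j"] by (simp add: norm_mult norm_power)
  qed
  finally show ?thesis by simp
qed

text \<open>At radius \<open>r\<close>, each block of \<open>N\<close> consecutive factors is close to \<open>1 - R ^ N\<close>, with \<open>R\<close> tending
  geometrically to \<open>0\<close> along the blocks. The first two blocks are \<open>O(1 - r)\<close>, the product of the
  remaining ones is bounded; this beats the geometric sum of size \<open>1 / (1 - r)\<close>.\<close>

lemma norm_qpoch_block_le:
  fixes r R :: real and s :: nat
  assumes prim: "primitive_root_of_unity N \<omega>" and \<omega>: "norm \<omega> = 1" and z: "norm z = 1" "z ^ N = 1"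
    and r: "0 \<le> r" "r \<le> 1" and R: "0 \<le> R" "R \<le> 1"
  shows "norm (qpoch_fin (z * of_real r ^ s * of_real R) (\<omega> * (of_real r)\<^sup>2) N)
    \<le> 1 - R ^ N + 2 ^ N * real (N * (s + 2 * N)) * R * (1 - r)"
proof -
  define a where "a i = 1 - z * of_real r ^ s * of_real R * (\<omega> * (of_real r)\<^sup>2) ^ i" for i
  define d where "d i = 1 - z * of_real R * \<omega> ^ i" for i
  have ri: "a i = 1 - z * \<omega> ^ i * of_real (R * r ^ (s + 2 * i))" for i
    by (simp add: a_def power_mult_distrib power_add mult_ac flip: power_mult)
  have na: "norm (a i) \<le> 2" for i
  proof -
    have "R * r ^ (s + 2 * i) \<le> 1 * 1" using r R by (intro mult_mono power_le_one) auto
    moreover have "0 \<le> R * r ^ (s + 2 * i)" using r R by simp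
    ultimately show ?thesis
      using norm_triangle_ineq4[of 1 "z * \<omega> ^ i * of_real (R * r ^ (s + 2 * i))"] z \<omega>
      unfolding ri norm_mult norm_power norm_of_real by simp
  qed
  have nd: "norm (d i) \<le> 2" for i
    using norm_triangle_ineq4[of 1 "z * of_real R * \<omega> ^ i"] z \<omega> R
    unfolding d_def norm_mult norm_power norm_of_real by simp
  have ad: "norm (a i - d i) \<le> R * (real (s + 2 * N) * (1 - r))" if "i < N" for i
  proof -
    have "a i - d i = z * \<omega> ^ i * of_real (R * (1 - r ^ (s + 2 * i)))"
      unfolding ri d_def by (simp add: algebra_simps)
    then have "norm (a i - d i) = R * (1 - r ^ (s + 2 * i))"
      using z \<omega> r R by (simp add: norm_mult norm_power power_le_one del: of_real_mult of_real_diff of_real_power)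
    also have "1 - r ^ (s + 2 * i) \<le> real (s + 2 * i) * (1 - r)"
      by (rule one_minus_power_le[OF r])
    also have "\<dots> \<le> real (s + 2 * N) * (1 - r)"
      using that r by (intro mult_right_mono) auto
    finally show ?thesis using R by (simp add: mult_left_mono)
  qed
  have "norm ((\<Prod>i<N. a i / 2) - (\<Prod>i<N. d i / 2)) \<le> (\<Sum>i<N. norm (a i / 2 - d i / 2))"
    using na nd by (intro norm_prod_diff) (auto simp: norm_divide)
  also have "\<dots> \<le> (\<Sum>i<N. R * (real (s + 2 * N) * (1 - r)))"
  proof (intro sum_mono)
    fix i assume "i \<in> {..<N}"
    moreover have "norm (a i / 2 - d i / 2) \<le> norm (a i - d i)"
      by (simp add: norm_divide flip: diff_divide_distrib)
    ultimately show "norm (a i / 2 - d i / 2) \<le> R * (real (s + 2 * N) * (1 - r))"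
      using ad[of i] by simp
  qed
  also have "(\<Prod>i<N. a i / 2) - (\<Prod>i<N. d i / 2) = ((\<Prod>i<N. a i) - (\<Prod>i<N. d i)) / 2 ^ N"
    by (simp add: prod_dividef diff_divide_distrib)
  finally have diff: "norm ((\<Prod>i<N. a i) - (\<Prod>i<N. d i)) \<le> 2 ^ N * real (N * (s + 2 * N)) * R * (1 - r)"
    by (simp add: norm_divide norm_power divide_le_eq mult_ac)
  have "(\<Prod>i<N. d i) = 1 - (z * of_real R) ^ N"
    unfolding d_def by (rule prod_one_minus_primitive_root[OF prim])
  also have "\<dots> = of_real (1 - R ^ N)" using z by (simp add: power_mult_distrib)
  finally have "norm (\<Prod>i<N. d i) = 1 - R ^ N"
    using R by (simp only: norm_of_real) (simp add: power_le_one)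
  with diff show ?thesis
    using norm_triangle_ineq2[of "\<Prod>i<N. a i" "\<Prod>i<N. d i"]
    unfolding qpoch_fin_def a_def by simp
qed

lemma norm_qpoch_fin_quadratic_bound:
  assumes prim: "primitive_root_of_unity N \<omega>" and z: "z ^ N = 1"
  obtains K :: real where
    "\<And>r n. 0 < r \<Longrightarrow> r < 1 \<Longrightarrow> 2 * N \<le> n \<Longrightarrow>
      norm (qpoch_fin (z * of_real r ^ s) (\<omega> * (of_real r)\<^sup>2) n) \<le> K * (1 - r)\<^sup>2"
proof -
  have N: "N > 0" "\<omega> ^ N = 1" using prim by (auto simp: primitive_root_of_unity_def)
  have unit: "norm y = 1" if "y ^ N = 1" for y :: complex
    using power_eq_1_iff[OF that] N by simp
  note \<omega> = unit[OF N(2)] and z1 = unit[OF z]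
  define C where "C = 2 ^ N * real (N * (s + 2 * N))"
  define D where "D = C + real (2 * N * N)"
  have C0: "C \<ge> 0" by (simp add: C_def)
  have "norm (qpoch_fin (z * of_real r ^ s) (\<omega> * (of_real r)\<^sup>2) n) \<le> 2 ^ N * D\<^sup>2 * exp C * (1 - r)\<^sup>2"
    if r: "0 < r" "r < 1" and n: "2 * N \<le> n" for r n
  proof -
    let ?a = "z * of_real r ^ s" and ?q = "\<omega> * (of_real r)\<^sup>2"
    have qN: "?q ^ (N * m) = of_real (r ^ (2 * N * m))" for m
      using N by (simp add: power_mult_distrib power_mult)
    have block: "norm (qpoch_fin (?a * ?q ^ (N * m)) ?q N)
        \<le> 1 - (r ^ (2 * N * m)) ^ N + C * r ^ (2 * N * m) * (1 - r)" for m
      unfolding qN C_def using r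
      by (intro norm_qpoch_block_le[OF prim \<omega> z1 z]) (auto simp: power_le_one)
    have first: "norm (qpoch_fin (?a * ?q ^ (N * m)) ?q N) \<le> D * (1 - r)" if "m \<le> 1" for m
    proof -
      have "1 - (r ^ (2 * N * m)) ^ N \<le> real (2 * N * m * N) * (1 - r)"
        using one_minus_power_le[of r "2 * N * m * N"] r by (simp add: power_mult)
      also have "\<dots> \<le> real (2 * N * N) * (1 - r)"
        using that r by (intro mult_right_mono of_nat_mono) (auto simp: mult_le_cancel2)
      finally have "1 - (r ^ (2 * N * m)) ^ N \<le> real (2 * N * N) * (1 - r)" .
      moreover have "C * r ^ (2 * N * m) * (1 - r) \<le> C * 1 * (1 - r)"
        using r C0 by (intro mult_right_mono mult_left_mono power_le_one) auto
      ultimately show ?thesis using block[of m] by (simp add: D_def algebra_simps)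
    qed
    have rest: "norm (qpoch_fin (?a * ?q ^ (N * (m + 2))) ?q N) \<le> exp (C * (1 - r) * r ^ m)" for m
    proof -
      have "r ^ (2 * N * (m + 2)) \<le> r ^ m"
      proof (rule power_decreasing)
        have "1 * m \<le> 2 * N * (m + 2)" using N by (intro mult_mono) auto
        then show "m \<le> 2 * N * (m + 2)" by simp
      qed (use r in auto)
      then have "C * (1 - r) * r ^ (2 * N * (m + 2)) \<le> C * (1 - r) * r ^ m"
        using r C0 by (intro mult_left_mono) auto
      moreover have "0 \<le> (r ^ (2 * N * (m + 2))) ^ N" using r by simp
      ultimately have "norm (qpoch_fin (?a * ?q ^ (N * (m + 2))) ?q N) \<le> 1 + C * (1 - r) * r ^ m"
        using block[of "m + 2"] by (simp add: mult_ac)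
      also have "\<dots> \<le> exp (C * (1 - r) * r ^ m)" by (rule exp_ge_add_one_self)
      finally show ?thesis .
    qed
    have blocks: "norm (qpoch_fin ?a ?q (N * (m + 2))) \<le> (D * (1 - r))\<^sup>2 * exp (C * (1 - r) * (\<Sum>i<m. r ^ i))" for m
    proof (induction m)
      case 0
      have e: "N * (0 + 2) = N + N" by simp
      show ?case
        unfolding e qpoch_fin_add norm_mult
        using mult_mono[OF first[of 0] first[of 1]] order_trans[OF norm_ge_zero first[of 0]]
        by (simp add: power2_eq_square)
    next
      case (Suc m)
      have "qpoch_fin ?a ?q (N * (Suc m + 2)) = qpoch_fin ?a ?q (N * (m + 2)) * qpoch_fin (?a * ?q ^ (N * (m + 2))) ?q N"
        using qpoch_fin_add[of ?a ?q "N * (m + 2)" N] by (simp add: algebra_simps)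
      then have "norm (qpoch_fin ?a ?q (N * (Suc m + 2)))
          \<le> (D * (1 - r))\<^sup>2 * exp (C * (1 - r) * (\<Sum>i<m. r ^ i)) * exp (C * (1 - r) * r ^ m)"
        unfolding norm_mult[symmetric] using mult_mono[OF Suc rest[of m]] by (simp only: norm_mult) simp
      then show ?case by (simp add: distrib_left mult.assoc flip: exp_add)
    qed
    have geo: "(1 - r) * (\<Sum>i<m. r ^ i) \<le> 1" for m
      using r by (simp add: one_diff_power_eq[symmetric])
    define m where "m = n div N - 2"
    have "2 \<le> n div N" using n N by (simp add: less_eq_div_iff_mult_less_eq)
    then have "n div N = m + 2" by (simp add: m_def)
    then have nm: "n = N * (m + 2) + n mod N" by (metis mult_div_mod_eq)
    have q1: "norm ?q \<le> 1" using \<omega> r by (simp add: norm_mult norm_power power_le_one)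
    have "norm (?a * ?q ^ (N * (m + 2))) = r ^ s * norm ?q ^ (N * (m + 2))"
      using z1 r by (simp add: norm_mult norm_power)
    also have "\<dots> \<le> 1 * 1" using q1 r by (intro mult_mono power_le_one) auto
    finally have "norm (qpoch_fin (?a * ?q ^ (N * (m + 2))) ?q (n mod N)) \<le> 2 ^ (n mod N)"
      using q1 by (intro norm_qpoch_fin_le) auto
    also have "\<dots> \<le> 2 ^ N" using N by (intro power_increasing) (auto intro: less_imp_le)
    finally have tail: "norm (qpoch_fin (?a * ?q ^ (N * (m + 2))) ?q (n mod N)) \<le> 2 ^ N" .
    have "norm (qpoch_fin ?a ?q (N * (m + 2))) \<le> (D * (1 - r))\<^sup>2 * exp C"
    proof (rule order_trans[OF blocks[of m]], intro mult_left_mono)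
      show "exp (C * (1 - r) * (\<Sum>i<m. r ^ i)) \<le> exp C"
        using mult_left_mono[OF geo[of m] C0] by (simp add: mult.assoc)
    qed simp
    from mult_mono[OF this tail] show ?thesis
      unfolding arg_cong[OF nm, of "qpoch_fin ?a ?q"] qpoch_fin_add norm_mult
      by (simp add: power_mult_distrib mult_ac)
  qed
  then show ?thesis using that by blast
qed

lemma radial_limit_qpoch_sums:
  fixes w :: "nat \<Rightarrow> real \<Rightarrow> complex"
  assumes prim: "primitive_root_of_unity N \<omega>" and z: "z ^ N = 1"
    and w: "\<And>n r. 0 < r \<Longrightarrow> r < 1 \<Longrightarrow> norm (w n r) \<le> r ^ n"
    and W: "\<And>n. (w n \<longlongrightarrow> W n) (at_left 1)"
    and van: "\<And>n. k \<le> n \<Longrightarrow> qpoch_fin z \<omega> n = 0"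
    and sums: "\<And>r. 0 < r \<Longrightarrow> r < 1 \<Longrightarrow>
        (\<lambda>n. w n r * qpoch_fin (z * of_real r ^ s) (\<omega> * (of_real r)\<^sup>2) n) sums S r"
  shows "(S \<longlongrightarrow> (\<Sum>n<k. W n * qpoch_fin z \<omega> n)) (at_left 1)"
proof -
  obtain K where K: "\<And>r n. 0 < r \<Longrightarrow> r < 1 \<Longrightarrow> 2 * N \<le> n \<Longrightarrow>
      norm (qpoch_fin (z * of_real r ^ s) (\<omega> * (of_real r)\<^sup>2) n) \<le> K * (1 - r)\<^sup>2"
    using norm_qpoch_fin_quadratic_bound[OF prim z] by blast
  define P where "P n r = qpoch_fin (z * of_real r ^ s) (\<omega> * (of_real r)\<^sup>2) n" for n and r :: real
  define L where "L = max k (2 * N)"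
  have near: "eventually (\<lambda>r. 0 < r \<and> r < (1::real)) (at_left 1)"
    using eventually_at_left_real[of 0 1] by (auto elim: eventually_mono)
  have P1: "(P n \<longlongrightarrow> qpoch_fin z \<omega> n) (at_left 1)" for n
  proof -
    have "((\<lambda>r. \<Prod>j<n. 1 - z * of_real r ^ s * (\<omega> * (of_real r)\<^sup>2) ^ j)
        \<longlongrightarrow> (\<Prod>j<n. 1 - z * of_real 1 ^ s * (\<omega> * (of_real 1)\<^sup>2) ^ j)) (at_left 1)"
      by (intro tendsto_intros)
    then show ?thesis by (simp add: P_def[abs_def] qpoch_fin_def)
  qed
  have tail: "norm (S r - (\<Sum>n<L. w n r * P n r)) \<le> K * (1 - r)" if r: "0 < r" "r < 1" for r
  proof -
    note sm = sums[OF r, folded P_def]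
    have le: "norm (w (n + L) r * P (n + L) r) \<le> K * (1 - r)\<^sup>2 * r ^ n" for n
    proof -
      have "norm (w (n + L) r) \<le> r ^ n"
        by (rule order_trans[OF w[OF r] power_decreasing]) (use r in auto)
      moreover have "norm (P (n + L) r) \<le> K * (1 - r)\<^sup>2"
        unfolding P_def by (rule K[OF r]) (simp add: L_def)
      ultimately show ?thesis
        using mult_mono[of "norm (w (n + L) r)" "r ^ n" "norm (P (n + L) r)" "K * (1 - r)\<^sup>2"] r
        by (simp add: norm_mult mult_ac)
    qed
    have "S r - (\<Sum>n<L. w n r * P n r) = (\<Sum>n. w (n + L) r * P (n + L) r)"
      using sm suminf_minus_initial_segment[OF sums_summable[OF sm], of L] by (simp add: sums_iff)
    also have "norm \<dots> \<le> (\<Sum>n. K * (1 - r)\<^sup>2 * r ^ n)"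
      using r by (intro norm_suminf_le le summable_mult summable_geometric) auto
    also have "\<dots> = K * (1 - r)\<^sup>2 * (1 / (1 - r))"
      using r by (subst suminf_mult) (auto intro!: summable_geometric simp: suminf_geometric)
    also have "\<dots> = K * (1 - r)" using r by (simp add: power2_eq_square)
    finally show ?thesis .
  qed
  have lim0: "((\<lambda>r. K * (1 - r)) \<longlongrightarrow> 0) (at_left 1)" by (auto intro!: tendsto_eq_intros)
  have "eventually (\<lambda>r. norm (S r - (\<Sum>n<L. w n r * P n r)) \<le> K * (1 - r)) (at_left 1)"
    by (rule eventually_mono[OF near]) (simp add: tail)
  from Lim_null_comparison[OF this lim0] have "((\<lambda>r. S r - (\<Sum>n<L. w n r * P n r)) \<longlongrightarrow> 0) (at_left 1)" .
  moreover have "((\<lambda>r. \<Sum>n<L. w n r * P n r) \<longlongrightarrow> (\<Sum>n<L. W n * qpoch_fin z \<omega> n)) (at_left 1)"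
    by (intro tendsto_intros W P1)
  ultimately have "((\<lambda>r. (S r - (\<Sum>n<L. w n r * P n r)) + (\<Sum>n<L. w n r * P n r))
      \<longlongrightarrow> 0 + (\<Sum>n<L. W n * qpoch_fin z \<omega> n)) (at_left 1)"
    by (rule tendsto_add)
  moreover have "(\<Sum>n<L. W n * qpoch_fin z \<omega> n) = (\<Sum>n<k. W n * qpoch_fin z \<omega> n)"
    by (rule sum.mono_neutral_right) (auto simp: L_def van)
  ultimately show ?thesis by simp
qed


lemma sums_negative_indices:
  fixes c :: "int \<Rightarrow> complex"
  assumes "c summable_on UNIV"
  shows "(\<lambda>n. c (- int n - 1)) sums (infsum c UNIV - infsum c {0..})"
proof -
  have U: "UNIV = {0..} \<union> {..<0::int}" by auto
  have sm: "c summable_on {0..}" "c summable_on {..<0}"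
    using summable_on_subset_banach[OF assms] by blast+
  have "infsum c UNIV = infsum c {0..} + infsum c {..<0}"
    unfolding U using sm by (intro infsum_Un_disjoint) auto
  moreover have "((\<lambda>n. c (- int n - 1)) has_sum infsum c {..<0}) UNIV"
    using has_sum_infsum[OF sm(2)]
    by (subst has_sum_reindex_bij_witness[of UNIV "\<lambda>n. nat (- n - 1)" "\<lambda>n. - int n - 1" "{..<0}" c]) auto
  ultimately show ?thesis using has_sum_imp_sums by fastforce
qed

context punctured_unit_disc
begin

lemma qpoch_denominators_nz:
  "qpoch_inf (- (q\<^sup>2)) (q\<^sup>2) \<noteq> 0" "qpoch_inf q (q\<^sup>2) \<noteq> 0" "qpoch_inf (- q) (q\<^sup>2) \<noteq> 0"
  using qpoch_inf_nonzero_of_norm[OF sq1] q1 sq1 by auto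

lemma bilateral_term_down:
  assumes "x \<noteq> 0"
  shows "bilateral_term x b (q\<^sup>2) (n - 1) = bilateral_term x b (q\<^sup>2) n * ((b - q powi (2 - 2 * n)) / x)"
proof -
  have q2: "(q\<^sup>2) powi k = q powi (2 * k)" for k by (simp add: power_int_mult)
  define Q where "Q = q powi (2 * (n - 1))"
  have Q: "Q \<noteq> 0" "q powi (2 - 2 * n) = inverse Q"
    using q0 power_int_minus[of q "2 * (n - 1)"] by (auto simp: Q_def algebra_simps)
  have g: "gauss_term x (q\<^sup>2) n = - x * Q * gauss_term x (q\<^sup>2) (n - 1)"
    using gauss_term_step[OF assms sq0, of "n - 1"] by (simp add: q2 Q_def)
  have p: "qpoch_inf (b * (q\<^sup>2) powi (n - 1)) (q\<^sup>2) = (1 - b * Q) * qpoch_inf (b * (q\<^sup>2) powi n) (q\<^sup>2)"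
    using qpoch_inf_powi_step[OF sq1 sq0, of b "n - 1"] by (simp add: q2 Q_def)
  show ?thesis
    unfolding bilateral_term_def g p Q(2) using assms Q(1) by (simp add: field_simps)
qed

lemma c_phi_negative: "c_phi q (- int n - 1) = 2 * q ^ (n + 1) * qpoch_fin (- (q\<^sup>2)) (q\<^sup>2) n"
proof -
  have down: "c_phi q (m - 1) = c_phi q m * ((q powi (2 - 2 * m) + q\<^sup>2) / q)" for m
  proof -
    have "(- (q\<^sup>2) - Q) / (- q) = (Q + q\<^sup>2) / q" for Q using q0 by (simp add: field_simps)
    note e = this
    have nq: "- q \<noteq> 0" using q0 by simp
    show ?thesis unfolding c_phi_bilateral_term bilateral_term_down[OF nq] e by simp
  qed
  show ?thesis
  proof (induction n)
    case 0
    have "c_phi q 0 = 1" using qpoch_denominators_nz by (simp add: c_phi_bilateral_term bilateral_term_def)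
    then show ?case using down[of 0] q0 by (simp add: power2_eq_square field_simps)
  next
    case (Suc n)
    have "2 - 2 * (- int n - 1) = int (2 * n + 4)" by simp
    then have e: "q powi (2 - 2 * (- int n - 1)) = q ^ (2 * n + 4)" by (simp only: power_int_of_nat)
    have i: "- int (Suc n) - 1 = (- int n - 1) - 1" by simp
    show ?case
      unfolding i down[of "- int n - 1"] Suc e qpoch_fin_Suc using q0
      by (simp add: power_add power_mult eval_nat_numeral field_simps)
  qed
qed

lemma c_psi_negative: "c_psi q (- int n) = (- 1) ^ n * qpoch_fin q (q\<^sup>2) n"
proof -
  have down: "c_psi q (m - 1) = c_psi q m * ((q powi (2 - 2 * m) - q) / q)" for m
  proof -
    have "(q - Q) / (- q) = (Q - q) / q" for Q using q0 by (simp add: field_simps)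
    note e = this
    have nq: "- q \<noteq> 0" using q0 by simp
    show ?thesis unfolding c_psi_bilateral_term bilateral_term_down[OF nq] e by simp
  qed
  show ?thesis
  proof (induction n)
    case 0
    show "c_psi q (- int 0) = (- 1) ^ 0 * qpoch_fin q (q\<^sup>2) 0"
      using qpoch_denominators_nz by (simp add: c_psi_bilateral_term bilateral_term_def)
  next
    case (Suc n)
    have "2 - 2 * (- int n) = int (2 * n + 2)" by simp
    then have e: "q powi (2 - 2 * (- int n)) = q ^ (2 * n + 2)" by (simp only: power_int_of_nat)
    have i: "- int (Suc n) = (- int n) - 1" by simp
    show ?case
      unfolding i down[of "- int n"] Suc e qpoch_fin_Suc using q0
      by (simp add: power_add power_mult power2_eq_square field_simps)
  qed
qed

lemma c_nu_negative: "c_nu q (- int n - 1) = q ^ n * qpoch_fin (- q) (q\<^sup>2) n"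
proof -
  have down: "c_nu q (m - 1) = c_nu q m * (q powi (- 2 * m) + q)" for m
    unfolding c_nu_bilateral_term using bilateral_term_down[of "- 1" "- q" "m + 1"] by (simp add: field_simps)
  show ?thesis
  proof (induction n)
    case 0
    show "c_nu q (- int 0 - 1) = q ^ 0 * qpoch_fin (- q) (q\<^sup>2) 0"
      using qpoch_denominators_nz by (simp add: c_nu_bilateral_term bilateral_term_def)
  next
    case (Suc n)
    have "- 2 * (- int n - 1) = int (2 * n + 2)" by simp
    then have e: "q powi (- 2 * (- int n - 1)) = q ^ (2 * n + 2)" by (simp only: power_int_of_nat)
    have i: "- int (Suc n) - 1 = (- int n - 1) - 1" by simp
    show ?case
      unfolding i down[of "- int n - 1"] Suc e qpoch_fin_Suc
      by (simp add: power_add power_mult power2_eq_square algebra_simps)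
  qed
qed

lemma phi_minus_B_phi:
  "(\<lambda>n. q ^ n * qpoch_fin (- (q\<^sup>2)) (q\<^sup>2) n) sums ((mock_phi q - B_phi q) / (- 2 * q))"
proof -
  have "(\<lambda>n. 2 * q ^ (n + 1) * qpoch_fin (- (q\<^sup>2)) (q\<^sup>2) n) sums (B_phi q - mock_phi q)"
    using sums_negative_indices[OF summable_c_phi] summable_c_phi
    unfolding c_phi_negative B_phi_def bilateral_sum_def mock_phi_def by simp
  from sums_mult[OF this, of "1 / (2 * q)"]
  have "(\<lambda>n. q ^ n * qpoch_fin (- (q\<^sup>2)) (q\<^sup>2) n) sums ((B_phi q - mock_phi q) / (2 * q))"
    using q0 by (simp add: field_simps)
  moreover have "(B_phi q - mock_phi q) / (2 * q) = (mock_phi q - B_phi q) / (- 2 * q)"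
    using q0 by (simp add: field_simps)
  ultimately show ?thesis by simp
qed

lemma nu_minus_B_nu:
  "(\<lambda>n. q ^ n * qpoch_fin (- q) (q\<^sup>2) n) sums (- (mock_nu q - B_nu q))"
  using sums_negative_indices[OF summable_c_nu] summable_c_nu
  unfolding c_nu_negative B_nu_def bilateral_sum_def mock_nu_def by simp

lemma psi_minus_B_psi:
  "(\<lambda>n. (- 1) ^ n * q ^ (2 * n + 1) * qpoch_fin q (q\<^sup>2) n) sums (- 2 * (mock_psi q - B_psi q) - 1)"
proof -
  define d where "d n = c_psi q n + c_psi q (n + 1)" for n
  have d: "d (- int n - 1) = (- 1) ^ n * q ^ (2 * n + 1) * qpoch_fin q (q\<^sup>2) n" for n
  proof -
    have e: "- int n - 1 = - int (Suc n)" by simp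
    have "- int n - 1 + 1 = - int n" by simp
    then show ?thesis
      unfolding d_def by (simp only: e c_psi_negative qpoch_fin_Suc) (simp add: algebra_simps flip: power_mult)
  qed
  have sm: "d summable_on UNIV" using summable_c_psi_pair by (simp add: d_def[abs_def])
  have B: "B_psi q = infsum d UNIV / 2" by (simp add: B_psi_pair d_def[abs_def])
  have s0: "c_psi q summable_on {0..}" by (rule summable_c_psi_nonneg)
  have s1: "c_psi q summable_on {1..}" by (rule summable_on_subset_banach[OF s0]) auto
  have sh: "infsum (\<lambda>n. c_psi q (n + 1)) {0..} = infsum (c_psi q) {1..}"
    by (rule infsum_reindex_bij_witness[of _ "\<lambda>n. n - 1" "\<lambda>n. n + 1"]) auto
  have sh': "(\<lambda>n. c_psi q (n + 1)) summable_on {0..}"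
    using s1 by (subst summable_on_reindex_bij_witness[of _ "\<lambda>n. n - 1" "\<lambda>n. n + 1" "{1..}" "c_psi q"]) auto
  have c0: "c_psi q 0 = 1" using c_psi_negative[of 0] by simp
  have "{0..} = insert (0::int) {1..}" by auto
  then have "infsum (c_psi q) {0..} = 1 + infsum (c_psi q) {1..}"
    using infsum_insert[OF s1, of 0] by (simp add: c0)
  then have "infsum d {0..} = 1 + 2 * mock_psi q"
    unfolding d_def[abs_def] using infsum_add[OF s0 sh'] sh by (simp add: mock_psi_def)
  with sums_negative_indices[OF sm] B show ?thesis
    unfolding d by (simp add: algebra_simps)
qed

end

lemma has_radial_limitI:
  assumes "(g \<longlongrightarrow> L) (at_left 1)"
    and "\<And>r. 0 < r \<Longrightarrow> r < 1 \<Longrightarrow> f (of_real r * \<zeta>) = g r"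
  shows "has_radial_limit f \<zeta> L"
proof -
  have "eventually (\<lambda>r. g r = f (of_real r * \<zeta>)) (at_left 1)"
    using eventually_at_left_real[of 0 1] assms(2) by (auto elim: eventually_mono)
  then show ?thesis
    unfolding has_radial_limit_def by (rule Lim_transform_eventually[OF assms(1)])
qed

lemma primitive_root_of_unity_norm:
  assumes "primitive_root_of_unity m \<zeta>"
  shows "norm \<zeta> = 1"
  using assms power_eq_1_iff[of \<zeta> m] by (auto simp: primitive_root_of_unity_def)

lemma punctured_unit_disc_radius:
  assumes "primitive_root_of_unity m \<zeta>" "0 < r" "r < 1"
  shows "punctured_unit_disc (of_real r * \<zeta>)"
proof
  show "norm (of_real r * \<zeta>) < 1" "of_real r * \<zeta> \<noteq> 0"
    using primitive_root_of_unity_norm[OF assms(1)] assms(2,3) by (auto simp: norm_mult)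
qed

lemma primitive_root_of_unity_square_even:
  assumes "primitive_root_of_unity (2 * m) \<zeta>"
  shows "primitive_root_of_unity m (\<zeta>\<^sup>2)" and "\<zeta> ^ m = - 1"
proof -
  have m: "m > 0" "\<zeta> ^ (2 * m) = 1" "\<And>j. 0 < j \<Longrightarrow> j < 2 * m \<Longrightarrow> \<zeta> ^ j \<noteq> 1"
    using assms by (auto simp: primitive_root_of_unity_def)
  then show "primitive_root_of_unity m (\<zeta>\<^sup>2)"
    by (auto simp: primitive_root_of_unity_def simp flip: power_mult)
  have "(\<zeta> ^ m)\<^sup>2 = 1" using m by (simp add: mult.commute flip: power_mult)
  moreover have "\<zeta> ^ m \<noteq> 1" using m by auto
  ultimately show "\<zeta> ^ m = - 1" by (auto simp: power2_eq_1_iff)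
qed

lemma primitive_root_of_unity_square_odd:
  assumes "primitive_root_of_unity m \<zeta>" "odd m"
  shows "primitive_root_of_unity m (\<zeta>\<^sup>2)"
proof -
  have m: "m > 0" "\<zeta> ^ m = 1" and prim: "\<And>j. 0 < j \<Longrightarrow> j < m \<Longrightarrow> \<zeta> ^ j \<noteq> 1"
    using assms by (auto simp: primitive_root_of_unity_def)
  have "(\<zeta>\<^sup>2) ^ j \<noteq> 1" if j: "0 < j" "j < m" for j
  proof
    assume eq: "(\<zeta>\<^sup>2) ^ j = 1"
    then have eq': "\<zeta> ^ (2 * j) = 1" by (simp add: power_mult)
    show False
    proof (cases "2 * j < m")
      case True
      then show ?thesis using prim[of "2 * j"] j eq' by simp
    next
      case False
      moreover have "2 * j \<noteq> m" using assms(2) by auto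
      ultimately have l: "0 < 2 * j - m" "2 * j - m < m" "2 * j = m + (2 * j - m)" using j by auto
      have "\<zeta> ^ (2 * j) = \<zeta> ^ m * \<zeta> ^ (2 * j - m)" by (subst l(3)) (rule power_add)
      with prim[OF l(1,2)] eq' m show ?thesis by simp
    qed
  qed
  moreover have "(\<zeta>\<^sup>2) ^ m = 1" using m by (metis power_mult mult.commute power_one)
  ultimately show ?thesis using m by (auto simp: primitive_root_of_unity_def)
qed

lemma qpoch_fin_eq_0:
  assumes "a * q ^ j = 1" "j < n"
  shows "qpoch_fin a q n = 0"
  using assms by (auto simp: qpoch_fin_def intro!: bexI[of _ j])

lemma norm_radial_power:
  fixes r :: real and \<zeta> :: complex
  assumes "norm \<zeta> = 1" "0 < r"
  shows "norm ((of_real r * \<zeta>) ^ n) = r ^ n"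
  using assms by (simp add: norm_mult norm_power power_mult_distrib)

theorem radial_limit_phi:
  assumes k: "k \<ge> 1" and prim: "primitive_root_of_unity (4 * k) \<zeta>"
  shows "has_radial_limit (\<lambda>q. mock_phi q - B_phi q) \<zeta>
    (- 2 * \<zeta> * (\<Sum>n<k. \<zeta> ^ n * qpoch_fin (- (\<zeta>\<^sup>2)) (\<zeta>\<^sup>2) n))"
proof (rule has_radial_limitI)
  have p: "primitive_root_of_unity (2 * (2 * k)) \<zeta>" using prim by simp
  note n1 = primitive_root_of_unity_norm[OF prim]
  note sq = primitive_root_of_unity_square_even[OF p]
  define S where "S r = (mock_phi (of_real r * \<zeta>) - B_phi (of_real r * \<zeta>)) / (- 2 * (of_real r * \<zeta>))" for r
  have "(S \<longlongrightarrow> (\<Sum>n<k. \<zeta> ^ n * qpoch_fin (- (\<zeta>\<^sup>2)) (\<zeta>\<^sup>2) n)) (at_left 1)"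
  proof (rule radial_limit_qpoch_sums[where w = "\<lambda>n r. (of_real r * \<zeta>) ^ n" and s = 2, OF sq(1)])
    show "(- (\<zeta>\<^sup>2)) ^ (2 * k) = 1"
      using sq by (simp add: primitive_root_of_unity_def)
    show "norm ((of_real r * \<zeta>) ^ n) \<le> r ^ n" if "0 < r" "r < 1" for r n
      using norm_radial_power[OF n1 that(1), of n] by simp
    have "((\<lambda>r. (of_real r * \<zeta>) ^ n) \<longlongrightarrow> (of_real 1 * \<zeta>) ^ n) (at_left 1)" for n
      by (intro tendsto_intros)
    then show "((\<lambda>r. (of_real r * \<zeta>) ^ n) \<longlongrightarrow> \<zeta> ^ n) (at_left 1)" for n by simp
    show "qpoch_fin (- (\<zeta>\<^sup>2)) (\<zeta>\<^sup>2) n = 0" if "k \<le> n" for n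
    proof (rule qpoch_fin_eq_0[of _ _ "k - 1"])
      have "(\<zeta>\<^sup>2) * (\<zeta>\<^sup>2) ^ (k - 1) = (\<zeta>\<^sup>2) ^ k" using k by (cases k) auto
      then show "- (\<zeta>\<^sup>2) * (\<zeta>\<^sup>2) ^ (k - 1) = 1" using sq(2) by (simp flip: power_mult)
    qed (use that k in auto)
    show "(\<lambda>n. (of_real r * \<zeta>) ^ n * qpoch_fin (- (\<zeta>\<^sup>2) * of_real r ^ 2) (\<zeta>\<^sup>2 * (of_real r)\<^sup>2) n) sums S r"
      if "0 < r" "r < 1" for r
      using punctured_unit_disc.phi_minus_B_phi[OF punctured_unit_disc_radius[OF prim that]]
      by (simp add: S_def power_mult_distrib mult_ac)
  qed
  then show "((\<lambda>r. - 2 * (of_real r * \<zeta>) * S r) \<longlongrightarrow>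
      - 2 * \<zeta> * (\<Sum>n<k. \<zeta> ^ n * qpoch_fin (- (\<zeta>\<^sup>2)) (\<zeta>\<^sup>2) n)) (at_left 1)"
    by (auto intro!: tendsto_eq_intros)
  show "mock_phi (of_real r * \<zeta>) - B_phi (of_real r * \<zeta>) = - 2 * (of_real r * \<zeta>) * S r"
    if "0 < r" "r < 1" for r
    using punctured_unit_disc.q0[OF punctured_unit_disc_radius[OF prim that]] by (simp add: S_def)
qed

theorem radial_limit_nu:
  assumes k: "k \<ge> 1" and prim: "primitive_root_of_unity (4 * k - 2) \<zeta>"
  shows "has_radial_limit (\<lambda>q. mock_nu q - B_nu q) \<zeta>
    (- (\<Sum>n<k. \<zeta> ^ n * qpoch_fin (- \<zeta>) (\<zeta>\<^sup>2) n))"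
proof (rule has_radial_limitI)
  have "4 * k - 2 = 2 * (2 * k - 1)" using k by simp
  then have p: "primitive_root_of_unity (2 * (2 * k - 1)) \<zeta>" using prim by simp
  note n1 = primitive_root_of_unity_norm[OF prim]
  note sq = primitive_root_of_unity_square_even[OF p]
  define S where "S r = - (mock_nu (of_real r * \<zeta>) - B_nu (of_real r * \<zeta>))" for r
  have "(S \<longlongrightarrow> (\<Sum>n<k. \<zeta> ^ n * qpoch_fin (- \<zeta>) (\<zeta>\<^sup>2) n)) (at_left 1)"
  proof (rule radial_limit_qpoch_sums[where w = "\<lambda>n r. (of_real r * \<zeta>) ^ n" and s = 1, OF sq(1)])
    show "(- \<zeta>) ^ (2 * k - 1) = 1"
      using sq k by simp
    show "norm ((of_real r * \<zeta>) ^ n) \<le> r ^ n" if "0 < r" "r < 1" for r n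
      using norm_radial_power[OF n1 that(1), of n] by simp
    have "((\<lambda>r. (of_real r * \<zeta>) ^ n) \<longlongrightarrow> (of_real 1 * \<zeta>) ^ n) (at_left 1)" for n
      by (intro tendsto_intros)
    then show "((\<lambda>r. (of_real r * \<zeta>) ^ n) \<longlongrightarrow> \<zeta> ^ n) (at_left 1)" for n by simp
    show "qpoch_fin (- \<zeta>) (\<zeta>\<^sup>2) n = 0" if "k \<le> n" for n
    proof (rule qpoch_fin_eq_0[of _ _ "k - 1"])
      have "2 * k - 1 = 1 + 2 * (k - 1)" using k by simp
      then have "\<zeta> * (\<zeta>\<^sup>2) ^ (k - 1) = \<zeta> ^ (2 * k - 1)" by (simp add: power_mult)
      then show "- \<zeta> * (\<zeta>\<^sup>2) ^ (k - 1) = 1" using sq(2) by simp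
    qed (use that k in auto)
    show "(\<lambda>n. (of_real r * \<zeta>) ^ n * qpoch_fin (- \<zeta> * of_real r ^ 1) (\<zeta>\<^sup>2 * (of_real r)\<^sup>2) n) sums S r"
      if "0 < r" "r < 1" for r
      using punctured_unit_disc.nu_minus_B_nu[OF punctured_unit_disc_radius[OF prim that]]
      by (simp add: S_def power_mult_distrib mult_ac)
  qed
  then show "((\<lambda>r. - S r) \<longlongrightarrow> - (\<Sum>n<k. \<zeta> ^ n * qpoch_fin (- \<zeta>) (\<zeta>\<^sup>2) n)) (at_left 1)"
    by (rule tendsto_minus)
  show "mock_nu (of_real r * \<zeta>) - B_nu (of_real r * \<zeta>) = - S r" for r
    by (simp add: S_def)
qed

theorem radial_limit_psi:
  assumes k: "k \<ge> 1" and prim: "primitive_root_of_unity (2 * k - 1) \<zeta>"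
  shows "has_radial_limit (\<lambda>q. mock_psi q - B_psi q) \<zeta>
    (- (\<Sum>n<k. (- 1) ^ n * qpoch_fin \<zeta> (\<zeta>\<^sup>2) n))"
proof (rule has_radial_limitI)
  have odd: "odd (2 * k - 1)" using k by simp
  note n1 = primitive_root_of_unity_norm[OF prim]
  note sq = primitive_root_of_unity_square_odd[OF prim odd]
  have one: "\<zeta> ^ (2 * k - 1) = 1" using prim by (simp add: primitive_root_of_unity_def)
  define S where "S r = - 2 * (mock_psi (of_real r * \<zeta>) - B_psi (of_real r * \<zeta>)) - 1" for r
  have van: "qpoch_fin \<zeta> (\<zeta>\<^sup>2) n = 0" if "k \<le> n" for n
  proof (rule qpoch_fin_eq_0[of _ _ "k - 1"])
    have "2 * k - 1 = 1 + 2 * (k - 1)" using k by simp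
    then show "\<zeta> * (\<zeta>\<^sup>2) ^ (k - 1) = 1" using one by (simp add: power_mult)
  qed (use that k in auto)
  have lim: "(S \<longlongrightarrow> (\<Sum>n<k. (- 1) ^ n * \<zeta> ^ (2 * n + 1) * qpoch_fin \<zeta> (\<zeta>\<^sup>2) n)) (at_left 1)"
  proof (rule radial_limit_qpoch_sums[where w = "\<lambda>n r. (- 1) ^ n * (of_real r * \<zeta>) ^ (2 * n + 1)" and s = 1, OF sq one])
    show "norm ((- 1) ^ n * (of_real r * \<zeta>) ^ (2 * n + 1)) \<le> r ^ n" if "0 < r" "r < 1" for r n
      using norm_radial_power[OF n1 that(1), of "2 * n + 1"] power_decreasing[of n "2 * n + 1" r] that
      by (simp add: norm_mult norm_power del: power_Suc)
    have "((\<lambda>r. (- 1) ^ n * (of_real r * \<zeta>) ^ (2 * n + 1)) \<longlongrightarrow> (- 1) ^ n * (of_real 1 * \<zeta>) ^ (2 * n + 1)) (at_left 1)" for n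
      by (intro tendsto_intros)
    then show "((\<lambda>r. (- 1) ^ n * (of_real r * \<zeta>) ^ (2 * n + 1)) \<longlongrightarrow> (- 1) ^ n * \<zeta> ^ (2 * n + 1)) (at_left 1)" for n
      by simp
    show "(\<lambda>n. (- 1) ^ n * (of_real r * \<zeta>) ^ (2 * n + 1) * qpoch_fin (\<zeta> * of_real r ^ 1) (\<zeta>\<^sup>2 * (of_real r)\<^sup>2) n) sums S r"
      if "0 < r" "r < 1" for r
      using punctured_unit_disc.psi_minus_B_psi[OF punctured_unit_disc_radius[OF prim that]]
      by (simp add: S_def power_mult_distrib mult_ac)
  qed (rule van)
  have tele: "1 + (\<Sum>n<m. (- 1) ^ n * \<zeta> ^ (2 * n + 1) * qpoch_fin \<zeta> (\<zeta>\<^sup>2) n)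
      = 2 * (\<Sum>n<m. (- 1) ^ n * qpoch_fin \<zeta> (\<zeta>\<^sup>2) n) + (- 1) ^ m * qpoch_fin \<zeta> (\<zeta>\<^sup>2) m" for m
    by (induction m) (simp_all add: qpoch_fin_Suc algebra_simps flip: power_mult)
  have "((\<lambda>r. - (1 + S r) / 2) \<longlongrightarrow> - (1 + (\<Sum>n<k. (- 1) ^ n * \<zeta> ^ (2 * n + 1) * qpoch_fin \<zeta> (\<zeta>\<^sup>2) n)) / 2) (at_left 1)"
    by (intro tendsto_intros lim) auto
  then show "((\<lambda>r. - (1 + S r) / 2) \<longlongrightarrow> - (\<Sum>n<k. (- 1) ^ n * qpoch_fin \<zeta> (\<zeta>\<^sup>2) n)) (at_left 1)"
    unfolding tele using van[of k] by simp
  show "mock_psi (of_real r * \<zeta>) - B_psi (of_real r * \<zeta>) = - (1 + S r) / 2" for r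
    by (simp add: S_def)
qed

section \<open>The eta function under \<open>SL\<^sub>2(\<int>)\<close>\<close>

definition qexp :: "complex \<Rightarrow> complex" where
  "qexp z = exp (2 * of_real pi * \<i> * z)"

lemma qexp_add: "qexp (x + y) = qexp x * qexp y"
  by (simp add: qexp_def algebra_simps flip: exp_add)

lemma qexp_diff: "qexp (x - y) = qexp x / qexp y"
  by (simp add: qexp_def algebra_simps flip: exp_diff)

lemma qexp_minus: "qexp (- x) = 1 / qexp x"
  using qexp_diff[of 0 x] by (simp add: qexp_def)

lemma qexp_nz [simp]: "qexp z \<noteq> 0"
  by (simp add: qexp_def)

lemma qexp_0 [simp]: "qexp 0 = 1"
  by (simp add: qexp_def)

lemma qexp_of_nat_mult: "qexp (of_nat n * z) = qexp z ^ n"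
  by (simp add: qexp_def mult_ac flip: exp_of_nat_mult)

lemma norm_qexp: "norm (qexp z) = exp (- 2 * pi * Im z)"
  by (simp add: qexp_def)

lemma norm_qexp_lt_1: "Im z > 0 \<Longrightarrow> norm (qexp z) < 1"
  by (simp add: norm_qexp)

lemma qexp_eq_1_iff: "qexp z = 1 \<longleftrightarrow> (\<exists>n::int. z = of_int n)"
proof -
  have "Re (2 * of_real pi * \<i> * z) = - 2 * pi * Im z" "Im (2 * of_real pi * \<i> * z) = 2 * pi * Re z"
    by simp_all
  then have "qexp z = 1 \<longleftrightarrow> Im z = 0 \<and> (\<exists>n::int. Re z = of_int n)"
    unfolding qexp_def exp_eq_1 by auto
  then show ?thesis by (auto simp: complex_eq_iff)
qed

lemma qexp_1 [simp]: "qexp 1 = 1" and qexp_half: "qexp (1 / 2) = - 1"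
  using qexp_eq_1_iff[of 1] by (auto simp: qexp_def intro: exI[of _ "1::int"])

lemma holomorphic_on_qexp [holomorphic_intros]:
  "f holomorphic_on S \<Longrightarrow> (\<lambda>z. qexp (f z)) holomorphic_on S"
  unfolding qexp_def by (intro holomorphic_intros)

lemma has_field_derivative_qexp: "(qexp has_field_derivative 2 * of_real pi * \<i> * qexp z) (at z)"
  unfolding qexp_def by (auto intro!: derivative_eq_intros)

lemma int_translate_invariant:
  fixes z \<omega> :: complex
  assumes "\<And>z. P (z + \<omega>) \<longleftrightarrow> P z"
  shows "P (z + of_int n * \<omega>) \<longleftrightarrow> P z"
proof (induction n rule: int_induct[where k = 0])
  case (step1 i)
  then show ?case using assms[of "z + of_int i * \<omega>"] by (simp add: algebra_simps)
next
  case (step2 i)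
  then show ?case using assms[of "z + of_int (i - 1) * \<omega>"] by (simp add: algebra_simps)
qed simp

lemma lattice_invariant:
  fixes z \<tau> :: complex
  assumes "\<And>z. P (z + 1) \<longleftrightarrow> P z" "\<And>z. P (z + \<tau>) \<longleftrightarrow> P z"
  shows "P (z + of_int m + of_int n * \<tau>) \<longleftrightarrow> P z"
  using int_translate_invariant[of P \<tau>, OF assms(2)] int_translate_invariant[of P 1, OF assms(1)] by simp

lemma deriv_at_translated_zero:
  assumes F: "F holomorphic_on UNIV" and u: "u holomorphic_on UNIV"
    and eq: "\<And>z. F (z + \<omega>) = u z * F z" and z: "F z = 0"
  shows "deriv F (z + \<omega>) = u z * deriv F z"
proof -
  have DF: "(F has_field_derivative deriv F x) (at x)" and Du: "(u has_field_derivative deriv u x) (at x)" for x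
    using F u by (auto intro: holomorphic_derivI)
  have "((\<lambda>z. F (z + \<omega>)) has_field_derivative deriv F (z + \<omega>)) (at z)"
    using DF[of "z + \<omega>"] by (simp add: DERIV_shift)
  moreover have "((\<lambda>z. F (z + \<omega>)) has_field_derivative deriv u z * F z + deriv F z * u z) (at z)"
    unfolding eq by (rule DERIV_mult[OF Du DF])
  ultimately show ?thesis using z DERIV_unique by fastforce
qed

lemma quotient_of_entire_with_simple_zeros:
  assumes J: "J holomorphic_on UNIV" and K: "K holomorphic_on UNIV"
    and simple: "\<And>z. J z = 0 \<Longrightarrow> deriv J z \<noteq> 0" and zeros: "\<And>z. J z = 0 \<Longrightarrow> K z = 0"
  shows "(\<lambda>z. if J z = 0 then deriv K z / deriv J z else K z / J z) holomorphic_on UNIV"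
    (is "?g holomorphic_on UNIV")
proof -
  have "?g field_differentiable (at a)" for a
  proof -
    define Q where "Q F z = (if z = a then deriv F a else (F z - F a) / (z - a))" for F :: "complex \<Rightarrow> complex" and z
    have Q: "Q J holomorphic_on UNIV" "Q K holomorphic_on UNIV"
      unfolding Q_def using J K by (auto intro!: pole_lemma_open[of _ UNIV])
    show ?thesis
    proof (cases "J a = 0")
      case True
      then have Ka: "K a = 0" by (rule zeros)
      have cont: "isCont (Q J) a"
        using Q(1) by (metis continuous_on_eq_continuous_at holomorphic_on_imp_continuous_on open_UNIV UNIV_I)
      moreover have "Q J a \<noteq> 0" using simple[OF True] by (simp add: Q_def)
      ultimately obtain e where e: "e > 0" "\<And>z. dist a z < e \<Longrightarrow> Q J z \<noteq> 0"
        using continuous_at_avoid by blast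
      have "(\<lambda>z. Q K z / Q J z) holomorphic_on ball a e"
        using e Q by (intro holomorphic_intros) (auto intro: holomorphic_on_subset)
      then have "(\<lambda>z. Q K z / Q J z) field_differentiable (at a)"
        using e by (intro holomorphic_on_imp_differentiable_at[of _ "ball a e"]) auto
      moreover have "Q K z / Q J z = ?g z" if "z \<in> ball a e" for z
      proof (cases "z = a")
        case False
        then have "J z \<noteq> 0" using e(2)[of z] that True by (auto simp: Q_def)
        then show ?thesis using False True Ka by (simp add: Q_def)
      qed (use True in \<open>simp add: Q_def\<close>)
      ultimately show ?thesis
        by (intro field_differentiable_transform_within[OF e(1) UNIV_I, of _ _ ?g]) (auto simp: dist_commute)
    next
      case False
      have "isCont J a"
        using J by (metis continuous_on_eq_continuous_at holomorphic_on_imp_continuous_on open_UNIV UNIV_I)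
      then obtain e where e: "e > 0" "\<And>z. dist a z < e \<Longrightarrow> J z \<noteq> 0"
        using continuous_at_avoid[of a J 0] False by blast
      have "(\<lambda>z. K z / J z) holomorphic_on ball a e"
        using e J K by (intro holomorphic_intros) (auto intro: holomorphic_on_subset)
      then have "(\<lambda>z. K z / J z) field_differentiable (at a)"
        using e by (intro holomorphic_on_imp_differentiable_at[of _ "ball a e"]) auto
      then show ?thesis
        by (rule field_differentiable_transform_within[OF e(1), rotated 2]) (use e in \<open>auto simp: dist_commute\<close>)
    qed
  qed
  then show ?thesis by (auto simp: holomorphic_on_def field_differentiable_at_within)
qed

lemma doubly_periodic_entire_constant:
  assumes g: "g holomorphic_on UNIV" and \<tau>: "Im \<tau> > 0"
    and per: "\<And>z. g (z + 1) = g z" "\<And>z. g (z + \<tau>) = g z"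
  obtains c where "\<And>z. g z = c"
proof -
  define f where "f = (\<lambda>(a, b). g (of_real a + of_real b * \<tau>))"
  define box where "box = {0..1::real} \<times> {0..1::real}"
  have "continuous_on box f"
    unfolding f_def case_prod_beta
    by (intro continuous_on_compose2[OF holomorphic_on_imp_continuous_on[OF g]] continuous_intros) auto
  moreover have "compact box" by (simp add: box_def compact_Times)
  ultimately have "bounded (f ` box)" by (intro compact_imp_bounded compact_continuous_image)
  moreover have "range g \<subseteq> f ` box"
  proof
    fix y assume "y \<in> range g"
    then obtain z where z: "y = g z" by blast
    define b where "b = Im z / Im \<tau>"
    define a where "a = Re z - b * Re \<tau>"
    have zz: "z = of_real a + of_real b * \<tau>" using \<tau> by (simp add: complex_eq_iff a_def b_def)
    have "z = of_real (frac a) + of_real (frac b) * \<tau> + of_int \<lfloor>a\<rfloor> + of_int \<lfloor>b\<rfloor> * \<tau>"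
      unfolding zz frac_def by (simp add: algebra_simps)
    then have "g z = f (frac a, frac b)"
      using lattice_invariant[where P = "\<lambda>x. g x = f (frac a, frac b)" and \<tau> = \<tau> and z = "of_real (frac a) + of_real (frac b) * \<tau>" and m = "\<lfloor>a\<rfloor>" and n = "\<lfloor>b\<rfloor>"] per
      by (simp add: f_def)
    moreover have "(frac a, frac b) \<in> box" by (simp add: box_def frac_lt_1 less_imp_le)
    ultimately show "y \<in> f ` box" using z by blast
  qed
  ultimately have "bounded (range g)" by (rule bounded_subset)
  from Liouville_theorem[OF g this] show ?thesis
    using that unfolding constant_on_def by auto
qed

lemma theta_functions_proportional:
  assumes J: "J holomorphic_on UNIV" and K: "K holomorphic_on UNIV" and u: "u holomorphic_on UNIV"
    and \<tau>: "Im \<tau> > 0" and unz: "\<And>z. u z \<noteq> 0"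
    and J1: "\<And>z. J (z + 1) = J z" and K1: "\<And>z. K (z + 1) = K z"
    and Jt: "\<And>z. J (z + \<tau>) = u z * J z" and Kt: "\<And>z. K (z + \<tau>) = u z * K z"
    and zeros: "\<And>z. J z = 0 \<Longrightarrow> \<exists>m n. z = of_int m + of_int n * \<tau>"
    and J0: "J 0 = 0" "deriv J 0 \<noteq> 0" and K0: "K 0 = 0"
  obtains c where "\<And>z. K z = c * J z"
proof -
  have one: "(\<lambda>_. 1 :: complex) holomorphic_on UNIV" by simp
  have K_zero: "K z = 0" if "J z = 0" for z
    using zeros[OF that] lattice_invariant[where P = "\<lambda>z. K z = 0" and \<tau> = \<tau> and z = 0] K0 K1 Kt unz by auto
  have dJ1: "deriv J (z + 1) = deriv J z" if "J z = 0" for z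
    using deriv_at_translated_zero[OF J one _ that, of 1] J1 by simp
  have dJt: "deriv J (z + \<tau>) = u z * deriv J z" if "J z = 0" for z
    using deriv_at_translated_zero[OF J u _ that, of \<tau>] Jt by simp
  have dK1: "deriv K (z + 1) = deriv K z" if "K z = 0" for z
    using deriv_at_translated_zero[OF K one _ that, of 1] K1 by simp
  have dKt: "deriv K (z + \<tau>) = u z * deriv K z" if "K z = 0" for z
    using deriv_at_translated_zero[OF K u _ that, of \<tau>] Kt by simp
  have simple: "deriv J z \<noteq> 0" if Jz: "J z = 0" for z
  proof -
    obtain m n where z: "z = of_int m + of_int n * \<tau>" using zeros[OF Jz] by blast
    have "J (x + 1) = 0 \<and> deriv J (x + 1) \<noteq> 0 \<longleftrightarrow> J x = 0 \<and> deriv J x \<noteq> 0" for x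
      using J1[of x] dJ1[of x] by auto
    moreover have "J (x + \<tau>) = 0 \<and> deriv J (x + \<tau>) \<noteq> 0 \<longleftrightarrow> J x = 0 \<and> deriv J x \<noteq> 0" for x
      using Jt[of x] dJt[of x] unz[of x] by auto
    ultimately show ?thesis
      using lattice_invariant[where P = "\<lambda>x. J x = 0 \<and> deriv J x \<noteq> 0" and \<tau> = \<tau> and z = 0] J0 z by auto
  qed
  define g where "g z = (if J z = 0 then deriv K z / deriv J z else K z / J z)" for z
  have "g holomorphic_on UNIV"
    unfolding g_def by (rule quotient_of_entire_with_simple_zeros[OF J K simple K_zero])
  moreover have "g (z + 1) = g z" for z
    unfolding g_def using J1[of z] K1[of z] dJ1[of z] dK1[of z] K_zero[of z] by auto
  moreover have "g (z + \<tau>) = g z" for z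
    unfolding g_def using Jt[of z] Kt[of z] dJt[of z] dKt[of z] K_zero[of z] unz[of z] by auto
  ultimately obtain c where c: "\<And>z. g z = c"
    using doubly_periodic_entire_constant[OF _ \<tau>] by blast
  have "K z = c * J z" for z
    using c[of z] K_zero[of z] by (auto simp: g_def split: if_splits)
  then show ?thesis using that by blast
qed

definition theta :: "complex \<Rightarrow> complex \<Rightarrow> complex" where
  "theta \<tau> z = qpoch_inf (qexp z) (qexp \<tau>) * qpoch_inf (qexp (\<tau> - z)) (qexp \<tau>)"

lemma holomorphic_theta:
  assumes "Im \<tau> > 0"
  shows "theta \<tau> holomorphic_on UNIV"
  unfolding theta_def using norm_qexp_lt_1[OF assms]
  by (intro holomorphic_intros holomorphic_on_qpoch_inf) auto

lemma theta_add_1: "theta \<tau> (z + 1) = theta \<tau> z"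
  by (simp add: theta_def qexp_add qexp_diff)

lemma theta_factor:
  assumes "Im \<tau> > 0"
  shows "theta \<tau> z = (1 - qexp z) * (qpoch_inf (qexp (z + \<tau>)) (qexp \<tau>) * qpoch_inf (qexp (\<tau> - z)) (qexp \<tau>))"
  unfolding theta_def using qpoch_inf_step[OF norm_qexp_lt_1[OF assms], of "qexp z"]
  by (simp add: qexp_add)

lemma theta_add_period:
  assumes "Im \<tau> > 0"
  shows "theta \<tau> (z + \<tau>) = - qexp (- z) * theta \<tau> z"
proof -
  have "theta \<tau> (z + \<tau>) = qpoch_inf (qexp (z + \<tau>)) (qexp \<tau>) * qpoch_inf (qexp (- z)) (qexp \<tau>)"
    by (simp add: theta_def)
  also have "qpoch_inf (qexp (- z)) (qexp \<tau>) = (1 - qexp (- z)) * qpoch_inf (qexp (\<tau> - z)) (qexp \<tau>)"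
    using qpoch_inf_step[OF norm_qexp_lt_1[OF assms], of "qexp (- z)"] by (simp add: qexp_add[symmetric])
  also have "1 - qexp (- z) = - qexp (- z) * (1 - qexp z)"
    by (simp add: qexp_minus field_simps)
  finally show ?thesis unfolding theta_factor[OF assms, of z] by (simp add: mult_ac)
qed

lemma theta_0 [simp]: "theta \<tau> 0 = 0" if "Im \<tau> > 0"
  using theta_factor[OF that, of 0] by simp

lemma theta_zeroD:
  assumes \<tau>: "Im \<tau> > 0" and z: "theta \<tau> z = 0"
  shows "\<exists>m n. z = of_int m + of_int n * \<tau>"
proof -
  note q = norm_qexp_lt_1[OF \<tau>]
  have "(\<exists>j. qexp (z + of_nat j * \<tau>) = 1) \<or> (\<exists>j. qexp ((\<tau> - z) + of_nat j * \<tau>) = 1)"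
    using z unfolding theta_def mult_eq_0_iff qpoch_inf_eq_0_iff[OF q] qexp_add qexp_of_nat_mult by blast
  then consider j m where "z + of_nat j * \<tau> = of_int m" | j m where "(\<tau> - z) + of_nat j * \<tau> = of_int m"
    unfolding qexp_eq_1_iff by blast
  then show ?thesis
  proof cases
    case 1
    then have "z = of_int m + of_int (- int j) * \<tau>" by (simp add: algebra_simps)
    then show ?thesis by blast
  next
    case 2
    then have "z = of_int (- m) + of_int (int j + 1) * \<tau>" by (simp add: algebra_simps)
    then show ?thesis by blast
  qed
qed

lemma deriv_theta_0:
  assumes "Im \<tau> > 0"
  shows "deriv (theta \<tau>) 0 = - 2 * of_real pi * \<i> * (qpoch_inf (qexp \<tau>) (qexp \<tau>))\<^sup>2"
proof -
  define G where "G z = qpoch_inf (qexp (z + \<tau>)) (qexp \<tau>) * qpoch_inf (qexp (\<tau> - z)) (qexp \<tau>)" for z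
  have "G holomorphic_on UNIV"
    unfolding G_def using norm_qexp_lt_1[OF assms] by (intro holomorphic_intros holomorphic_on_qpoch_inf) auto
  then have G: "(G has_field_derivative deriv G 0) (at 0)" by (intro holomorphic_derivI) auto
  have "theta \<tau> = (\<lambda>z. (1 - qexp z) * G z)"
    using theta_factor[OF assms] by (auto simp: G_def)
  moreover have "((\<lambda>z. (1 - qexp z) * G z) has_field_derivative
      - (2 * of_real pi * \<i> * qexp 0) * G 0 + deriv G 0 * (1 - qexp 0)) (at 0)"
    by (rule derivative_eq_intros has_field_derivative_qexp G refl | simp)+
  ultimately have "(theta \<tau> has_field_derivative - (2 * of_real pi * \<i>) * G 0) (at 0)" by simp
  then have "deriv (theta \<tau>) 0 = - (2 * of_real pi * \<i>) * G 0" by (rule DERIV_imp_deriv)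
  then show ?thesis by (simp add: G_def power2_eq_square)
qed

lemma theta_half_periods:
  assumes "Im \<tau> > 0"
  shows "theta \<tau> (1 / 2) * theta \<tau> (\<tau> / 2) * theta \<tau> ((1 + \<tau>) / 2) = 2"
proof -
  define q s where "q = qexp \<tau>" and "s = qexp (\<tau> / 2)"
  have q: "norm q < 1" using norm_qexp_lt_1[OF assms] by (simp add: q_def)
  then have q2: "norm (q\<^sup>2) < 1" by (simp add: norm_power power_less_one_iff)
  have s2: "s\<^sup>2 = q" unfolding q_def s_def using qexp_of_nat_mult[of 2 "\<tau> / 2"] by simp
  have t1: "theta \<tau> (1 / 2) = 2 * (qpoch_inf (- q) q)\<^sup>2"
    using qpoch_inf_step[OF q, of "- 1"]
    by (simp add: theta_def qexp_diff qexp_half power2_eq_square flip: q_def)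
  have t2: "theta \<tau> (\<tau> / 2) = (qpoch_inf s q)\<^sup>2"
    by (simp add: theta_def power2_eq_square flip: q_def s_def)
  have "qexp ((1 + \<tau>) / 2) = - s" "qexp (\<tau> - (1 + \<tau>) / 2) = - s"
  proof -
    have "(1 + \<tau>) / 2 = 1 / 2 + \<tau> / 2" "\<tau> - (1 + \<tau>) / 2 = \<tau> / 2 - 1 / 2" by (simp_all add: field_simps)
    then show "qexp ((1 + \<tau>) / 2) = - s" "qexp (\<tau> - (1 + \<tau>) / 2) = - s"
      by (simp_all only: qexp_add qexp_diff qexp_half s_def) simp_all
  qed
  then have t3: "theta \<tau> ((1 + \<tau>) / 2) = (qpoch_inf (- s) q)\<^sup>2"
    by (simp add: theta_def power2_eq_square flip: q_def)
  have "qpoch_inf s q * qpoch_inf (- s) q = qpoch_inf q (q\<^sup>2)"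
    using qpoch_inf_mult_uminus[OF q, of s] s2 by simp
  moreover have "qpoch_inf q q = qpoch_inf q (q\<^sup>2) * qpoch_inf (q\<^sup>2) (q\<^sup>2)"
    using qpoch_inf_dissect[OF q, of q] by (simp add: power2_eq_square)
  moreover have "qpoch_inf q q * qpoch_inf (- q) q = qpoch_inf (q\<^sup>2) (q\<^sup>2)"
    by (rule qpoch_inf_mult_uminus[OF q])
  moreover have "qpoch_inf (q\<^sup>2) (q\<^sup>2) \<noteq> 0"
    by (rule qpoch_inf_nonzero_of_norm[OF q2 q2])
  ultimately have "qpoch_inf (- q) q * (qpoch_inf s q * qpoch_inf (- s) q) = 1"
    by (metis mult.assoc mult.commute mult_cancel_right1)
  then have "(qpoch_inf (- q) q * (qpoch_inf s q * qpoch_inf (- s) q))\<^sup>2 = 1" by simp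
  then show ?thesis unfolding t1 t2 t3 by (simp add: power_mult_distrib mult_ac)
qed

lemma Im_minus_inverse: "Im (- 1 / \<tau>) = Im \<tau> / (norm \<tau>)\<^sup>2"
  by (simp add: Im_divide cmod_power2)

lemma theta_inversion:
  assumes \<tau>: "Im \<tau> > 0"
  obtains c where "\<And>z. exp (- of_real pi * \<i> * z\<^sup>2 / \<tau> + (of_real pi * \<i> - of_real pi * \<i> / \<tau>) * z)
      * theta (- 1 / \<tau>) (z / \<tau>) = c * theta \<tau> z"
proof -
  define \<sigma> where "\<sigma> = - 1 / \<tau>"
  have nz: "\<tau> \<noteq> 0" using \<tau> by auto
  have \<sigma>: "Im \<sigma> > 0" using \<tau> nz unfolding \<sigma>_def Im_minus_inverse by simp
  define E where "E z = - of_real pi * \<i> * z\<^sup>2 / \<tau> + (of_real pi * \<i> - of_real pi * \<i> / \<tau>) * z" for z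
  define K where "K z = exp (E z) * theta \<sigma> (z / \<tau>)" for z
  have "(\<lambda>z. theta \<sigma> (z / \<tau>)) holomorphic_on UNIV"
    using holomorphic_on_compose[of "\<lambda>z. z / \<tau>" UNIV "theta \<sigma>"]
      holomorphic_on_subset[OF holomorphic_theta[OF \<sigma>] subset_UNIV] nz
    by (simp add: o_def holomorphic_intros)
  then have Kh: "K holomorphic_on UNIV"
    unfolding K_def E_def using nz by (intro holomorphic_intros) auto
  have K1: "K (z + 1) = K z" for z
  proof -
    have "theta \<sigma> (z / \<tau>) = - qexp (- ((z + 1) / \<tau>)) * theta \<sigma> ((z + 1) / \<tau>)"
      using theta_add_period[OF \<sigma>, of "(z + 1) / \<tau>"] by (simp add: \<sigma>_def add_divide_distrib)
    then have t: "theta \<sigma> ((z + 1) / \<tau>) = - qexp ((z + 1) / \<tau>) * theta \<sigma> (z / \<tau>)"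
      by (simp add: qexp_minus)
    have "E (z + 1) + 2 * of_real pi * \<i> * ((z + 1) / \<tau>) = E z + of_real pi * \<i>"
      unfolding E_def using nz by (simp add: field_simps power2_eq_square)
    then have "exp (E (z + 1)) * qexp ((z + 1) / \<tau>) = - exp (E z)"
      unfolding qexp_def exp_add[symmetric] by (simp add: exp_add)
    then show ?thesis unfolding K_def t by (simp add: mult.assoc[symmetric])
  qed
  have Kt: "K (z + \<tau>) = - qexp (- z) * K z" for z
  proof -
    have t: "theta \<sigma> ((z + \<tau>) / \<tau>) = theta \<sigma> (z / \<tau>)"
      using theta_add_1[of \<sigma> "z / \<tau>"] nz by (simp add: add_divide_distrib)
    have "E (z + \<tau>) + of_real pi * \<i> = E z + 2 * of_real pi * \<i> * (- z)"
      unfolding E_def using nz by (simp add: field_simps power2_eq_square)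
    then have "exp (E (z + \<tau>)) * exp (of_real pi * \<i>) = exp (E z) * qexp (- z)"
      unfolding qexp_def exp_add[symmetric] by simp
    from arg_cong[OF this, of uminus] have "exp (E (z + \<tau>)) = - qexp (- z) * exp (E z)"
      by (simp add: mult.commute)
    then show ?thesis unfolding K_def t by simp
  qed
  have dnz: "deriv (theta \<tau>) 0 \<noteq> 0"
    unfolding deriv_theta_0[OF \<tau>]
    using qpoch_inf_nonzero_of_norm[OF norm_qexp_lt_1[OF \<tau>] norm_qexp_lt_1[OF \<tau>]] by simp
  have uh: "(\<lambda>z. - qexp (- z)) holomorphic_on UNIV" by (intro holomorphic_intros)
  obtain c where "\<And>z. K z = c * theta \<tau> z"
    by (rule theta_functions_proportional[OF holomorphic_theta[OF \<tau>] Kh uh \<tau> _ theta_add_1 K1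
          theta_add_period[OF \<tau>] Kt theta_zeroD[OF \<tau>] theta_0[OF \<tau>] dnz])
       (use \<sigma> in \<open>auto simp: K_def\<close>)
  then show ?thesis using that unfolding K_def E_def \<sigma>_def by blast
qed

definition eta :: "complex \<Rightarrow> complex" where
  "eta \<tau> = qexp (\<tau> / 24) * qpoch_inf (qexp \<tau>) (qexp \<tau>)"

lemma norm_eta_inversion:
  assumes \<tau>: "Im \<tau> > 0"
  shows "(norm (eta (- 1 / \<tau>)))\<^sup>2 = norm \<tau> * (norm (eta \<tau>))\<^sup>2"
proof -
  define \<sigma> where "\<sigma> = - 1 / \<tau>"
  have nz: "\<tau> \<noteq> 0" using \<tau> by auto
  have \<sigma>: "Im \<sigma> > 0" using \<tau> nz unfolding \<sigma>_def Im_minus_inverse by simp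
  define E where "E z = - of_real pi * \<i> * z\<^sup>2 / \<tau> + (of_real pi * \<i> - of_real pi * \<i> / \<tau>) * z" for z
  obtain c where c: "\<And>z. exp (E z) * theta \<sigma> (z / \<tau>) = c * theta \<tau> z"
    using theta_inversion[OF \<tau>] unfolding E_def \<sigma>_def by blast
  define e e' where "e = qpoch_inf (qexp \<tau>) (qexp \<tau>)" and "e' = qpoch_inf (qexp \<sigma>) (qexp \<sigma>)"

  have dth: "(theta \<rho> has_field_derivative deriv (theta \<rho>) x) (at x)" if "Im \<rho> > 0" for \<rho> x
    using holomorphic_theta[OF that] by (intro holomorphic_derivI) auto
  have "((\<lambda>z. theta \<sigma> (z / \<tau>)) has_field_derivative deriv (theta \<sigma>) 0 * (1 / \<tau>)) (at 0)"
    using DERIV_chain2[of "theta \<sigma>" "deriv (theta \<sigma>) 0" "\<lambda>z. z / \<tau>" 0 "1 / \<tau>" UNIV] dth[OF \<sigma>, of 0]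
      DERIV_cdivide[OF DERIV_ident, of \<tau> 0 UNIV]
    by simp
  moreover have "((\<lambda>z. exp (E z)) has_field_derivative (of_real pi * \<i> - of_real pi * \<i> / \<tau>)) (at 0)"
    unfolding E_def using nz by (auto intro!: derivative_eq_intros)
  ultimately have "((\<lambda>z. exp (E z) * theta \<sigma> (z / \<tau>)) has_field_derivative
      (of_real pi * \<i> - of_real pi * \<i> / \<tau>) * theta \<sigma> (0 / \<tau>) + deriv (theta \<sigma>) 0 * (1 / \<tau>) * exp (E 0)) (at 0)"
    by (rule DERIV_mult[rotated])
  then have "((\<lambda>z. c * theta \<tau> z) has_field_derivative deriv (theta \<sigma>) 0 / \<tau>) (at 0)"
    using \<sigma> unfolding c by (simp add: E_def)
  moreover have "((\<lambda>z. c * theta \<tau> z) has_field_derivative c * deriv (theta \<tau>) 0) (at 0)"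
    by (rule DERIV_cmult[OF dth[OF \<tau>]])
  ultimately have "deriv (theta \<sigma>) 0 / \<tau> = c * deriv (theta \<tau>) 0" by (rule DERIV_unique)
  then have "e'\<^sup>2 / \<tau> = c * e\<^sup>2"
    unfolding deriv_theta_0[OF \<tau>] deriv_theta_0[OF \<sigma>] using nz by (simp add: e_def e'_def field_simps)
  then have e': "(norm e')\<^sup>2 = norm \<tau> * norm c * (norm e)\<^sup>2"
    using nz by (simp add: field_simps flip: norm_power norm_mult)

  have per: "theta \<sigma> (x - \<sigma>) = - qexp (x - \<sigma>) * theta \<sigma> x" for x
    using theta_add_period[OF \<sigma>, of "x - \<sigma>"] by (simp add: qexp_diff field_simps)
  have z1: "(1 / 2) / \<tau> = \<sigma> / 2 - \<sigma>" and z2: "(\<tau> / 2) / \<tau> = 1 / 2"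
    and z3: "((1 + \<tau>) / 2) / \<tau> = (1 + \<sigma>) / 2 - \<sigma>"
    using nz by (simp_all add: \<sigma>_def field_simps)
  have p1: "theta \<sigma> ((1 / 2) / \<tau>) = - qexp (\<sigma> / 2 - \<sigma>) * theta \<sigma> (\<sigma> / 2)"
    unfolding z1 by (rule per)
  have p3: "theta \<sigma> (((1 + \<tau>) / 2) / \<tau>) = - qexp ((1 + \<sigma>) / 2 - \<sigma>) * theta \<sigma> ((1 + \<sigma>) / 2)"
    unfolding z3 by (rule per)
  have "c ^ 3 * (theta \<tau> (1 / 2) * theta \<tau> (\<tau> / 2) * theta \<tau> ((1 + \<tau>) / 2))
      = (exp (E (1 / 2)) * theta \<sigma> ((1 / 2) / \<tau>)) * (exp (E (\<tau> / 2)) * theta \<sigma> ((\<tau> / 2) / \<tau>))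
        * (exp (E ((1 + \<tau>) / 2)) * theta \<sigma> (((1 + \<tau>) / 2) / \<tau>))"
    unfolding c by (simp add: power3_eq_cube mult_ac)
  also have "\<dots> = exp (E (1 / 2)) * exp (E (\<tau> / 2)) * exp (E ((1 + \<tau>) / 2))
      * (qexp (\<sigma> / 2 - \<sigma>) * qexp ((1 + \<sigma>) / 2 - \<sigma>))
      * (theta \<sigma> (1 / 2) * theta \<sigma> (\<sigma> / 2) * theta \<sigma> ((1 + \<sigma>) / 2))"
    unfolding p1 p3 z2 by (simp add: mult_ac)
  finally have "c ^ 3 = exp (E (1 / 2)) * exp (E (\<tau> / 2)) * exp (E ((1 + \<tau>) / 2))
      * (qexp (\<sigma> / 2 - \<sigma>) * qexp ((1 + \<sigma>) / 2 - \<sigma>))"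
    unfolding theta_half_periods[OF \<tau>] theta_half_periods[OF \<sigma>] by simp
  also have "\<dots> = exp (E (1 / 2) + E (\<tau> / 2) + E ((1 + \<tau>) / 2)
      + 2 * of_real pi * \<i> * (\<sigma> / 2 - \<sigma> + ((1 + \<sigma>) / 2 - \<sigma>)))"
    by (simp only: qexp_def exp_add distrib_left)
  also have "E (1 / 2) + E (\<tau> / 2) + E ((1 + \<tau>) / 2) + 2 * of_real pi * \<i> * (\<sigma> / 2 - \<sigma> + ((1 + \<sigma>) / 2 - \<sigma>))
      = of_real (pi / 2) * \<i> * (\<tau> - \<sigma> + 1)"
    unfolding E_def \<sigma>_def using nz by (simp add: field_simps power2_eq_square)
  finally have "norm c ^ 3 = exp (pi / 2 * (Im \<sigma> - Im \<tau>))"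
    by (simp add: algebra_simps flip: norm_power)
  also have "\<dots> = exp (pi / 6 * (Im \<sigma> - Im \<tau>)) ^ 3"
    by (simp add: field_simps flip: exp_of_nat_mult)
  finally have nc: "norm c = exp (pi / 6 * (Im \<sigma> - Im \<tau>))"
    by (rule power_eq_imp_eq_base) auto
  have n: "(norm (qexp (z / 24)))\<^sup>2 = exp (- (pi / 6) * Im z)" for z
    unfolding norm_qexp by (simp flip: exp_of_nat_mult)
  have h: "exp (- (pi / 6) * Im \<sigma>) * norm c = exp (- (pi / 6) * Im \<tau>)"
    unfolding nc exp_add[symmetric] by (simp add: field_simps)
  show ?thesis
    unfolding \<sigma>_def[symmetric] eta_def e_def[symmetric] e'_def[symmetric] norm_mult power_mult_distrib n e'
    by (subst h[symmetric]) (simp only: mult_ac)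
qed

definition eta_invariant :: "complex \<Rightarrow> real" where
  "eta_invariant \<tau> = norm (eta \<tau>) ^ 4 * Im \<tau>"

lemma eta_invariant_inversion:
  assumes "Im \<tau> > 0"
  shows "eta_invariant (- 1 / \<tau>) = eta_invariant \<tau>"
proof -
  have "norm (eta (- 1 / \<tau>)) ^ 4 = ((norm (eta (- 1 / \<tau>)))\<^sup>2)\<^sup>2" by (simp flip: power_mult)
  also have "\<dots> = (norm \<tau>)\<^sup>2 * norm (eta \<tau>) ^ 4"
    unfolding norm_eta_inversion[OF assms] by (simp add: power_mult_distrib flip: power_mult)
  finally show ?thesis
    using assms unfolding eta_invariant_def Im_minus_inverse by auto
qed

lemma eta_add_1: "eta (\<tau> + 1) = qexp (1 / 24) * eta \<tau>"
  by (simp add: eta_def add_divide_distrib qexp_add)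

lemma eta_invariant_add_int: "eta_invariant (\<tau> + of_int n) = eta_invariant \<tau>"
proof -
  have "eta_invariant (z + 1) = eta_invariant z" for z
    by (simp add: eta_invariant_def eta_add_1 norm_mult norm_qexp)
  then show ?thesis
    using int_translate_invariant[of "\<lambda>z. eta_invariant z = eta_invariant \<tau>" 1 \<tau> n] by simp
qed

lemma moebius_denominator_nz:
  fixes c d :: int
  assumes "Im \<tau> > 0" "c \<noteq> 0 \<or> d \<noteq> 0"
  shows "of_int c * \<tau> + of_int d \<noteq> (0::complex)"
proof
  assume eq: "of_int c * \<tau> + of_int d = 0"
  then have "Im (of_int c * \<tau> + of_int d) = 0" by simp
  then have "c = 0" using assms by simp
  with eq assms show False by simp
qed

lemma Im_moebius:
  fixes a b c d :: int
  assumes "a * d - b * c = n"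
  shows "Im ((of_int a * \<tau> + of_int b) / (of_int c * \<tau> + of_int d))
    = of_int n * Im \<tau> / (norm (of_int c * \<tau> + of_int d))\<^sup>2"
proof -
  have n: "of_int n = (of_int a * of_int d - of_int b * of_int c :: real)"
    unfolding assms[symmetric] by simp
  show ?thesis unfolding n by (simp add: Im_divide cmod_power2 algebra_simps)
qed

theorem eta_invariant_SL2:
  fixes a b c d :: int
  assumes "a * d - b * c = 1" "Im \<tau> > 0"
  shows "eta_invariant ((of_int a * \<tau> + of_int b) / (of_int c * \<tau> + of_int d)) = eta_invariant \<tau>"
  using assms(1)
proof (induction "nat \<bar>c\<bar>" arbitrary: a b c d rule: less_induct)
  case less
  show ?case
  proof (cases "c = 0")
    case True
    with less.prems have "a * d = 1" by simp
    then consider "a = 1" "d = 1" | "a = - 1" "d = - 1" by (auto simp: zmult_eq_1_iff)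
    then show ?thesis
    proof cases
      case 1
      then show ?thesis using True eta_invariant_add_int[of \<tau> b] by simp
    next
      case 2
      have "(- \<tau> + of_int b) / (- 1) = \<tau> + of_int (- b)" by simp
      then show ?thesis using 2 True eta_invariant_add_int[of \<tau> "- b"] by simp
    qed
  next
    case False
    define k where "k = a div c"
    define a' b' where "a' = a - k * c" and "b' = b - k * d"
    have a': "a' = a mod c" by (simp add: a'_def k_def minus_div_mult_eq_mod)
    have det: "(- c) * b' - (- d) * a' = 1" using less.prems by (simp add: a'_def b'_def algebra_simps)
    have det': "a' * d - b' * c = 1" using less.prems by (simp add: a'_def b'_def algebra_simps)
    have nz: "of_int c * \<tau> + of_int d \<noteq> 0" using False assms(2) by (intro moebius_denominator_nz) auto
    define \<sigma> where "\<sigma> = (of_int a' * \<tau> + of_int b') / (of_int c * \<tau> + of_int d)"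
    have "(of_int a * \<tau> + of_int b) / (of_int c * \<tau> + of_int d) = \<sigma> + of_int k"
      unfolding \<sigma>_def a'_def b'_def using nz by (simp add: field_simps)
    then have "eta_invariant ((of_int a * \<tau> + of_int b) / (of_int c * \<tau> + of_int d)) = eta_invariant \<sigma>"
      by (simp add: eta_invariant_add_int)
    also have "\<dots> = eta_invariant (- 1 / \<sigma>)"
    proof -
      have "Im \<sigma> > 0" unfolding \<sigma>_def Im_moebius[OF det'] using assms(2) nz by simp
      then show ?thesis by (rule eta_invariant_inversion[symmetric])
    qed
    also have "- 1 / \<sigma> = (of_int (- c) * \<tau> + of_int (- d)) / (of_int a' * \<tau> + of_int b')"
      by (simp add: \<sigma>_def minus_divide_left)
    also have "eta_invariant \<dots> = eta_invariant \<tau>"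
    proof (rule less.hyps[OF _ det])
      show "nat \<bar>a'\<bar> < nat \<bar>c\<bar>" unfolding a' using False abs_mod_less[of c a] by simp
    qed
    finally show ?thesis .
  qed
qed

section \<open>Eta quotients as modular forms\<close>

no_notation fps_nth (infixl "$" 75)

lemma eta_nz: "Im \<tau> > 0 \<Longrightarrow> eta \<tau> \<noteq> 0"
  unfolding eta_def using qpoch_inf_nonzero_of_norm[OF norm_qexp_lt_1 norm_qexp_lt_1] by simp

lemma holomorphic_on_eta [holomorphic_intros]:
  assumes f: "f holomorphic_on S" and S: "open S" "\<And>z. z \<in> S \<Longrightarrow> Im (f z) > 0"
  shows "(\<lambda>z. eta (f z)) holomorphic_on S"
  unfolding eta_def using S by (intro holomorphic_intros holomorphic_on_qpoch_inf f norm_qexp_lt_1) auto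

lemma open_upper_half_plane: "open upper_half_plane"
  unfolding upper_half_plane_def by (rule open_halfspace_Im_gt)

lemma unimodular_holomorphic_constant:
  assumes h: "h holomorphic_on upper_half_plane" and n: "\<And>\<tau>. \<tau> \<in> upper_half_plane \<Longrightarrow> norm (h \<tau>) = 1"
  obtains c where "norm c = 1" "\<And>\<tau>. \<tau> \<in> upper_half_plane \<Longrightarrow> h \<tau> = c"
proof -
  have i: "\<i> \<in> upper_half_plane" by (simp add: upper_half_plane_def)
  have "connected upper_half_plane"
    unfolding upper_half_plane_def by (intro convex_connected convex_halfspace_Im_gt)
  then have "h constant_on upper_half_plane"
    using maximum_modulus_principle[OF h open_upper_half_plane _ open_upper_half_plane order_refl i] n i by simp
  then obtain c where c: "\<And>\<tau>. \<tau> \<in> upper_half_plane \<Longrightarrow> h \<tau> = c" unfolding constant_on_def by blast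
  show ?thesis using that[of c] c n[OF i] i by simp
qed

lemma SL2Z_det: "A \<in> SL2Z \<longleftrightarrow> A $ 1 $ 1 * A $ 2 $ 2 - A $ 1 $ 2 * A $ 2 $ 1 = 1"
  by (simp add: SL2Z_def det_2)

lemma denominator_nz:
  assumes "A \<in> SL2Z" "\<tau> \<in> upper_half_plane"
  shows "of_int (A $ 2 $ 1) * \<tau> + of_int (A $ 2 $ 2) \<noteq> 0"
proof -
  have "A $ 2 $ 1 \<noteq> 0 \<or> A $ 2 $ 2 \<noteq> 0" using assms(1) by (auto simp: SL2Z_det)
  then show ?thesis
    using assms(2) moebius_denominator_nz[of \<tau> "A $ 2 $ 1" "A $ 2 $ 2"] by (simp add: upper_half_plane_def)
qed

lemma Im_moebius_act:
  assumes "A \<in> SL2Z"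
  shows "Im (moebius_act A \<tau>) = Im \<tau> / (norm (of_int (A $ 2 $ 1) * \<tau> + of_int (A $ 2 $ 2)))\<^sup>2"
  using Im_moebius[of "A $ 1 $ 1" "A $ 2 $ 2" "A $ 1 $ 2" "A $ 2 $ 1" 1 \<tau>] assms
  by (simp add: SL2Z_det moebius_act_def)

lemma moebius_act_in_upper_half_plane:
  assumes "A \<in> SL2Z" "\<tau> \<in> upper_half_plane"
  shows "moebius_act A \<tau> \<in> upper_half_plane"
  using denominator_nz[OF assms] assms by (simp add: upper_half_plane_def Im_moebius_act)

lemma moebius_act_mult:
  assumes "A \<in> SL2Z" "B \<in> SL2Z" "\<tau> \<in> upper_half_plane"
  shows "moebius_act (A ** B) \<tau> = moebius_act A (moebius_act B \<tau>)"
proof -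
  define y where "y = of_int (B $ 2 $ 1) * \<tau> + (of_int (B $ 2 $ 2) :: complex)"
  define x where "x = of_int (B $ 1 $ 1) * \<tau> + (of_int (B $ 1 $ 2) :: complex)"
  have y: "y \<noteq> 0" unfolding y_def by (rule denominator_nz[OF assms(2,3)])
  have "moebius_act (A ** B) \<tau> = (of_int (A $ 1 $ 1) * x + of_int (A $ 1 $ 2) * y) / (of_int (A $ 2 $ 1) * x + of_int (A $ 2 $ 2) * y)"
    by (simp add: moebius_act_def matrix_matrix_mult_def sum_2 x_def y_def algebra_simps)
  also have "\<dots> = (of_int (A $ 1 $ 1) * (x / y) + of_int (A $ 1 $ 2)) / (of_int (A $ 2 $ 1) * (x / y) + of_int (A $ 2 $ 2))"
  proof -
    have "of_int u * x + of_int v * y = y * (of_int u * (x / y) + (of_int v :: complex))" for u v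
      using y by (simp add: field_simps)
    then show ?thesis using y by simp
  qed
  finally show ?thesis by (simp add: moebius_act_def x_def y_def)
qed

lemma norm_automorphy:
  "norm (automorphy k A \<tau>) = norm (of_int (A $ 2 $ 1) * \<tau> + of_int (A $ 2 $ 2) :: complex) powr k"
  by (simp add: automorphy_def norm_powr_real_powr')

lemma automorphy_nz:
  assumes "A \<in> SL2Z" "\<tau> \<in> upper_half_plane"
  shows "automorphy k A \<tau> \<noteq> 0"
  using denominator_nz[OF assms] by (simp add: automorphy_def)

lemma holomorphic_on_automorphy:
  assumes "A \<in> SL2Z"
  shows "automorphy k A holomorphic_on upper_half_plane"
proof (cases "A $ 2 $ 1 = 0")
  case False
  show ?thesis
    unfolding automorphy_def
  proof (intro holomorphic_intros)
    fix \<tau> assume "\<tau> \<in> upper_half_plane"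
    then have "Im (of_int (A $ 2 $ 1) * \<tau> + of_int (A $ 2 $ 2)) \<noteq> 0"
      using False by (simp add: upper_half_plane_def)
    then show "of_int (A $ 2 $ 1) * \<tau> + of_int (A $ 2 $ 2) \<notin> \<real>\<^sub>\<le>\<^sub>0"
      by (auto simp: complex_nonpos_Reals_iff)
  qed
next
  case True
  then show ?thesis by (simp add: automorphy_def[abs_def])
qed

lemma holomorphic_on_moebius_act:
  assumes "A \<in> SL2Z"
  shows "moebius_act A holomorphic_on upper_half_plane"
  unfolding moebius_act_def using denominator_nz[OF assms] by (intro holomorphic_intros) auto

lemma holomorphic_on_compose_moebius_act:
  assumes "f holomorphic_on upper_half_plane" "A \<in> SL2Z"
  shows "(\<lambda>\<tau>. f (moebius_act A \<tau>)) holomorphic_on upper_half_plane"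
proof -
  have "f holomorphic_on moebius_act A ` upper_half_plane"
    using assms moebius_act_in_upper_half_plane by (auto intro: holomorphic_on_subset)
  then show ?thesis
    using holomorphic_on_compose[OF holomorphic_on_moebius_act[OF assms(2)]] by (simp add: o_def)
qed

text \<open>A holomorphic function of modulus \<open>1\<close> on the half-plane is constant, so a nowhere vanishing
  function is modular with some multiplier system as soon as its modulus transforms correctly.\<close>

lemma modular_form_of_norm:
  assumes G: "G \<subseteq> SL2Z" "\<And>A B. A \<in> G \<Longrightarrow> B \<in> G \<Longrightarrow> A ** B \<in> G"
    and f: "f holomorphic_on upper_half_plane" and nz: "\<And>\<tau>. \<tau> \<in> upper_half_plane \<Longrightarrow> f \<tau> \<noteq> 0"
    and nf: "\<And>A \<tau>. A \<in> G \<Longrightarrow> \<tau> \<in> upper_half_plane \<Longrightarrow>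
        norm (f (moebius_act A \<tau>)) = norm (automorphy k A \<tau>) * norm (f \<tau>)"
    and cusps: "meromorphic_at_cusps k f"
  obtains v where "modular_form k G v f"
proof -
  have "\<exists>c. norm c = 1 \<and> (\<forall>\<tau>\<in>upper_half_plane. f (moebius_act A \<tau>) = c * automorphy k A \<tau> * f \<tau>)" if A: "A \<in> G" for A
  proof -
    have SA: "A \<in> SL2Z" using A G by blast
    define h where "h \<tau> = f (moebius_act A \<tau>) / (automorphy k A \<tau> * f \<tau>)" for \<tau>
    have "h holomorphic_on upper_half_plane"
      unfolding h_def using automorphy_nz[OF SA] nz
      by (intro holomorphic_intros holomorphic_on_compose_moebius_act holomorphic_on_automorphy f SA) auto
    moreover have "norm (h \<tau>) = 1" if "\<tau> \<in> upper_half_plane" for \<tau>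
      unfolding h_def norm_divide norm_mult nf[OF A that] using nz[OF that] automorphy_nz[OF SA that] by simp
    ultimately obtain c where c: "norm c = 1" "\<And>\<tau>. \<tau> \<in> upper_half_plane \<Longrightarrow> h \<tau> = c"
      using unimodular_holomorphic_constant by blast
    have "f (moebius_act A \<tau>) = c * automorphy k A \<tau> * f \<tau>" if "\<tau> \<in> upper_half_plane" for \<tau>
      using c(2)[OF that] nz[OF that] automorphy_nz[OF SA that] by (simp add: h_def field_simps)
    with c show ?thesis by blast
  qed
  then obtain v where v: "\<And>A. A \<in> G \<Longrightarrow> norm (v A) = 1"
    "\<And>A \<tau>. A \<in> G \<Longrightarrow> \<tau> \<in> upper_half_plane \<Longrightarrow> f (moebius_act A \<tau>) = v A * automorphy k A \<tau> * f \<tau>"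
    by metis
  have "v (A ** B) * automorphy k (A ** B) \<tau> = v A * v B * automorphy k A (moebius_act B \<tau>) * automorphy k B \<tau>"
    if AB: "A \<in> G" "B \<in> G" and \<tau>: "\<tau> \<in> upper_half_plane" for A B \<tau>
  proof -
    have SL: "A \<in> SL2Z" "B \<in> SL2Z" using AB G by auto
    have "v (A ** B) * automorphy k (A ** B) \<tau> * f \<tau> = f (moebius_act A (moebius_act B \<tau>))"
      using v(2)[OF G(2)[OF AB] \<tau>] moebius_act_mult[OF SL \<tau>] by simp
    also have "\<dots> = v A * v B * automorphy k A (moebius_act B \<tau>) * automorphy k B \<tau> * f \<tau>"
      using v(2)[OF AB(1) moebius_act_in_upper_half_plane[OF SL(2) \<tau>]] v(2)[OF AB(2) \<tau>] by simp
    finally show ?thesis using nz[OF \<tau>] by simp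
  qed
  then have "modular_form k G v f"
    unfolding modular_form_def multiplier_system_def using v f cusps by blast
  then show ?thesis by (rule that)
qed

lemma Gamma0_mult_closed:
  assumes "A \<in> Gamma0 N" "B \<in> Gamma0 N"
  shows "A ** B \<in> Gamma0 N"
proof -
  have "det (A ** B) = 1" using assms by (simp add: Gamma0_def SL2Z_def det_mul)
  moreover have "int N dvd (A ** B) $ 2 $ 1"
    using assms by (simp add: Gamma0_def matrix_matrix_mult_def sum_2)
  ultimately show ?thesis by (simp add: Gamma0_def SL2Z_def)
qed

definition eta_quotient :: "nat set \<Rightarrow> (nat \<Rightarrow> int) \<Rightarrow> complex \<Rightarrow> complex" where
  "eta_quotient D r \<tau> = (\<Prod>d\<in>D. eta (of_nat d * \<tau>) powi r d)"

lemma prod_norm_eta_powi: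
  fixes w :: "nat \<Rightarrow> complex" and m :: "nat \<Rightarrow> real"
  assumes "finite D" "y > 0" and w: "\<And>d. d \<in> D \<Longrightarrow> m d > 0 \<and> Im (w d) = m d * y"
  shows "norm (\<Prod>d\<in>D. eta (w d) powi r d) ^ 4 * y powi (\<Sum>d\<in>D. r d)
    = (\<Prod>d\<in>D. (eta_invariant (w d) / m d) powi r d)"
  using assms(1) w
proof (induction D rule: finite_induct)
  case (insert d D)
  have m: "m d > 0" "Im (w d) = m d * y" using insert.prems by auto
  have "eta_invariant (w d) / m d = norm (eta (w d)) ^ 4 * y"
    using m by (simp add: eta_invariant_def)
  then have "(eta_invariant (w d) / m d) powi r d = norm (eta (w d) powi r d) ^ 4 * y powi r d"
    using power_int_mult[of "norm (eta (w d))" 4 "r d"] power_int_mult[of "norm (eta (w d))" "r d" 4]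
    by (simp add: power_int_mult_distrib norm_power_int mult.commute)
  then show ?case
    using insert assms(2) by (simp add: norm_mult power_mult_distrib power_int_add mult_ac)
qed simp

locale eta_quotient_level =
  fixes N :: nat and D :: "nat set" and r :: "nat \<Rightarrow> int"
  assumes N: "N > 0" and D: "\<And>d. d \<in> D \<Longrightarrow> d dvd N"
begin

lemma finite_D: "finite D"
  by (rule finite_subset[OF _ finite_divisors_nat[OF N]]) (use D in auto)

lemma D_pos: "d \<in> D \<Longrightarrow> d > 0"
  using D N by (auto intro: dvd_pos_nat)

definition weight :: real where
  "weight = of_int (\<Sum>d\<in>D. r d) / 2"

lemma eta_quotient_nz: "\<tau> \<in> upper_half_plane \<Longrightarrow> eta_quotient D r \<tau> \<noteq> 0"
  unfolding eta_quotient_def upper_half_plane_def using finite_D D_pos by (auto simp: eta_nz power_int_eq_0_iff)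

lemma holomorphic_eta_quotient: "eta_quotient D r holomorphic_on upper_half_plane"
proof -
  have "(\<lambda>\<tau>. eta (of_nat d * \<tau>) powi r d) holomorphic_on upper_half_plane" if "d \<in> D" for d
    using D_pos[OF that] open_upper_half_plane
    by (intro holomorphic_intros disjI2 ballI eta_nz) (auto simp: upper_half_plane_def)
  then show ?thesis unfolding eta_quotient_def by (intro holomorphic_on_prod)
qed

lemma norm_eta_quotient:
  assumes "\<tau> \<in> upper_half_plane"
  shows "norm (eta_quotient D r \<tau>) ^ 4 * Im \<tau> powi (\<Sum>d\<in>D. r d)
    = (\<Prod>d\<in>D. (eta_invariant (of_nat d * \<tau>) / real d) powi r d)"
  unfolding eta_quotient_def using assms D_pos
  by (intro prod_norm_eta_powi finite_D) (auto simp: upper_half_plane_def)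

lemma Im_moebius_powi:
  assumes A: "A \<in> SL2Z" and \<tau>: "\<tau> \<in> upper_half_plane"
  shows "Im (moebius_act A \<tau>) powi (\<Sum>d\<in>D. r d) * norm (automorphy weight A \<tau>) ^ 4
    = Im \<tau> powi (\<Sum>d\<in>D. r d)"
proof -
  define y where "y = norm (of_int (A $ 2 $ 1) * \<tau> + of_int (A $ 2 $ 2) :: complex)"
  have y: "y > 0" using denominator_nz[OF A \<tau>] by (simp add: y_def)
  have "norm (automorphy weight A \<tau>) ^ 4 = y powr (of_int (2 * (\<Sum>d\<in>D. r d)))"
    unfolding norm_automorphy y_def[symmetric] using y by (simp add: powr_power weight_def mult.commute)
  also have "\<dots> = (y\<^sup>2) powi (\<Sum>d\<in>D. r d)"
  proof -
    have "y powr (of_int (2 * (\<Sum>d\<in>D. r d))) = y powi (2 * (\<Sum>d\<in>D. r d))"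
      using y by (intro powr_real_of_int') auto
    then show ?thesis by (simp only: power_int_mult power_int_numeral)
  qed
  finally show ?thesis
    unfolding Im_moebius_act[OF A] y_def[symmetric] using y by (simp add: power_int_divide_distrib)
qed

lemma norm_eta_quotient_Gamma0:
  assumes A: "A \<in> Gamma0 N" and \<tau>: "\<tau> \<in> upper_half_plane"
  shows "norm (eta_quotient D r (moebius_act A \<tau>)) = norm (automorphy weight A \<tau>) * norm (eta_quotient D r \<tau>)"
proof -
  have SA: "A \<in> SL2Z" using A by (simp add: Gamma0_def)
  let ?A\<tau> = "moebius_act A \<tau>" and ?s = "\<Sum>d\<in>D. r d"
  note A\<tau> = moebius_act_in_upper_half_plane[OF SA \<tau>]
  have inv: "eta_invariant (of_nat d * ?A\<tau>) = eta_invariant (of_nat d * \<tau>)" if d: "d \<in> D" for d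
  proof -
    have "int d dvd A $ 2 $ 1"
      using A D[OF d] by (auto simp: Gamma0_def intro: dvd_trans[of _ "int N"])
    then obtain c where c: "A $ 2 $ 1 = int d * c" by blast
    have det: "A $ 1 $ 1 * A $ 2 $ 2 - (int d * A $ 1 $ 2) * c = 1"
      using SA c by (simp add: SL2Z_det mult_ac)
    have "of_nat d * ?A\<tau> = (of_int (A $ 1 $ 1) * (of_nat d * \<tau>) + of_int (int d * A $ 1 $ 2)) / (of_int c * (of_nat d * \<tau>) + of_int (A $ 2 $ 2))"
      by (simp add: moebius_act_def c algebra_simps)
    with eta_invariant_SL2[OF det, of "of_nat d * \<tau>"] show ?thesis
      using D_pos[OF d] \<tau> by (simp add: upper_half_plane_def)
  qed
  have "norm (eta_quotient D r ?A\<tau>) ^ 4 * Im ?A\<tau> powi ?s = norm (eta_quotient D r \<tau>) ^ 4 * Im \<tau> powi ?s"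
    unfolding norm_eta_quotient[OF A\<tau>] norm_eta_quotient[OF \<tau>] by (intro prod.cong) (simp_all add: inv)
  also have "\<dots> = (norm (automorphy weight A \<tau>) * norm (eta_quotient D r \<tau>)) ^ 4 * Im ?A\<tau> powi ?s"
    unfolding Im_moebius_powi[OF SA \<tau>, symmetric] by (simp add: power_mult_distrib mult_ac)
  finally have "norm (eta_quotient D r ?A\<tau>) ^ 4 = (norm (automorphy weight A \<tau>) * norm (eta_quotient D r \<tau>)) ^ 4"
    using A\<tau> by (simp add: upper_half_plane_def)
  then show ?thesis by (rule power_eq_imp_eq_base) auto
qed

end

lemma eta_invariant_scaled_moebius:
  assumes A: "A \<in> SL2Z" and d: "d > 0"
  obtains \<alpha> \<delta> :: nat and \<beta> :: int where "\<alpha> * \<delta> = d"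
    "\<And>\<tau>. \<tau> \<in> upper_half_plane \<Longrightarrow>
      eta_invariant (of_nat d * moebius_act A \<tau>) = eta_invariant ((of_nat \<alpha> * \<tau> + of_int \<beta>) / of_nat \<delta>)"
proof -
  define a b c e where "a = A $ 1 $ 1" and "b = A $ 1 $ 2" and "c = A $ 2 $ 1" and "e = A $ 2 $ 2"
  have det: "a * e - b * c = 1" using A by (simp add: SL2Z_det a_def b_def c_def e_def)
  define g where "g = gcd (int d * a) c"
  have g: "g > 0" using det d by (auto simp: g_def)
  obtain p s where p: "int d * a = g * p" and s: "c = g * s"
    unfolding g_def by (meson dvdE gcd_dvd1 gcd_dvd2)
  obtain u v where "u * (int d * a) + v * c = g" unfolding g_def using bezout_int by blast
  then have "g * (u * p + v * s) = g * 1" unfolding p s by (simp add: algebra_simps)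
  then have uv: "u * p + v * s = 1" using g by simp
  define \<beta> \<delta> where "\<beta> = u * int d * b + v * e" and "\<delta> = p * e - s * int d * b"
  have g\<delta>: "g * \<delta> = int d"
  proof -
    have "g * \<delta> = (g * p) * e - (g * s) * int d * b" by (simp add: \<delta>_def algebra_simps)
    also have "\<dots> = int d * (a * e - b * c)" unfolding p[symmetric] s[symmetric] by (simp add: algebra_simps)
    finally show ?thesis by (simp add: det)
  qed
  then have \<delta>: "\<delta> > 0" using g d by (metis of_nat_0_less_iff zero_less_mult_pos)
  have "eta_invariant (of_nat d * moebius_act A \<tau>) = eta_invariant ((of_nat (nat g) * \<tau> + of_int \<beta>) / of_nat (nat \<delta>))"
    if \<tau>: "\<tau> \<in> upper_half_plane" for \<tau>
  proof -
    define w where "w = (of_int g * \<tau> + of_int \<beta>) / (of_int \<delta> :: complex)"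
    have "Im w = of_int g * Im \<tau> / of_int \<delta>"
      using Im_divide_of_real[of "of_int g * \<tau> + of_int \<beta>" "of_int \<delta>"] by (simp add: w_def)
    then have "Im w > 0" using g \<delta> \<tau> by (simp add: upper_half_plane_def)
    have det': "p * u - (- v) * s = 1" using uv by (simp add: algebra_simps)
    have \<delta>0: "(of_int \<delta> :: complex) \<noteq> 0" using \<delta> by simp
    have top: "p * g = int d * a" "p * \<beta> - v * \<delta> = int d * b"
    proof -
      have "p * \<beta> - v * \<delta> = int d * b * (u * p + v * s)" by (simp add: \<beta>_def \<delta>_def algebra_simps)
      then show "p * \<beta> - v * \<delta> = int d * b" by (simp add: uv)
    qed (simp add: p)
    have bot: "s * g = c" "s * \<beta> + u * \<delta> = e"
    proof -
      have "s * \<beta> + u * \<delta> = e * (u * p + v * s)" by (simp add: \<beta>_def \<delta>_def algebra_simps)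
      then show "s * \<beta> + u * \<delta> = e" by (simp add: uv)
    qed (simp add: s)
    have "of_int p * w + of_int (- v) = (of_int (p * g) * \<tau> + of_int (p * \<beta> - v * \<delta>)) / (of_int \<delta> :: complex)"
      using \<delta>0 by (simp add: w_def field_simps)
    then have t: "of_int p * w + of_int (- v) = of_nat d * (of_int a * \<tau> + of_int b) / of_int \<delta>"
      unfolding top by (simp add: algebra_simps)
    have "of_int s * w + of_int u = (of_int (s * g) * \<tau> + of_int (s * \<beta> + u * \<delta>)) / (of_int \<delta> :: complex)"
      using \<delta>0 by (simp add: w_def field_simps)
    then have b: "of_int s * w + of_int u = (of_int c * \<tau> + of_int e) / of_int \<delta>"
      unfolding bot .
    have "(of_int p * w + of_int (- v)) / (of_int s * w + of_int u) = of_nat d * moebius_act A \<tau>"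
      unfolding t b using \<delta>0 by (simp add: moebius_act_def a_def b_def c_def e_def)
    with eta_invariant_SL2[OF det' \<open>Im w > 0\<close>] show ?thesis
      using g \<delta> by (simp add: w_def)
  qed
  moreover have "nat g * nat \<delta> = d" using g\<delta> g \<delta> by (metis nat_int nat_mult_distrib less_imp_le)
  ultimately show ?thesis using that by blast
qed

context eta_quotient_level
begin

lemma meromorphic_at_cusps_eta_quotient: "meromorphic_at_cusps weight (eta_quotient D r)"
  unfolding meromorphic_at_cusps_def
proof
  fix A assume A: "A \<in> SL2Z"
  let ?s = "\<Sum>d\<in>D. r d"
  have "\<forall>d\<in>D. \<exists>\<alpha> \<delta> \<beta>. \<alpha> * \<delta> = d \<and> (\<forall>\<tau>\<in>upper_half_plane.
      eta_invariant (of_nat d * moebius_act A \<tau>) = eta_invariant ((of_nat \<alpha> * \<tau> + of_int \<beta>) / of_nat \<delta>))"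
    using eta_invariant_scaled_moebius[OF A D_pos] by metis
  then obtain \<alpha> \<delta> :: "nat \<Rightarrow> nat" and \<beta> :: "nat \<Rightarrow> int" where
    \<alpha>\<delta>: "\<And>d. d \<in> D \<Longrightarrow> \<alpha> d * \<delta> d = d" and
    inv: "\<And>d \<tau>. d \<in> D \<Longrightarrow> \<tau> \<in> upper_half_plane \<Longrightarrow>
      eta_invariant (of_nat d * moebius_act A \<tau>) = eta_invariant ((of_nat (\<alpha> d) * \<tau> + of_int (\<beta> d)) / of_nat (\<delta> d))"
    by metis
  have pos: "\<alpha> d > 0" "\<delta> d > 0" if "d \<in> D" for d
    using \<alpha>\<delta>[OF that] D_pos[OF that] by (auto intro!: Nat.gr0I)
  define w where "w d \<tau> = (of_nat (\<alpha> d) * \<tau> + of_int (\<beta> d)) / (of_nat (\<delta> d) :: complex)" for d \<tau>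
  define m where "m d = real (\<alpha> d) / real (\<delta> d)" for d
  have Im_w: "m d > 0 \<and> Im (w d \<tau>) = m d * Im \<tau>" if "d \<in> D" for d \<tau>
    using pos[OF that] by (simp add: m_def w_def Im_divide_of_nat)
  define f0 where "f0 \<tau> = (\<Prod>d\<in>D. eta (w d \<tau>) powi r d)" for \<tau>
  define \<kappa> where "\<kappa> = (\<Prod>d\<in>D. (m d / real d) powi r d)"
  have \<kappa>: "\<kappa> > 0"
    unfolding \<kappa>_def using Im_w D_pos by (intro prod_pos zero_less_power_int) auto
  have f0_nz: "f0 \<tau> \<noteq> 0" if "\<tau> \<in> upper_half_plane" for \<tau>
    unfolding f0_def using finite_D that Im_w[of _ \<tau>]
    by (auto simp: eta_nz power_int_eq_0_iff upper_half_plane_def)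
  have f0_hol: "f0 holomorphic_on upper_half_plane"
  proof -
    have "(\<lambda>\<tau>. eta (w d \<tau>) powi r d) holomorphic_on upper_half_plane" if d: "d \<in> D" for d
    proof -
      have "w d holomorphic_on upper_half_plane"
        unfolding w_def using pos[OF d] by (intro holomorphic_intros) auto
      then show ?thesis
        using Im_w[OF d] open_upper_half_plane
        by (intro holomorphic_intros disjI2 ballI eta_nz) (auto simp: upper_half_plane_def)
    qed
    then show ?thesis unfolding f0_def by (intro holomorphic_on_prod)
  qed
  have norms: "norm (eta_quotient D r (moebius_act A \<tau>)) ^ 4 = \<kappa> * norm (automorphy weight A \<tau> * f0 \<tau>) ^ 4"
    if \<tau>: "\<tau> \<in> upper_half_plane" for \<tau>
  proof -
    note A\<tau> = moebius_act_in_upper_half_plane[OF A \<tau>]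
    have "norm (eta_quotient D r (moebius_act A \<tau>)) ^ 4 * Im (moebius_act A \<tau>) powi ?s
        = (\<Prod>d\<in>D. (eta_invariant (w d \<tau>) / real d) powi r d)"
      unfolding norm_eta_quotient[OF A\<tau>] w_def using inv \<tau> by (intro prod.cong) auto
    also have "\<dots> = \<kappa> * (\<Prod>d\<in>D. (eta_invariant (w d \<tau>) / m d) powi r d)"
      unfolding \<kappa>_def prod.distrib[symmetric] power_int_mult_distrib[symmetric]
    proof (intro prod.cong refl)
      fix d assume "d \<in> D"
      then have "m d \<noteq> 0" using Im_w by force
      then show "(eta_invariant (w d \<tau>) / real d) powi r d = (m d / real d * (eta_invariant (w d \<tau>) / m d)) powi r d"
        by simp
    qed
    also have "(\<Prod>d\<in>D. (eta_invariant (w d \<tau>) / m d) powi r d) = norm (f0 \<tau>) ^ 4 * Im \<tau> powi ?s"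
      unfolding f0_def using \<tau> Im_w
      by (intro prod_norm_eta_powi[symmetric] finite_D) (auto simp: upper_half_plane_def)
    also have "Im \<tau> powi ?s = Im (moebius_act A \<tau>) powi ?s * norm (automorphy weight A \<tau>) ^ 4"
      by (rule Im_moebius_powi[OF A \<tau>, symmetric])
    finally show ?thesis
      using A\<tau> by (simp add: upper_half_plane_def norm_mult power_mult_distrib mult_ac)
  qed
  define \<kappa>' where "\<kappa>' = root 4 \<kappa>"
  have \<kappa>': "\<kappa>' > 0" "\<kappa>' ^ 4 = \<kappa>" using \<kappa> by (auto simp: \<kappa>'_def)
  define h where "h \<tau> = eta_quotient D r (moebius_act A \<tau>) / (of_real \<kappa>' * (automorphy weight A \<tau> * f0 \<tau>))" for \<tau>
  have "h holomorphic_on upper_half_plane"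
    unfolding h_def using automorphy_nz[OF A] f0_nz \<kappa>'
    by (intro holomorphic_intros holomorphic_on_compose_moebius_act holomorphic_on_automorphy
        holomorphic_eta_quotient f0_hol A) auto
  moreover have "norm (h \<tau>) = 1" if \<tau>: "\<tau> \<in> upper_half_plane" for \<tau>
  proof -
    have "norm (eta_quotient D r (moebius_act A \<tau>)) ^ 4 = (\<kappa>' * norm (automorphy weight A \<tau> * f0 \<tau>)) ^ 4"
      unfolding norms[OF \<tau>] power_mult_distrib \<kappa>' ..
    then have "norm (eta_quotient D r (moebius_act A \<tau>)) = \<kappa>' * norm (automorphy weight A \<tau> * f0 \<tau>)"
      by (rule power_eq_imp_eq_base) (use \<kappa>' in auto)
    then show ?thesis
      unfolding h_def norm_divide norm_mult using \<kappa>' automorphy_nz[OF A \<tau>] f0_nz[OF \<tau>] by simp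
  qed
  ultimately obtain c where c: "\<And>\<tau>. \<tau> \<in> upper_half_plane \<Longrightarrow> h \<tau> = c"
    using unimodular_holomorphic_constant by blast

  define n where "n d = \<alpha> d * (N div \<delta> d)" for d
  have nd: "of_nat (\<alpha> d) * of_nat N / (of_nat (\<delta> d) :: complex) = of_nat (n d)" "n d > 0" if d: "d \<in> D" for d
  proof -
    have "\<delta> d dvd N" using \<alpha>\<delta>[OF d] D[OF d] by (metis dvd_mult_right)
    then obtain j where j: "N = \<delta> d * j" by blast
    show "of_nat (\<alpha> d) * of_nat N / (of_nat (\<delta> d) :: complex) = of_nat (n d)" "n d > 0"
      using pos[OF d] N unfolding n_def j by auto
  qed
  define \<rho> where "\<rho> d = qexp (of_int (\<beta> d) / of_nat (\<delta> d))" for d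
  define G where "G d Q = qexp (of_int (\<beta> d) / (24 * of_nat (\<delta> d))) * Q ^ n d
      * qpoch_inf (\<rho> d * Q ^ (24 * n d)) (\<rho> d * Q ^ (24 * n d))" for d Q
  have \<rho>: "norm (\<rho> d) = 1" for d by (simp add: \<rho>_def norm_qexp Im_divide_of_nat)
  have "G d meromorphic_on {0}" if d: "d \<in> D" for d
  proof -
    have "norm (\<rho> d * Q ^ (24 * n d)) < 1" if "Q \<in> ball 0 1" for Q
      using that nd[OF d] by (simp add: norm_mult \<rho> norm_power power_less_one_iff)
    then have "G d holomorphic_on ball 0 1"
      unfolding G_def by (intro holomorphic_intros holomorphic_on_qpoch_inf) auto
    then have "G d analytic_on ball 0 1" by (simp add: analytic_on_open)
    then have "G d analytic_on {0}" by (rule analytic_on_subset) auto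
    then show ?thesis by (rule analytic_on_imp_meromorphic_on)
  qed
  then have "(\<lambda>Q. c * of_real \<kappa>' * (\<Prod>d\<in>D. G d Q powi r d)) meromorphic_on {0}"
    by (intro meromorphic_intros)
  moreover have "eta_quotient D r (moebius_act A \<tau>) / automorphy weight A \<tau>
      = c * of_real \<kappa>' * (\<Prod>d\<in>D. G d (exp (2 * of_real pi * \<i> * \<tau> / of_nat (24 * N))) powi r d)"
    if \<tau>: "\<tau> \<in> upper_half_plane" for \<tau>
  proof -
    define Q where "Q = qexp (\<tau> / of_nat (24 * N))"
    have "eta (w d \<tau>) = G d Q" if d: "d \<in> D" for d
    proof -
      have e: "w d \<tau> = of_int (\<beta> d) / of_nat (\<delta> d) + of_nat (24 * n d) * (\<tau> / of_nat (24 * N))"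
        unfolding of_nat_mult[of 24 "n d"] nd(1)[OF d, symmetric] w_def using N pos[OF d] by (simp add: field_simps)
      have e24: "w d \<tau> / 24 = of_int (\<beta> d) / (24 * of_nat (\<delta> d)) + of_nat (n d) * (\<tau> / of_nat (24 * N))"
        unfolding e by (simp add: field_simps)
      have "qexp (w d \<tau> / 24) = qexp (of_int (\<beta> d) / (24 * of_nat (\<delta> d))) * Q ^ n d"
        unfolding e24 qexp_add qexp_of_nat_mult Q_def ..
      moreover have "qexp (w d \<tau>) = \<rho> d * Q ^ (24 * n d)"
        unfolding e qexp_add qexp_of_nat_mult Q_def \<rho>_def ..
      ultimately show ?thesis by (simp only: eta_def G_def)
    qed
    then have "f0 \<tau> = (\<Prod>d\<in>D. G d Q powi r d)" by (simp add: f0_def)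
    moreover have "Q = exp (2 * of_real pi * \<i> * \<tau> / of_nat (24 * N))" by (simp add: Q_def qexp_def)
    moreover have "eta_quotient D r (moebius_act A \<tau>) / automorphy weight A \<tau> = c * of_real \<kappa>' * f0 \<tau>"
      using c[OF \<tau>] \<kappa>' automorphy_nz[OF A \<tau>] f0_nz[OF \<tau>] by (simp add: h_def field_simps)
    ultimately show ?thesis by simp
  qed
  ultimately show "\<exists>N>0. \<exists>g. g meromorphic_on {0} \<and> (\<forall>\<tau>\<in>upper_half_plane.
      eta_quotient D r (moebius_act A \<tau>) / automorphy weight A \<tau> = g (exp (2 * of_real pi * \<i> * \<tau> / of_nat N)))"
    using N by (intro exI[of _ "24 * N"] conjI exI[of _ "\<lambda>Q. c * of_real \<kappa>' * (\<Prod>d\<in>D. G d Q powi r d)"]) auto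
qed

theorem modular_form_eta_quotient:
  assumes f: "\<And>\<tau>. \<tau> \<in> upper_half_plane \<Longrightarrow> f \<tau> = C * eta_quotient D r \<tau>" and C: "C \<noteq> 0"
  obtains v where "modular_form weight (Gamma0 N) v f"
proof (rule modular_form_of_norm[of "Gamma0 N" f weight])
  have "(\<lambda>\<tau>. C * eta_quotient D r \<tau>) holomorphic_on upper_half_plane"
    by (intro holomorphic_intros holomorphic_eta_quotient)
  then show "f holomorphic_on upper_half_plane" by (rule holomorphic_transform) (simp add: f)
  show "Gamma0 N \<subseteq> SL2Z" by (auto simp: Gamma0_def)
  show "f \<tau> \<noteq> 0" if "\<tau> \<in> upper_half_plane" for \<tau>
    using that by (simp add: f C eta_quotient_nz)
  show "norm (f (moebius_act A \<tau>)) = norm (automorphy weight A \<tau>) * norm (f \<tau>)"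
    if "A \<in> Gamma0 N" "\<tau> \<in> upper_half_plane" for A \<tau>
    using that moebius_act_in_upper_half_plane[of A \<tau>] norm_eta_quotient_Gamma0[OF that]
    by (simp add: Gamma0_def f norm_mult)
  show "meromorphic_at_cusps weight f"
    unfolding meromorphic_at_cusps_def
  proof
    fix A assume A: "A \<in> SL2Z"
    then obtain M g where g: "M > 0" "g meromorphic_on {0}"
      "\<And>\<tau>. \<tau> \<in> upper_half_plane \<Longrightarrow> eta_quotient D r (moebius_act A \<tau>) / automorphy weight A \<tau> = g (exp (2 * of_real pi * \<i> * \<tau> / of_nat M))"
      using meromorphic_at_cusps_eta_quotient unfolding meromorphic_at_cusps_def by metis
    have "f (moebius_act A \<tau>) / automorphy weight A \<tau> = C * g (exp (2 * of_real pi * \<i> * \<tau> / of_nat M))"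
      if "\<tau> \<in> upper_half_plane" for \<tau>
      using g(3)[OF that] moebius_act_in_upper_half_plane[OF A that] by (simp add: f flip: times_divide_eq_right)
    moreover have "(\<lambda>Q. C * g Q) meromorphic_on {0}" by (intro meromorphic_intros g(2))
    ultimately show "\<exists>N>0. \<exists>g. g meromorphic_on {0} \<and> (\<forall>\<tau>\<in>upper_half_plane.
        f (moebius_act A \<tau>) / automorphy weight A \<tau> = g (exp (2 * of_real pi * \<i> * \<tau> / of_nat N)))"
      using g(1) by blast
  qed
qed (use Gamma0_mult_closed that in auto)

end


lemma eta_multiple:
  "eta (of_nat d * \<tau>) = qexp (of_nat d * \<tau> / 24) * qpoch_inf (qexp \<tau> ^ d) (qexp \<tau> ^ d)"
  by (simp add: eta_def qexp_of_nat_mult)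

lemma qexp_powi: "qexp z powi n = qexp (of_int n * z)"
  by (simp add: qexp_def exp_power_int mult_ac)

lemma punctured_unit_disc_qexp: "\<tau> \<in> upper_half_plane \<Longrightarrow> punctured_unit_disc (qexp \<tau>)"
  by unfold_locales (auto simp: upper_half_plane_def norm_qexp_lt_1)

lemma modular_up_to_q_power_eta_quotient:
  fixes e :: rat
  assumes lvl: "eta_quotient_level N D" and wt: "eta_quotient_level.weight D r = k" and C: "C \<noteq> 0"
    and F: "\<And>\<tau>. \<tau> \<in> upper_half_plane \<Longrightarrow> qexp (of_rat e * \<tau>) * F (qexp \<tau>) = C * eta_quotient D r \<tau>"
  shows "modular_up_to_q_power k (Gamma0 N) F"
proof -
  have "exp (2 * of_real pi * \<i> * of_rat e * \<tau>) * F (exp (2 * of_real pi * \<i> * \<tau>)) = C * eta_quotient D r \<tau>"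
    if "\<tau> \<in> upper_half_plane" for \<tau>
    using F[OF that] by (simp add: qexp_def mult.assoc)
  from eta_quotient_level.modular_form_eta_quotient[OF lvl this C] show ?thesis
    unfolding modular_up_to_q_power_def wt by blast
qed

lemma modular_multiple_of_B_phi:
  assumes C: "C \<noteq> 0" and F: "\<And>q. punctured_unit_disc q \<Longrightarrow> F q = C * B_phi q"
  shows "modular_up_to_q_power (1 / 2) (Gamma0 4) F"
proof -
  define r :: "nat \<Rightarrow> int" where "r d = (if d = 2 then 7 else - 3)" for d
  have lvl: "eta_quotient_level 4 {1, 2, 4}" by unfold_locales auto
  show ?thesis
  proof (rule modular_up_to_q_power_eta_quotient[OF lvl _ C, where e = "- 1 / 24"])
    show "eta_quotient_level.weight {1, 2, 4} r = 1 / 2"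
      unfolding eta_quotient_level.weight_def[OF lvl] by (simp add: r_def)
    fix \<tau> assume \<tau>: "\<tau> \<in> upper_half_plane"
    note disc = punctured_unit_disc_qexp[OF \<tau>]
    define e1 e2 e4 where "e1 = qpoch_inf (qexp \<tau>) (qexp \<tau>)"
      and "e2 = qpoch_inf (qexp \<tau> ^ 2) (qexp \<tau> ^ 2)" and "e4 = qpoch_inf (qexp \<tau> ^ 4) (qexp \<tau> ^ 4)"
    have "eta_quotient {1, 2, 4} r \<tau> = eta (of_nat 1 * \<tau>) powi (- 3) * (eta (of_nat 2 * \<tau>) powi 7 * eta (of_nat 4 * \<tau>) powi (- 3))"
      by (simp add: eta_quotient_def r_def)
    also have "\<dots> = (qexp (of_nat 1 * \<tau> / 24) powi (- 3) * qexp (of_nat 2 * \<tau> / 24) powi 7 * qexp (of_nat 4 * \<tau> / 24) powi (- 3))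
        * (e1 powi (- 3) * e2 powi 7 * e4 powi (- 3))"
      unfolding eta_multiple power_int_mult_distrib e1_def e2_def e4_def power_one_right by (simp only: mult_ac)
    finally have quot: "eta_quotient {1, 2, 4} r \<tau> = (qexp (of_nat 1 * \<tau> / 24) powi (- 3) * qexp (of_nat 2 * \<tau> / 24) powi 7 * qexp (of_nat 4 * \<tau> / 24) powi (- 3))
        * (e1 powi (- 3) * e2 powi 7 * e4 powi (- 3))" .
    have q_power: "qexp (of_nat 1 * \<tau> / 24) powi (- 3) * qexp (of_nat 2 * \<tau> / 24) powi 7 * qexp (of_nat 4 * \<tau> / 24) powi (- 3)
        = qexp (of_rat (- 1 / 24) * \<tau>)"
      unfolding qexp_powi qexp_add[symmetric] by (rule arg_cong[where f = qexp]) (simp add: of_rat_divide of_rat_minus field_simps)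
    have euler: "e1 powi (- 3) * e2 powi 7 * e4 powi (- 3) = B_phi (qexp \<tau>)"
      unfolding punctured_unit_disc.B_phi_product[OF disc] e1_def[symmetric] e2_def[symmetric] e4_def[symmetric]
      by (simp add: power_int_minus divide_inverse)
    show "qexp (of_rat (- 1 / 24) * \<tau>) * F (qexp \<tau>) = C * eta_quotient {1, 2, 4} r \<tau>"
      unfolding quot q_power euler F[OF disc] by (simp only: mult_ac)
  qed
qed

lemma modular_B_nu: "modular_up_to_q_power (1 / 2) (Gamma0 4) B_nu"
proof -
  define r :: "nat \<Rightarrow> int" where "r d = (if d = 2 then - 2 else 3)" for d
  have lvl: "eta_quotient_level 4 {2, 4}" by unfold_locales auto
  show ?thesis
  proof (rule modular_up_to_q_power_eta_quotient[OF lvl, where e = "1 / 3" and C = 2])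
    show "eta_quotient_level.weight {2, 4} r = 1 / 2"
      unfolding eta_quotient_level.weight_def[OF lvl] by (simp add: r_def)
    fix \<tau> assume \<tau>: "\<tau> \<in> upper_half_plane"
    note disc = punctured_unit_disc_qexp[OF \<tau>]
    define e2 e4 where "e2 = qpoch_inf (qexp \<tau> ^ 2) (qexp \<tau> ^ 2)" and "e4 = qpoch_inf (qexp \<tau> ^ 4) (qexp \<tau> ^ 4)"
    have "eta_quotient {2, 4} r \<tau> = eta (of_nat 2 * \<tau>) powi (- 2) * eta (of_nat 4 * \<tau>) powi 3"
      by (simp add: eta_quotient_def r_def)
    also have "\<dots> = (qexp (of_nat 2 * \<tau> / 24) powi (- 2) * qexp (of_nat 4 * \<tau> / 24) powi 3) * (e2 powi (- 2) * e4 powi 3)"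
      unfolding eta_multiple power_int_mult_distrib e2_def e4_def by (simp only: mult_ac)
    finally have quot: "eta_quotient {2, 4} r \<tau>
        = (qexp (of_nat 2 * \<tau> / 24) powi (- 2) * qexp (of_nat 4 * \<tau> / 24) powi 3) * (e2 powi (- 2) * e4 powi 3)" .
    have q_power: "qexp (of_nat 2 * \<tau> / 24) powi (- 2) * qexp (of_nat 4 * \<tau> / 24) powi 3 = qexp (of_rat (1 / 3) * \<tau>)"
      unfolding qexp_powi qexp_add[symmetric] by (rule arg_cong[where f = qexp]) (simp add: of_rat_divide field_simps)
    have "e2 powi (- 2) = 1 / e2\<^sup>2" "e4 powi 3 = e4 ^ 3"
      using power_int_minus[of e2 2] by (simp_all add: inverse_eq_divide)
    then have euler: "e2 powi (- 2) * e4 powi 3 = B_nu (qexp \<tau>) / 2"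
      unfolding punctured_unit_disc.B_nu_product[OF disc] e2_def[symmetric] e4_def[symmetric] by simp
    show "qexp (of_rat (1 / 3) * \<tau>) * B_nu (qexp \<tau>) = 2 * eta_quotient {2, 4} r \<tau>"
      unfolding quot q_power euler by simp
  qed simp
qed

theorem theorem5p2:
  shows "(\<forall>k::nat. \<forall>\<zeta>::complex. k \<ge> 1 \<longrightarrow>
            (primitive_root_of_unity (4 * k) \<zeta> \<longrightarrow>
               has_radial_limit (\<lambda>q. mock_phi q - B_phi q) \<zeta>
                 (- 2 * \<zeta> * (\<Sum>n=0..k-1. \<zeta> ^ n * qpoch_fin (- (\<zeta>\<^sup>2)) (\<zeta>\<^sup>2) n))) \<and>
            (primitive_root_of_unity (2 * k - 1) \<zeta> \<longrightarrow>
               has_radial_limit (\<lambda>q. mock_psi q - B_psi q) \<zeta>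
                 (- (\<Sum>n=0..k-1. (- 1) ^ n * qpoch_fin \<zeta> (\<zeta>\<^sup>2) n))) \<and>
            (primitive_root_of_unity (4 * k - 2) \<zeta> \<longrightarrow>
               has_radial_limit (\<lambda>q. mock_nu q - B_nu q) \<zeta>
                 (- (\<Sum>n=0..k-1. \<zeta> ^ n * qpoch_fin (- \<zeta>) (\<zeta>\<^sup>2) n))))
       \<and> (\<forall>F \<in> {B_phi, B_psi, B_nu}. modular_up_to_q_power (1/2) (Gamma0 4) F)"
proof -
  have "{0..k - 1} = {..<k}" if "k \<ge> 1" for k :: nat using that by auto
  moreover have "modular_up_to_q_power (1 / 2) (Gamma0 4) B_phi"
    by (rule modular_multiple_of_B_phi[where C = 1]) auto
  moreover have "modular_up_to_q_power (1 / 2) (Gamma0 4) B_psi"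
    by (rule modular_multiple_of_B_phi[where C = "1 / 2"])
       (auto simp: punctured_unit_disc.B_psi_eq_half_B_phi)
  ultimately show ?thesis
    using radial_limit_phi radial_limit_psi radial_limit_nu modular_B_nu by simp
qed

end
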